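(* Let $n\ge3$ and let $X(a_1,\dots,a_n)$ be a Kollár hypersurface of type $(a_1,\dots,a_n)$. Then there is a birational map $X(a_1,\dots,a_n)\dashrightarrow Y'$.
   Context: The ground field is $\mathbb{C}$; $n\geq3$ is an integer and indices are taken modulo $n$. Let $a_1,\dots,a_n$ be positive integers such that, when $n$ is even, $(a_i,a_{i+2},\dots,a_{i+n-2})\ne(1,\dots,1)$ for all $i$. Put $W_i=\sum_{j=1}^n(-1)^{j-1}\prod_{l=i+j}^{i+n-1}a_l$ (empty products equal $1$), $w^*=\gcd(W_1,\dots,W_n)$, $w_i=W_i/w^*$. The Kollár hypersurface is $X(a_1,\dots,a_n)=(x_1^{a_1}x_2+x_2^{a_2}x_3+\cdots+x_n^{a_n}x_1=0)\subset\mathbb{P}(w_1,\dots,w_n)$. One has $\gcd(a_i,w^* )=1$ for all $i$. Definition of $Y'$: let $\mathbb{P}^{n-2}=\{y_1+\cdots+y_n=0\}\subset\mathbb{P}^{n-1}$ and $L_i=\{y_i=0\}\subset\mathbb{P}^{n-2}$. Let $0<\mu_i<w^*$ be the integers with $\mu_i\equiv(-1)^{i+1}\prod_{l=i+1}^{n}a_l\pmod{w^*}$ for $i=1,\dots,n$ (so $\mu_n\equiv(-1)^{n+1}$). Then $w^*\mid\sum_i\mu_i$; write $tw^*=\sum_i\mu_i$. $Y'$ is the normalization of the cyclic cover $Y_0=\mathrm{Spec}_{\mathbb{P}^{n-2}}\big(\bigoplus_{i=0}^{w^*-1}\mathcal{O}_{\mathbb{P}^{n-2}}(-ti)\big)\to\mathbb{P}^{n-2}$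 defined by $\mathcal{O}_{\mathbb{P}^{n-2}}(t)^{\otimes w^*}\simeq\mathcal{O}_{\mathbb{P}^{n-2}}(\mu_1L_1+\cdots+\mu_nL_n)$; explicitly $Y'=\mathrm{Spec}_{\mathbb{P}^{n-2}}\big(\bigoplus_{i=0}^{w^*-1}{\mathcal{L}^{(i)}}^{-1}\big)$, $\mathcal{L}^{(i)}=\mathcal{O}_{\mathbb{P}^{n-2}}(ti)\otimes\mathcal{O}_{\mathbb{P}^{n-2}}\big(-\sum_{j=1}^n\lfloor\mu_ji/w^*\rfloor L_j\big)$. When $w^*=1$, $Y'=\mathbb{P}^{n-2}$. *)

theory Defs
  imports "HOL-Analysis.Analysis" "HOL-Algebra.Ring"
begin

section \<open>Complex varieties as spaces with functions\<close>

text \<open>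
  Varieties over the complex numbers are described classically, by their closed points, their
  Zariski topology and their regular functions.  Whether \<open>f \<in> funs X U\<close> holds depends only on the
  values of \<open>f\<close> on the open set \<open>U\<close>.
\<close>

record 'a fspace =
  zar :: "'a topology"
  funs :: "'a set \<Rightarrow> ('a \<Rightarrow> complex) set"

definition morphism :: "'a fspace \<Rightarrow> 'b fspace \<Rightarrow> ('a \<Rightarrow> 'b) \<Rightarrow> bool" where
  "morphism X Y f \<longleftrightarrow>
     continuous_map (zar X) (zar Y) f \<and>
     (\<forall>V h. openin (zar Y) V \<longrightarrow> h \<in> funs Y V \<longrightarrow>
        h \<circ> f \<in> funs X {x \<in> topspace (zar X). f x \<in> V})"

definition open_subspace :: "'a fspace \<Rightarrow> 'a set \<Rightarrow> 'a fspace" where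
  "open_subspace X U = \<lparr>zar = subtopology (zar X) U, funs = funs X\<rparr>"

definition dense_open :: "'a fspace \<Rightarrow> 'a set \<Rightarrow> bool" where
  "dense_open X U \<longleftrightarrow> openin (zar X) U \<and> zar X closure_of U = topspace (zar X)"

definition birational_map ::
    "'a fspace \<Rightarrow> 'b fspace \<Rightarrow> 'a set \<Rightarrow> ('a \<Rightarrow> 'b) \<Rightarrow> bool" where
  "birational_map X Y U f \<longleftrightarrow>
     dense_open X U \<and>
     (\<exists>V g. dense_open Y V \<and>
        morphism (open_subspace X U) (open_subspace Y V) f \<and>
        morphism (open_subspace Y V) (open_subspace X U) g \<and>
        (\<forall>x\<in>U. g (f x) = x) \<and> (\<forall>y\<in>V. f (g y) = y))"

definition birational :: "'a fspace \<Rightarrow> 'b fspace \<Rightarrow> bool" where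
  "birational X Y \<longleftrightarrow> (\<exists>U f. birational_map X Y U f)"


section \<open>Subvarieties of weighted projective spaces\<close>

text \<open>
  Coordinates are indexed by \<open>{1..n}\<close>; a vector is a function vanishing off \<open>{1..n}\<close>.  A point of
  \<open>\<P>(w\<^sub>1,\<dots>,w\<^sub>n)\<close> is an orbit of the multiplicative group, as a set of vectors.
  Hence \<open>\<Union>U\<close> is the punctured affine cone over a set \<open>U\<close> of points.
\<close>

type_synonym vec = "nat \<Rightarrow> complex"
type_synonym point = "vec set"

definition vecs :: "nat \<Rightarrow> vec set" where
  "vecs n = {x. \<forall>i. i \<notin> {1..n} \<longrightarrow> x i = 0}"

definition orbit :: "(nat \<Rightarrow> nat) \<Rightarrow> vec \<Rightarrow> point" where
  "orbit w x = {(\<lambda>i. c ^ w i * x i) | c. c \<noteq> 0}"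

definition wproj :: "nat \<Rightarrow> (nat \<Rightarrow> nat) \<Rightarrow> point set" where
  "wproj n w = {orbit w x | x. x \<in> vecs n \<and> x \<noteq> (\<lambda>_. 0)}"

text \<open>Weighted homogeneous polynomials of degree \<open>d\<close>; \<open>m \<in> M\<close> are exponent vectors.\<close>

definition whom :: "nat \<Rightarrow> (nat \<Rightarrow> nat) \<Rightarrow> nat \<Rightarrow> (vec \<Rightarrow> complex) \<Rightarrow> bool" where
  "whom n w d F \<longleftrightarrow>
     (\<exists>(M :: (nat \<Rightarrow> nat) set) c. finite M \<and> (\<forall>m\<in>M. (\<Sum>i=1..n. w i * m i) = d) \<and>
        F = (\<lambda>x. \<Sum>m\<in>M. c m * (\<Prod>i=1..n. x i ^ m i)))"

definition wproj_zariski :: "nat \<Rightarrow> (nat \<Rightarrow> nat) \<Rightarrow> point topology" where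
  "wproj_zariski n w =
     topology_generated_by {{p \<in> wproj n w. \<forall>x\<in>p. F x \<noteq> 0} | F. \<exists>d. whom n w d F}"

text \<open>
  \<open>twist n w Z k U\<close>: the sections over \<open>U\<close> of the sheaf \<open>\<O>\<^sub>Z(k)\<close>, as functions on the cone over \<open>U\<close>
  (extended by \<open>0\<close>) that are locally quotients \<open>F / G\<close> of weighted homogeneous polynomials with
  \<open>deg F - deg G = k\<close>.
\<close>

definition twist ::
    "nat \<Rightarrow> (nat \<Rightarrow> nat) \<Rightarrow> point set \<Rightarrow> int \<Rightarrow> point set \<Rightarrow> (vec \<Rightarrow> complex) set" where
  "twist n w Z k U =
     {s. (\<forall>x. x \<notin> \<Union>U \<longrightarrow> s x = 0) \<and>
         (\<forall>p\<in>U. \<exists>V d e F G.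
            openin (subtopology (wproj_zariski n w) Z) V \<and> p \<in> V \<and> V \<subseteq> U \<and>
            whom n w d F \<and> whom n w e G \<and> int d - int e = k \<and>
            (\<forall>x\<in>\<Union>V. G x \<noteq> 0 \<and> s x = F x / G x))}"

text \<open>
  The reduced closed subvariety with point set \<open>Z\<close>; a regular function is a section of
  \<open>\<O>\<^sub>Z = \<O>\<^sub>Z(0)\<close>, which is constant on orbits.
\<close>

definition wproj_subvariety :: "nat \<Rightarrow> (nat \<Rightarrow> nat) \<Rightarrow> point set \<Rightarrow> point fspace" where
  "wproj_subvariety n w Z =
     \<lparr>zar = subtopology (wproj_zariski n w) Z,
      funs = (\<lambda>U. {f. \<exists>s \<in> twist n w Z 0 U. \<forall>p\<in>U. \<forall>x\<in>p. f p = s x})\<rparr>"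


section \<open>Relative spectra\<close>

text \<open>
  A sheaf of algebras on a space with functions: rings of sections, restriction
  (\<open>restr V\<close> restricts to \<open>V\<close>), and the structure map from regular functions.
\<close>

record ('p, 's) alg_sheaf =
  sect :: "'p set \<Rightarrow> 's ring"
  restr :: "'p set \<Rightarrow> 's \<Rightarrow> 's"
  scal :: "'p set \<Rightarrow> ('p \<Rightarrow> complex) \<Rightarrow> 's"

definition complex_ring :: "complex ring" where
  "complex_ring = \<lparr>carrier = UNIV, mult = (*), one = 1, zero = 0, add = (+)\<rparr>"

text \<open>
  For a quasi-coherent sheaf \<open>A\<close> of algebras of finite type, the closed points of \<open>Spec\<^sub>B A\<close> over
  \<open>p \<in> B\<close> are the ring homomorphisms from the stalk \<open>A\<^sub>p\<close> to the complex numbers that restrict to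
  evaluation at \<open>p\<close> on the regular functions.  As \<open>A\<^sub>p\<close> is the colimit of the rings of sections over
  the open neighbourhoods \<open>U\<close> of \<open>p\<close>, such a homomorphism is a family \<open>\<phi> U\<close> compatible
  with restriction.  The first condition only makes \<open>\<phi>\<close> unique as a function.
\<close>

definition stalk_hom ::
    "'p fspace \<Rightarrow> ('p, 's) alg_sheaf \<Rightarrow> 'p \<Rightarrow> ('p set \<Rightarrow> 's \<Rightarrow> complex) \<Rightarrow> bool" where
  "stalk_hom B A p \<phi> \<longleftrightarrow>
     (\<forall>U s. \<not> (openin (zar B) U \<and> p \<in> U \<and> s \<in> carrier (sect A U)) \<longrightarrow> \<phi> U s = 0) \<and>
     (\<forall>U. openin (zar B) U \<and> p \<in> U \<longrightarrow>
        \<phi> U \<in> ring_hom (sect A U) complex_ring \<and>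
        (\<forall>f \<in> funs B U. \<phi> U (scal A U f) = f p) \<and>
        (\<forall>V s. openin (zar B) V \<and> p \<in> V \<and> V \<subseteq> U \<and> s \<in> carrier (sect A U) \<longrightarrow>
           \<phi> V (restr A V s) = \<phi> U s))"

type_synonym ('p, 's) spec_point = "'p \<times> ('p set \<Rightarrow> 's \<Rightarrow> complex)"

definition spec_points :: "'p fspace \<Rightarrow> ('p, 's) alg_sheaf \<Rightarrow> ('p, 's) spec_point set" where
  "spec_points B A = {(p, \<phi>). p \<in> topspace (zar B) \<and> stalk_hom B A p \<phi>}"

definition spec_zariski :: "'p fspace \<Rightarrow> ('p, 's) alg_sheaf \<Rightarrow> ('p, 's) spec_point topology" where
  "spec_zariski B A =
     topology_generated_by
       {{q \<in> spec_points B A. fst q \<in> U \<and> snd q U s \<noteq> 0} | U s.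
          openin (zar B) U \<and> s \<in> carrier (sect A U)}"

definition rel_spec :: "'p fspace \<Rightarrow> ('p, 's) alg_sheaf \<Rightarrow> ('p, 's) spec_point fspace" where
  "rel_spec B A =
     \<lparr>zar = spec_zariski B A,
      funs = (\<lambda>W. {f. \<forall>q\<in>W. \<exists>N U s s'.
         openin (spec_zariski B A) N \<and> q \<in> N \<and> N \<subseteq> W \<and>
         openin (zar B) U \<and> s \<in> carrier (sect A U) \<and> s' \<in> carrier (sect A U) \<and>
         (\<forall>r\<in>N. fst r \<in> U \<and> snd r U s' \<noteq> 0 \<and> f r = snd r U s / snd r U s')})\<rparr>"


section \<open>Kollar hypersurfaces\<close>

text \<open>The representative in \<open>{1..n}\<close> of a positive integer modulo \<open>n\<close>.\<close>

definition cyc :: "nat \<Rightarrow> nat \<Rightarrow> nat" where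
  "cyc n i = (i - 1) mod n + 1"

definition kollar_type :: "nat \<Rightarrow> (nat \<Rightarrow> nat) \<Rightarrow> bool" where
  "kollar_type n a \<longleftrightarrow>
     (\<forall>i\<in>{1..n}. a i > 0) \<and>
     (even n \<longrightarrow> (\<forall>i\<in>{1..n}. \<exists>k < n div 2. a (cyc n (i + 2 * k)) \<noteq> 1))"

definition W :: "nat \<Rightarrow> (nat \<Rightarrow> nat) \<Rightarrow> nat \<Rightarrow> int" where
  "W n a i = (\<Sum>j=1..n. (-1) ^ (j - 1) * (\<Prod>l=i+j..i+n-1. int (a (cyc n l))))"

definition wstar :: "nat \<Rightarrow> (nat \<Rightarrow> nat) \<Rightarrow> nat" where
  "wstar n a = nat (Gcd (W n a ` {1..n}))"

definition weight :: "nat \<Rightarrow> (nat \<Rightarrow> nat) \<Rightarrow> nat \<Rightarrow> nat" where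
  "weight n a i = nat (W n a i div int (wstar n a))"

definition kollar_hypersurface :: "nat \<Rightarrow> (nat \<Rightarrow> nat) \<Rightarrow> point fspace" where
  "kollar_hypersurface n a =
     wproj_subvariety n (weight n a)
       {p \<in> wproj n (weight n a). \<forall>x\<in>p. (\<Sum>i=1..n. x i ^ a i * x (cyc n (i + 1))) = 0}"


section \<open>The normalized cyclic cover\<close>

text \<open>\<open>\<P>\<^sup>n\<^sup>-\<^sup>2\<close> as the hyperplane \<open>y\<^sub>1 + \<dots> + y\<^sub>n = 0\<close> in \<open>\<P>\<^sup>n\<^sup>-\<^sup>1\<close>.\<close>

definition hyp_points :: "nat \<Rightarrow> point set" where
  "hyp_points n = {p \<in> wproj n (\<lambda>_. 1). \<forall>y\<in>p. (\<Sum>i=1..n. y i) = 0}"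

definition hyp :: "nat \<Rightarrow> point fspace" where
  "hyp n = wproj_subvariety n (\<lambda>_. 1) (hyp_points n)"

text \<open>The cone over the part of \<open>U\<close> outside the hyperplanes \<open>L\<^sub>j = {y\<^sub>j = 0}\<close>.\<close>

definition torus_cone :: "nat \<Rightarrow> point set \<Rightarrow> vec set" where
  "torus_cone n U = {y \<in> \<Union>U. \<forall>j\<in>{1..n}. y j \<noteq> 0}"

text \<open>
  Sections over \<open>U\<close> of \<open>\<O>(k) \<otimes> \<O>(\<Sum>\<^sub>j D\<^sub>j L\<^sub>j)\<close> on \<open>\<P>\<^sup>n\<^sup>-\<^sup>2\<close>: rational sections \<open>s\<close> of \<open>\<O>(k)\<close> with
  \<open>div s + \<Sum>\<^sub>j D\<^sub>j L\<^sub>j \<ge> 0\<close> on \<open>U\<close>, that is, with \<open>s \<cdot> \<Prod>\<^sub>j y\<^sub>j\<^sup>D\<^sup>j\<close> a regular section of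
  \<open>\<O>(k + \<Sum>\<^sub>j D\<^sub>j)\<close>.  They are regular off the \<open>L\<^sub>j\<close> and are represented by their restriction
  to that dense open set, extended by \<open>0\<close>.
\<close>

definition twist_div :: "nat \<Rightarrow> int \<Rightarrow> (nat \<Rightarrow> int) \<Rightarrow> point set \<Rightarrow> (vec \<Rightarrow> complex) set" where
  "twist_div n k D U =
     {s. (\<forall>y. y \<notin> torus_cone n U \<longrightarrow> s y = 0) \<and>
         (\<exists>g \<in> twist n (\<lambda>_. 1) (hyp_points n) (k + (\<Sum>j=1..n. D j)) U.
            \<forall>y \<in> torus_cone n U. s y * (\<Prod>j=1..n. y j powi D j) = g y)}"

text \<open>
  The least nonnegative residue.  When \<open>wstar n a > 1\<close> it is the required integer strictly between
  \<open>0\<close> and \<open>wstar n a\<close>, because \<open>wstar n a\<close> is coprime to every \<open>a l\<close>.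
\<close>

definition mu :: "nat \<Rightarrow> (nat \<Rightarrow> nat) \<Rightarrow> nat \<Rightarrow> nat" where
  "mu n a i = nat (((-1) ^ (i + 1) * (\<Prod>l=i+1..n. int (a l))) mod int (wstar n a))"

definition tt :: "nat \<Rightarrow> (nat \<Rightarrow> nat) \<Rightarrow> nat" where
  "tt n a = (\<Sum>i=1..n. mu n a i) div wstar n a"

text \<open>
  The sheaf of algebras \<open>\<Oplus>\<^sub>i \<L>\<^sup>(\<^sup>i\<^sup>)\<^sup>-\<^sup>1\<close> for \<open>0 \<le> i < r = wstar n a\<close>, where
  \<open>\<L>\<^sup>(\<^sup>i\<^sup>)\<^sup>-\<^sup>1 = \<O>(-ti) \<otimes> \<O>(\<Sum>\<^sub>j \<lfloor>\<mu>\<^sub>j i / r\<rfloor> L\<^sub>j)\<close>.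
  A section \<open>s\<close> stands for \<open>\<Sum>\<^sub>i s\<^sub>i z\<^sup>i\<close>.  The multiplication is the one of the cyclic cover: in
  degrees \<open>i + j \<ge> r\<close> the isomorphism \<open>\<O>(t)\<^sup>\<otimes>\<^sup>r \<cong> \<O>(\<Sum>\<^sub>j \<mu>\<^sub>j L\<^sub>j)\<close> gives the
  relation \<open>z\<^sup>r = \<Prod>\<^sub>j y\<^sub>j\<^sup>\<mu>\<^sup>j\<close>.
\<close>

type_synonym cover_section = "nat \<Rightarrow> vec \<Rightarrow> complex"

definition L_inv :: "nat \<Rightarrow> (nat \<Rightarrow> nat) \<Rightarrow> nat \<Rightarrow> point set \<Rightarrow> (vec \<Rightarrow> complex) set" where
  "L_inv n a i =
     twist_div n (- int (tt n a * i)) (\<lambda>j. \<lfloor>of_nat (mu n a j * i) / of_nat (wstar n a) :: real\<rfloor>)"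

definition cover_mult ::
    "nat \<Rightarrow> (nat \<Rightarrow> nat) \<Rightarrow> cover_section \<Rightarrow> cover_section \<Rightarrow> cover_section" where
  "cover_mult n a s s' = (\<lambda>k y. if k < wstar n a then
     (\<Sum>i<wstar n a. \<Sum>j<wstar n a.
        if i + j = k then s i y * s' j y
        else if i + j = k + wstar n a then s i y * s' j y * (\<Prod>l=1..n. y l ^ mu n a l)
        else 0) else 0)"

definition deg0_section :: "(vec \<Rightarrow> complex) \<Rightarrow> cover_section" where
  "deg0_section f = (\<lambda>k y. if k = 0 then f y else 0)"

definition cover_algebra :: "nat \<Rightarrow> (nat \<Rightarrow> nat) \<Rightarrow> (point, cover_section) alg_sheaf" where
  "cover_algebra n a =
     \<lparr>sect = (\<lambda>U.
        \<lparr>carrier = {s. (\<forall>i < wstar n a. s i \<in> L_inv n a i U) \<and>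
                       (\<forall>i \<ge> wstar n a. s i = (\<lambda>_. 0))},
         mult = cover_mult n a,
         one = deg0_section (\<lambda>y. if y \<in> torus_cone n U then 1 else 0),
         zero = (\<lambda>_ _. 0),
         add = (\<lambda>s s' k y. s k y + s' k y)\<rparr>),
      restr = (\<lambda>V s k y. if y \<in> torus_cone n V then s k y else 0),
      scal = (\<lambda>U f. deg0_section
                (\<lambda>y. if y \<in> torus_cone n U then f (orbit (\<lambda>_. 1) y) else 0))\<rparr>"

definition Y' :: "nat \<Rightarrow> (nat \<Rightarrow> nat) \<Rightarrow> (point, cover_section) spec_point fspace" where
  "Y' n a = rel_spec (hyp n) (cover_algebra n a)"

end

theory Submission
  imports Defs "HOL-Computational_Algebra.Fundamental_Theorem_Algebra"
begin

text \<open>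
  Write \<open>r = w\<^sup>*\<close> and \<open>y\<^sub>i = x\<^sub>i\<^sup>a x\<^sub>i\<^sub>+\<^sub>1\<close>, with exponent \<open>a = a\<^sub>i\<close>, for the terms of the equation.  They all
  have the same degree \<open>D = a\<^sub>i w\<^sub>i + w\<^sub>i\<^sub>+\<^sub>1\<close>, and \<open>r D = a\<^sub>1 \<cdots> a\<^sub>n - (-1)\<^sup>n\<close>.  So \<open>[x] \<mapsto> [y]\<close> maps the points
  of the hypersurface with nonzero coordinates to the points of the hyperplane \<open>y\<^sub>1 + \<dots> + y\<^sub>n = 0\<close> with
  nonzero coordinates.  This map has degree \<open>r\<close>, and the claim is that the cyclic cover of
  the definition of \<open>Y'\<close> is exactly what makes it bijective.

  Let \<open>\<nu>\<^sub>i = (-1)\<^sup>i\<^sup>+\<^sup>1 a\<^sub>i\<^sub>+\<^sub>1 \<cdots> a\<^sub>n\<close>.  As \<open>a\<^sub>i \<nu>\<^sub>i = - \<nu>\<^sub>i\<^sub>-\<^sub>1\<close>, the product of the powers \<open>y\<^sub>i\<close> to the \<open>\<nu>\<^sub>i\<close>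
  telescopes to the \<open>r\<close>-th power of \<open>x\<^sub>1\<^sup>D\<close>.  The numbers \<open>\<mu>\<^sub>i\<close> are the residues of the \<open>\<nu>\<^sub>i\<close>, say
  \<open>\<nu>\<^sub>i = r k\<^sub>i + \<mu>\<^sub>i\<close>.  Hence \<open>z = x\<^sub>1\<^sup>D / \<Prod>\<^sub>i y\<^sub>i\<^sup>k\<close> (exponent \<open>k\<^sub>i\<close>) satisfies the equation
  \<open>z\<^sup>r = \<Prod>\<^sub>i y\<^sub>i\<^sup>\<mu>\<close> of the cover, and \<open>[x] \<mapsto> [y, z]\<close> is a map to \<open>Y'\<close>.

  Conversely \<open>y\<close> and \<open>z\<close> give \<open>v = x\<^sub>1\<^sup>D\<close>, of degree \<open>D w\<^sub>1\<close>.  Now \<open>w\<^sub>1\<close> and \<open>D\<close> are coprime because the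
  \<open>w\<^sub>i\<close> have no common divisor, and \<open>e w\<^sub>1 + f D = 1\<close> provides the monomial \<open>x\<^sub>1\<^sup>e y\<^sub>1\<^sup>f\<close> of degree \<open>1\<close>.  Normalizing
  it to \<open>1\<close> selects one representative of every orbit, for which \<open>x\<^sub>1\<close> and then all \<open>x\<^sub>i\<close> are
  monomials of degree \<open>0\<close> in \<open>y\<close> and \<open>v\<close> (lemmas \<open>solve_closes\<close>, \<open>point_of_solution\<close>,
  \<open>solution_of_point\<close>).  If \<open>r = 1\<close> then \<open>v\<close> is a monomial in \<open>y\<close>, and the hyperplane takes the place of \<open>Y'\<close>.

  That these maps are morphisms is formal: regular functions are closed under the field operations, and maps
  given by regular functions pull regular functions back (\<open>coordinate_map\<close>, \<open>cover_map\<close>).  Over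
  the locus \<open>y\<^sub>i \<noteq> 0\<close> the algebra of the cover is generated by \<open>z\<close>, so its points there are the pairs
  \<open>(y, z)\<close> (\<open>cover_point_fiber_coord\<close>).

  It remains that the open sets are dense.  On \<open>Y'\<close> this holds because sections are determined by their values
  off the hyperplanes.  On the hypersurface a point is moved off the coordinate hyperplanes by
  solving the equation for a suitable coordinate (\<open>dense_open_kollar_torus\<close>).  This uses the
  condition on the type.
\<close>


section \<open>Weighted homogeneous polynomials\<close>

lemma whom_zero: "whom n w d (\<lambda>_. 0)"
  unfolding whom_def by (intro exI[of _ "{}"]) auto

lemma whom_monomial: "whom n w (\<Sum>i=1..n. w i * m i) (\<lambda>x. c * (\<Prod>i=1..n. x i ^ m i))"
  unfolding whom_def by (intro exI[of _ "{m}"] exI[of _ "\<lambda>_. c"]) auto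

lemma whom_const: "whom n w 0 (\<lambda>_. c)"
  using whom_monomial[of n w "\<lambda>_. 0" c] by simp

lemma whom_coord:
  assumes "i \<in> {1..n}"
  shows "whom n w (w i) (\<lambda>x. x i)"
proof -
  have "(\<Sum>j=1..n. w j * (if j = i then 1 else 0)) = w i"
    using assms by (simp add: if_distrib cong: if_cong)
  moreover have "(\<Prod>j=1..n. x j ^ (if j = i then 1 else 0)) = x i" for x :: vec
  proof -
    have "(\<Prod>j=1..n. x j ^ (if j = i then 1 else 0)) = (\<Prod>j=1..n. if j = i then x j else 1)"
      by (intro prod.cong) auto
    then show ?thesis using assms by (simp add: prod.delta)
  qed
  ultimately show ?thesis
    using whom_monomial[of n w "\<lambda>j. if j = i then 1 else 0" 1] by simp
qed

lemma whom_add: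
  assumes "whom n w d F" "whom n w d G"
  shows "whom n w d (\<lambda>x. F x + G x)"
proof -
  obtain M b where M: "finite M" "\<forall>m\<in>M. (\<Sum>i=1..n. w i * m i) = d"
    "F = (\<lambda>x. \<Sum>m\<in>M. b m * (\<Prod>i=1..n. x i ^ m i))"
    using assms(1) unfolding whom_def by blast
  obtain N c where N: "finite N" "\<forall>m\<in>N. (\<Sum>i=1..n. w i * m i) = d"
    "G = (\<lambda>x. \<Sum>m\<in>N. c m * (\<Prod>i=1..n. x i ^ m i))"
    using assms(2) unfolding whom_def by blast
  have "F x + G x = (\<Sum>m\<in>M \<union> N. ((if m \<in> M then b m else 0) + (if m \<in> N then c m else 0))
          * (\<Prod>i=1..n. x i ^ m i))" for x
  proof -
    have "F x = (\<Sum>m\<in>M \<union> N. (if m \<in> M then b m else 0) * (\<Prod>i=1..n. x i ^ m i))"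
      unfolding M(3) by (rule sum.mono_neutral_cong_left) (use M N in auto)
    moreover have "G x = (\<Sum>m\<in>M \<union> N. (if m \<in> N then c m else 0) * (\<Prod>i=1..n. x i ^ m i))"
      unfolding N(3) by (rule sum.mono_neutral_cong_left) (use M N in auto)
    ultimately show ?thesis by (simp add: sum.distrib distrib_right)
  qed
  then show ?thesis
    unfolding whom_def using M N by (intro exI[of _ "M \<union> N"] exI) (auto intro: ext)
qed

lemma whom_sum:
  assumes "\<And>i. i \<in> I \<Longrightarrow> whom n w d (F i)"
  shows "whom n w d (\<lambda>x. \<Sum>i\<in>I. F i x)"
  using assms
proof (induction I rule: infinite_finite_induct)
  case (insert i I)
  then show ?case using whom_add[of n w d "F i" "\<lambda>x. \<Sum>i\<in>I. F i x"] by simp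
qed (simp_all add: whom_zero)

lemma whom_mult:
  assumes "whom n w d F" "whom n w e G"
  shows "whom n w (d + e) (\<lambda>x. F x * G x)"
proof -
  obtain M b where M: "finite M" "\<forall>m\<in>M. (\<Sum>i=1..n. w i * m i) = d"
    "F = (\<lambda>x. \<Sum>m\<in>M. b m * (\<Prod>i=1..n. x i ^ m i))"
    using assms(1) unfolding whom_def by blast
  obtain N c where N: "finite N" "\<forall>m\<in>N. (\<Sum>i=1..n. w i * m i) = e"
    "G = (\<lambda>x. \<Sum>m\<in>N. c m * (\<Prod>i=1..n. x i ^ m i))"
    using assms(2) unfolding whom_def by blast
  have "F x * G x = (\<Sum>m\<in>M. \<Sum>m'\<in>N. b m * c m' * (\<Prod>i=1..n. x i ^ (m i + m' i)))" for x
    unfolding M N by (simp add: sum_product power_add prod.distrib algebra_simps)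
  moreover have "whom n w (d + e) (\<lambda>x. \<Sum>m\<in>M. \<Sum>m'\<in>N. b m * c m' * (\<Prod>i=1..n. x i ^ (m i + m' i)))"
  proof (intro whom_sum)
    fix m m' assume "m \<in> M" "m' \<in> N"
    then have "(\<Sum>i=1..n. w i * (m i + m' i)) = d + e"
      using M N by (simp add: distrib_left sum.distrib)
    then show "whom n w (d + e) (\<lambda>x. b m * c m' * (\<Prod>i=1..n. x i ^ (m i + m' i)))"
      using whom_monomial[of n w "\<lambda>i. m i + m' i"] by simp
  qed
  ultimately show ?thesis by simp
qed

lemma whom_power:
  assumes "whom n w d F"
  shows "whom n w (d * k) (\<lambda>x. F x ^ k)"
proof (induction k)
  case 0
  then show ?case using whom_const[of n w 1] by simp
next
  case (Suc k)
  then show ?case using whom_mult[OF assms Suc] by simp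
qed

lemma whom_scale:
  assumes "whom n w d F"
  shows "F (\<lambda>i. c ^ w i * x i) = c ^ d * F x"
proof -
  obtain M b where M: "finite M" "\<forall>m\<in>M. (\<Sum>i=1..n. w i * m i) = d"
    "F = (\<lambda>x. \<Sum>m\<in>M. b m * (\<Prod>i=1..n. x i ^ m i))"
    using assms unfolding whom_def by blast
  have "(\<Prod>i=1..n. (c ^ w i * x i) ^ m i) = c ^ d * (\<Prod>i=1..n. x i ^ m i)" if "m \<in> M" for m
  proof -
    have "(\<Prod>i=1..n. (c ^ w i * x i) ^ m i) = (\<Prod>i=1..n. c ^ (w i * m i)) * (\<Prod>i=1..n. x i ^ m i)"
      by (simp add: power_mult_distrib power_mult prod.distrib)
    also have "(\<Prod>i=1..n. c ^ (w i * m i)) = c ^ d"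
      using M(2) that by (simp flip: power_sum)
    finally show ?thesis .
  qed
  then show ?thesis unfolding M(3) by (simp add: sum_distrib_left algebra_simps)
qed

lemma whom_tendsto:
  assumes "whom n w d F" and "\<And>i. i \<in> {1..n} \<Longrightarrow> ((\<lambda>t. X t i) \<longlongrightarrow> x i) A"
  shows "((\<lambda>t. F (X t)) \<longlongrightarrow> F x) A"
proof -
  obtain M b where "F = (\<lambda>x. \<Sum>m\<in>M. b m * (\<Prod>i=1..n. x i ^ m i))"
    using assms(1) unfolding whom_def by blast
  then show ?thesis using assms(2) by (auto intro!: tendsto_intros)
qed


section \<open>Weighted projective spaces\<close>

lemma orbit_self: "x \<in> orbit w x"
  unfolding orbit_def by (auto intro!: exI[of _ 1])

lemma orbit_scale:
  assumes "c \<noteq> 0"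
  shows "orbit w (\<lambda>i. c ^ w i * x i) = orbit w x"
proof -
  have "\<exists>d. d \<noteq> 0 \<and> (\<lambda>i. b ^ w i * (c ^ w i * x i)) = (\<lambda>i. d ^ w i * x i)" if "b \<noteq> 0" for b
    using that assms by (intro exI[of _ "b * c"]) (auto simp: power_mult_distrib)
  moreover have "\<exists>d. d \<noteq> 0 \<and> (\<lambda>i. b ^ w i * x i) = (\<lambda>i. d ^ w i * (c ^ w i * x i))" if "b \<noteq> 0" for b
    using that assms by (intro exI[of _ "b / c"]) (auto simp: power_divide)
  ultimately show ?thesis unfolding orbit_def by fast
qed

lemma mem_orbitE:
  assumes "x \<in> orbit w y"
  obtains c where "c \<noteq> 0" "x = (\<lambda>i. c ^ w i * y i)"
  using assms unfolding orbit_def by auto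

lemma orbit_eq:
  assumes "x \<in> orbit w y"
  shows "orbit w x = orbit w y"
proof -
  obtain c where "c \<noteq> 0" "x = (\<lambda>i. c ^ w i * y i)" using assms by (rule mem_orbitE)
  then show ?thesis by (simp add: orbit_scale)
qed

lemma orbit_in_wproj:
  assumes "x \<in> vecs n" "i \<in> {1..n}" "x i \<noteq> 0"
  shows "orbit w x \<in> wproj n w"
proof -
  have "x \<noteq> (\<lambda>_. 0)" using assms(3) by auto
  then show ?thesis using assms(1) unfolding wproj_def by auto
qed

lemma wproj_point:
  assumes "p \<in> wproj n w" "x \<in> p"
  shows "p = orbit w x" "x \<in> vecs n" "\<exists>i\<in>{1..n}. x i \<noteq> 0"
proof -
  obtain y where y: "p = orbit w y" "y \<in> vecs n" "y \<noteq> (\<lambda>_. 0)"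
    using assms(1) unfolding wproj_def by auto
  obtain c where c: "c \<noteq> 0" "x = (\<lambda>i. c ^ w i * y i)"
    using assms(2) y(1) by (auto elim: mem_orbitE)
  show "p = orbit w x" using orbit_eq[of x w y] assms(2) y(1) by simp
  show "x \<in> vecs n" using y(2) c(2) unfolding vecs_def by auto
  obtain i where "y i \<noteq> 0" using y(3) by auto
  then show "\<exists>i\<in>{1..n}. x i \<noteq> 0"
    using y(2) c unfolding vecs_def by (intro bexI[of _ i]) auto
qed

lemma wproj_nonempty:
  assumes "p \<in> wproj n w"
  shows "\<exists>x. x \<in> p"
proof -
  obtain x where "p = orbit w x" using assms unfolding wproj_def by auto
  then show ?thesis using orbit_self[of x w] by auto
qed

definition nonvan :: "nat \<Rightarrow> (nat \<Rightarrow> nat) \<Rightarrow> (vec \<Rightarrow> complex) \<Rightarrow> point set" where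
  "nonvan n w F = {p \<in> wproj n w. \<forall>x\<in>p. F x \<noteq> 0}"

lemma nonvan_iff:
  assumes "whom n w d F" "p \<in> wproj n w" "x \<in> p"
  shows "p \<in> nonvan n w F \<longleftrightarrow> F x \<noteq> 0"
proof -
  have "F x' \<noteq> 0" if "x' \<in> p" "F x \<noteq> 0" for x'
  proof -
    obtain c where "c \<noteq> 0" "x' = (\<lambda>i. c ^ w i * x i)"
      using \<open>x' \<in> p\<close> wproj_point(1)[OF assms(2,3)] by (auto elim: mem_orbitE)
    then show ?thesis using that(2) by (simp add: whom_scale[OF assms(1)])
  qed
  then show ?thesis using assms unfolding nonvan_def by auto
qed

lemma wproj_zariski_nonvan:
  "wproj_zariski n w = topology_generated_by (nonvan n w ` {F. \<exists>d. whom n w d F})"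
proof -
  have "{nonvan n w F | F. \<exists>d. whom n w d F} = nonvan n w ` {F. \<exists>d. whom n w d F}" by auto
  then show ?thesis unfolding wproj_zariski_def nonvan_def by simp
qed

lemma openin_nonvan: "whom n w d F \<Longrightarrow> openin (wproj_zariski n w) (nonvan n w F)"
  unfolding wproj_zariski_nonvan by (rule topology_generated_by_Basis, rule imageI, rule CollectI, rule exI)

lemma topspace_wproj_zariski [simp]: "topspace (wproj_zariski n w) = wproj n w"
proof
  show "topspace (wproj_zariski n w) \<subseteq> wproj n w"
    unfolding wproj_zariski_nonvan topology_generated_by_topspace nonvan_def by auto
  have "nonvan n w (\<lambda>_. 1) = wproj n w" unfolding nonvan_def by simp
  then show "wproj n w \<subseteq> topspace (wproj_zariski n w)"
    using openin_subset[OF openin_nonvan[OF whom_const[of n w 1]]] by simp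
qed

text \<open>The loci \<open>F \<noteq> 0\<close>, and likewise the loci \<open>s \<noteq> 0\<close> on a relative spectrum, are closed under
  intersection, because the product of two functions is nonzero where both are.  Hence they are
  bases of the topologies that they generate.\<close>

lemma generated_topology_basis:
  assumes "openin (topology_generated_by B) T" "p \<in> T"
    and Int: "\<And>R S q. R \<in> B \<Longrightarrow> S \<in> B \<Longrightarrow> q \<in> R \<inter> S \<Longrightarrow> \<exists>Q\<in>B. q \<in> Q \<and> Q \<subseteq> R \<inter> S"
  shows "\<exists>Q\<in>B. p \<in> Q \<and> Q \<subseteq> T"
proof -
  have "generate_topology_on B T"
    using assms(1) unfolding openin_topology_generated_by_iff .
  then have "\<forall>p\<in>T. \<exists>Q\<in>B. p \<in> Q \<and> Q \<subseteq> T"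
  proof (induction rule: generate_topology_on.induct)
    case (Int R T)
    show ?case
    proof
      fix p assume p: "p \<in> R \<inter> T"
      then obtain Q Q' where Q: "Q \<in> B" "p \<in> Q" "Q \<subseteq> R" "Q' \<in> B" "p \<in> Q'" "Q' \<subseteq> T"
        using Int.IH by blast
      then obtain P where "P \<in> B" "p \<in> P" "P \<subseteq> Q \<inter> Q'" using assms(3)[of Q Q' p] by blast
      then show "\<exists>Q\<in>B. p \<in> Q \<and> Q \<subseteq> R \<inter> T" using Q by blast
    qed
  next
    case (UN K)
    then show ?case by (meson UnionE Union_upper subset_trans)
  qed auto
  then show ?thesis using assms(2) by blast
qed

lemma wproj_zariski_basis:
  assumes "openin (wproj_zariski n w) T" "p \<in> T"
  obtains d F where "whom n w d F" "p \<in> nonvan n w F" "nonvan n w F \<subseteq> T"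
proof -
  have "\<exists>Q\<in>nonvan n w ` {F. \<exists>d. whom n w d F}. p \<in> Q \<and> Q \<subseteq> T"
    using assms unfolding wproj_zariski_nonvan
  proof (rule generated_topology_basis)
    fix R S q assume "R \<in> nonvan n w ` {F. \<exists>d. whom n w d F}" "S \<in> nonvan n w ` {F. \<exists>d. whom n w d F}"
      and q: "q \<in> R \<inter> S"
    then obtain F d G e where F: "R = nonvan n w F" "whom n w d F" and G: "S = nonvan n w G" "whom n w e G"
      by auto
    have "nonvan n w (\<lambda>x. F x * G x) = R \<inter> S" unfolding F G nonvan_def by auto
    moreover have "(\<lambda>x. F x * G x) \<in> {F. \<exists>d. whom n w d F}"
      using whom_mult[OF F(2) G(2)] by (intro CollectI exI)
    ultimately show "\<exists>Q\<in>nonvan n w ` {F. \<exists>d. whom n w d F}. q \<in> Q \<and> Q \<subseteq> R \<inter> S"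
      using q by (intro bexI[of _ "R \<inter> S"]) (auto intro: rev_image_eqI)
  qed
  then show thesis using that by auto
qed


section \<open>Twisted sheaves on subvarieties\<close>

abbreviation subzar :: "nat \<Rightarrow> (nat \<Rightarrow> nat) \<Rightarrow> point set \<Rightarrow> point topology" where
  "subzar n w Z \<equiv> subtopology (wproj_zariski n w) Z"

lemma subzar_subset:
  assumes "openin (subzar n w Z) V"
  shows "V \<subseteq> wproj n w" "V \<subseteq> Z"
  using openin_subset[OF assms] by auto

lemma cone_memD:
  assumes "V \<subseteq> wproj n w" "x \<in> \<Union>V"
  shows "orbit w x \<in> V"
proof -
  obtain p where "p \<in> V" "x \<in> p" using assms(2) by auto
  then show ?thesis using wproj_point(1) assms(1) by (metis subsetD)
qed

definition quotient_on :: "nat \<Rightarrow> (nat \<Rightarrow> nat) \<Rightarrow> int \<Rightarrow> point set \<Rightarrow> (vec \<Rightarrow> complex) \<Rightarrow> bool" where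
  "quotient_on n w k V s \<longleftrightarrow> (\<exists>d e F G. whom n w d F \<and> whom n w e G \<and> int d - int e = k \<and>
            (\<forall>x\<in>\<Union>V. G x \<noteq> 0 \<and> s x = F x / G x))"

lemma quotient_onI:
  assumes "whom n w d F" "whom n w e G" "int d - int e = k"
    "\<And>x. x \<in> \<Union>V \<Longrightarrow> G x \<noteq> 0 \<and> s x = F x / G x"
  shows "quotient_on n w k V s"
  unfolding quotient_on_def using assms
  by (intro exI[of _ d] exI[of _ e] exI[of _ F] exI[of _ G]) auto

lemma quotient_onE:
  assumes "quotient_on n w k V s"
  obtains d e F G where "whom n w d F" "whom n w e G" "int d - int e = k"
    "\<forall>x\<in>\<Union>V. G x \<noteq> 0 \<and> s x = F x / G x"
  using assms unfolding quotient_on_def by (elim exE conjE) (rule that)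

lemma quotient_on_cong:
  assumes "quotient_on n w k V s" "V' \<subseteq> V" "\<And>x. x \<in> \<Union>V' \<Longrightarrow> s' x = s x"
  shows "quotient_on n w k V' s'"
proof -
  obtain d e F G where FG: "whom n w d F" "whom n w e G" "int d - int e = k"
    "\<forall>x\<in>\<Union>V. G x \<noteq> 0 \<and> s x = F x / G x"
    using assms(1) by (rule quotient_onE)
  show ?thesis by (rule quotient_onI[OF FG(1-3)]) (use FG(4) assms(2,3) in auto)
qed

lemma quotient_on_add:
  assumes "quotient_on n w k V s" "quotient_on n w k V s'"
  shows "quotient_on n w k V (\<lambda>x. s x + s' x)"
proof -
  obtain d e F G where FG: "whom n w d F" "whom n w e G" "int d - int e = k"
    "\<forall>x\<in>\<Union>V. G x \<noteq> 0 \<and> s x = F x / G x"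
    using assms(1) by (rule quotient_onE)
  obtain d' e' F' G' where FG': "whom n w d' F'" "whom n w e' G'" "int d' - int e' = k"
    "\<forall>x\<in>\<Union>V. G' x \<noteq> 0 \<and> s' x = F' x / G' x"
    using assms(2) by (rule quotient_onE)
  have eq: "d' + e = d + e'" using FG(3) FG'(3) by linarith
  have "whom n w (d + e') (\<lambda>x. F x * G' x + F' x * G x)"
    by (rule whom_add) (use whom_mult[OF FG(1) FG'(2)] whom_mult[OF FG'(1) FG(2)] eq in auto)
  then show ?thesis
    by (rule quotient_onI[OF _ whom_mult[OF FG(2) FG'(2)]])
      (use FG(3,4) FG'(4) in \<open>auto simp: add_frac_eq\<close>)
qed

lemma quotient_on_mult:
  assumes "quotient_on n w k V s" "quotient_on n w k' V s'"
  shows "quotient_on n w (k + k') V (\<lambda>x. s x * s' x)"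
proof -
  obtain d e F G where FG: "whom n w d F" "whom n w e G" "int d - int e = k"
    "\<forall>x\<in>\<Union>V. G x \<noteq> 0 \<and> s x = F x / G x"
    using assms(1) by (rule quotient_onE)
  obtain d' e' F' G' where FG': "whom n w d' F'" "whom n w e' G'" "int d' - int e' = k'"
    "\<forall>x\<in>\<Union>V. G' x \<noteq> 0 \<and> s' x = F' x / G' x"
    using assms(2) by (rule quotient_onE)
  show ?thesis
    by (rule quotient_onI[OF whom_mult[OF FG(1) FG'(1)] whom_mult[OF FG(2) FG'(2)]])
      (use FG(3,4) FG'(3,4) in auto)
qed

abbreviation quotient_near where
  "quotient_near n w Z k U s p \<equiv>
    \<exists>V. openin (subzar n w Z) V \<and> p \<in> V \<and> V \<subseteq> U \<and> quotient_on n w k V s"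

lemma twist_iff:
  "s \<in> twist n w Z k U \<longleftrightarrow> (\<forall>x. x \<notin> \<Union>U \<longrightarrow> s x = 0) \<and>
     (\<forall>p\<in>U. quotient_near n w Z k U s p)"
  unfolding twist_def quotient_on_def by simp

lemma twist_outside: "s \<in> twist n w Z k U \<Longrightarrow> x \<notin> \<Union>U \<Longrightarrow> s x = 0"
  unfolding twist_iff by simp

lemma twistE:
  assumes "s \<in> twist n w Z k U" "p \<in> U"
  obtains V where "openin (subzar n w Z) V" "p \<in> V" "V \<subseteq> U" "quotient_on n w k V s"
  using assms unfolding twist_iff by auto

lemma twistI:
  assumes "\<And>x. x \<notin> \<Union>U \<Longrightarrow> s x = 0"
    and "\<And>p. p \<in> U \<Longrightarrow> quotient_near n w Z k U s p"
  shows "s \<in> twist n w Z k U"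
  using assms unfolding twist_iff by simp

lemma twist_homogeneous:
  assumes "s \<in> twist n w Z k U" "U \<subseteq> wproj n w" "x \<in> \<Union>U" "c \<noteq> 0"
  shows "s (\<lambda>i. c ^ w i * x i) = c powi k * s x"
proof -
  obtain V where V: "orbit w x \<in> V" "quotient_on n w k V s"
    using assms(1) cone_memD[OF assms(2,3)] by (rule twistE)
  obtain d e F G where FG: "whom n w d F" "whom n w e G" "int d - int e = k"
    "\<forall>x\<in>\<Union>V. G x \<noteq> 0 \<and> s x = F x / G x"
    using V(2) by (rule quotient_onE)
  have "x \<in> \<Union>V" using V(1) orbit_self by (rule UnionI)
  moreover have "(\<lambda>i. c ^ w i * x i) \<in> \<Union>V"
    using V(1) by (rule UnionI) (use orbit_self[of "\<lambda>i. c ^ w i * x i" w] orbit_scale[OF assms(4)] in simp)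
  ultimately have "s (\<lambda>i. c ^ w i * x i) = (c ^ d * F x) / (c ^ e * G x)" "s x = F x / G x"
    using FG(4) by (auto simp: whom_scale[OF FG(1)] whom_scale[OF FG(2)])
  moreover have "c powi k = c ^ d / c ^ e"
    using assms(4) by (simp flip: FG(3) add: power_int_diff)
  ultimately show ?thesis by simp
qed

lemma twist_local:
  assumes "\<And>x. x \<notin> \<Union>U \<Longrightarrow> s x = 0"
    and "\<And>p. p \<in> U \<Longrightarrow> \<exists>V s'. p \<in> V \<and> V \<subseteq> U \<and> s' \<in> twist n w Z k V \<and> (\<forall>x\<in>\<Union>V. s x = s' x)"
  shows "s \<in> twist n w Z k U"
proof (rule twistI[OF assms(1)])
  fix p assume "p \<in> U"
  from assms(2)[OF this] obtain V s' where V: "p \<in> V" "V \<subseteq> U" "s' \<in> twist n w Z k V"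
    "\<forall>x\<in>\<Union>V. s x = s' x"
    by (elim exE conjE) (rule that)
  obtain V' where V': "openin (subzar n w Z) V'" "p \<in> V'" "V' \<subseteq> V" "quotient_on n w k V' s'"
    using V(3,1) by (rule twistE)
  have "quotient_on n w k V' s"
    by (rule quotient_on_cong[OF V'(4) subset_refl]) (use V(4) V'(3) in auto)
  then show "quotient_near n w Z k U s p"
    using V' V(2) by (intro exI[of _ V']) auto
qed

lemma twist_restrict:
  assumes "s \<in> twist n w Z k U" "openin (subzar n w Z) V" "V \<subseteq> U"
  shows "(\<lambda>x. if x \<in> \<Union>V then s x else 0) \<in> twist n w Z k V"
proof (rule twistI)
  fix p assume p: "p \<in> V"
  then have "p \<in> U" using assms(3) by auto
  with assms(1) obtain V' where V': "openin (subzar n w Z) V'" "p \<in> V'" "quotient_on n w k V' s"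
    by (rule twistE)
  have "quotient_on n w k (V' \<inter> V) (\<lambda>x. if x \<in> \<Union>V then s x else 0)"
    by (rule quotient_on_cong[OF V'(3)]) auto
  then show "quotient_near n w Z k V (\<lambda>x. if x \<in> \<Union>V then s x else 0) p"
    using openin_Int[OF V'(1) assms(2)] V'(2) p by (intro exI[of _ "V' \<inter> V"]) simp
qed simp

lemma twist_quotient:
  assumes "openin (subzar n w Z) U" "whom n w d F" "whom n w e G" "\<And>x. x \<in> \<Union>U \<Longrightarrow> G x \<noteq> 0"
    "k = int d - int e"
  shows "(\<lambda>x. if x \<in> \<Union>U then F x / G x else 0) \<in> twist n w Z k U"
proof (rule twistI)
  have "quotient_on n w k U (\<lambda>x. if x \<in> \<Union>U then F x / G x else 0)"
    by (rule quotient_onI[OF assms(2,3)]) (use assms in auto)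
  then show "quotient_near n w Z k U (\<lambda>x. if x \<in> \<Union>U then F x / G x else 0) p" if "p \<in> U" for p
    using assms(1) that by (intro exI[of _ U]) simp
qed simp

lemma twist_common:
  assumes "s \<in> twist n w Z k U" "s' \<in> twist n w Z k' U" "p \<in> U"
  obtains V where "openin (subzar n w Z) V" "p \<in> V" "V \<subseteq> U" "quotient_on n w k V s"
    "quotient_on n w k' V s'"
proof -
  obtain V where V: "openin (subzar n w Z) V" "p \<in> V" "V \<subseteq> U" "quotient_on n w k V s"
    using assms(1,3) by (rule twistE)
  obtain V' where V': "openin (subzar n w Z) V'" "p \<in> V'" "V' \<subseteq> U" "quotient_on n w k' V' s'"
    using assms(2,3) by (rule twistE)
  show thesis
  proof (rule that[of "V \<inter> V'"])
    show "quotient_on n w k (V \<inter> V') s" by (rule quotient_on_cong[OF V(4)]) auto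
    show "quotient_on n w k' (V \<inter> V') s'" by (rule quotient_on_cong[OF V'(4)]) auto
  qed (use V V' in auto)
qed

lemma twist_add:
  assumes "s \<in> twist n w Z k U" "s' \<in> twist n w Z k U"
  shows "(\<lambda>x. s x + s' x) \<in> twist n w Z k U"
proof (rule twistI)
  show "s x + s' x = 0" if "x \<notin> \<Union>U" for x
    using twist_outside[OF assms(1) that] twist_outside[OF assms(2) that] by simp
  fix p assume "p \<in> U"
  then obtain V where "openin (subzar n w Z) V" "p \<in> V" "V \<subseteq> U" "quotient_on n w k V s"
    "quotient_on n w k V s'" by (rule twist_common[OF assms])
  then show "quotient_near n w Z k U (\<lambda>x. s x + s' x) p"
    by (intro exI[of _ V]) (simp add: quotient_on_add)
qed

lemma twist_mult:
  assumes "s \<in> twist n w Z k U" "s' \<in> twist n w Z k' U"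
  shows "(\<lambda>x. s x * s' x) \<in> twist n w Z (k + k') U"
proof (rule twistI)
  show "s x * s' x = 0" if "x \<notin> \<Union>U" for x
    using twist_outside[OF assms(1) that] by simp
  fix p assume "p \<in> U"
  then obtain V where "openin (subzar n w Z) V" "p \<in> V" "V \<subseteq> U" "quotient_on n w k V s"
    "quotient_on n w k' V s'" by (rule twist_common[OF assms])
  then show "quotient_near n w Z (k + k') U (\<lambda>x. s x * s' x) p"
    by (intro exI[of _ V]) (simp add: quotient_on_mult)
qed

lemma openin_subzar_nonvan:
  assumes "openin (subzar n w Z) U" "whom n w d F"
  shows "openin (subzar n w Z) (U \<inter> nonvan n w F)"
proof -
  have "openin (subzar n w Z) (Z \<inter> nonvan n w F)"
    using openin_nonvan[OF assms(2)] by (rule openin_subtopology_Int2)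
  then have "openin (subzar n w Z) (U \<inter> (Z \<inter> nonvan n w F))" using assms(1) by (rule openin_Int[rotated])
  moreover have "U \<inter> (Z \<inter> nonvan n w F) = U \<inter> nonvan n w F" using subzar_subset[OF assms(1)] by auto
  ultimately show ?thesis by simp
qed

text \<open>In negative degree \<open>0\<close> is a section because it is \<open>0 / x\<^sub>i\<^sup>m\<close> where \<open>x\<^sub>i \<noteq> 0\<close>.\<close>

lemma twist_zero:
  assumes U: "openin (subzar n w Z) U" and w: "\<And>i. i \<in> {1..n} \<Longrightarrow> w i > 0"
  shows "(\<lambda>_. 0) \<in> twist n w Z k U"
proof (rule twistI)
  fix p assume p: "p \<in> U"
  then have pw: "p \<in> wproj n w" using subzar_subset[OF U] by auto
  then obtain x where x: "x \<in> p" using wproj_nonempty[OF pw] by auto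
  obtain i where i: "i \<in> {1..n}" "x i \<noteq> 0" using wproj_point(3)[OF pw x] by auto
  define V where "V = U \<inter> nonvan n w (\<lambda>x. x i)"
  define e where "e = w i * nat \<bar>k\<bar>"
  have "nat \<bar>k\<bar> \<le> e" using w[OF i(1)] unfolding e_def by simp
  then have "int (nat (k + int e)) - int e = k" by linarith
  with whom_zero whom_power[OF whom_coord[OF i(1)], of w "nat \<bar>k\<bar>", folded e_def]
  have "quotient_on n w k V (\<lambda>_. 0)" by (rule quotient_onI) (auto simp: V_def nonvan_def)
  moreover have "openin (subzar n w Z) V"
    unfolding V_def by (rule openin_subzar_nonvan[OF U whom_coord[OF i(1)]])
  moreover have "p \<in> V" using p nonvan_iff[OF whom_coord[OF i(1)] pw x] i(2) unfolding V_def by simp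
  ultimately show "quotient_near n w Z k U (\<lambda>_. 0) p"
    by (intro exI[of _ V]) (simp add: V_def)
qed simp


section \<open>Spaces with functions\<close>

text \<open>The properties of a sheaf of complex valued functions that the maps below are built from: the
  regular functions are a sheaf of algebras, the locus where one is nonzero is open, and there its
  inverse is regular.  Varieties have them, and so does a relative spectrum.\<close>

locale function_space =
  fixes X :: "'a fspace"
  assumes funs_const: "openin (zar X) U \<Longrightarrow> (\<lambda>_. c) \<in> funs X U"
    and funs_add: "openin (zar X) U \<Longrightarrow> f \<in> funs X U \<Longrightarrow> g \<in> funs X U \<Longrightarrow> (\<lambda>p. f p + g p) \<in> funs X U"
    and funs_mult: "openin (zar X) U \<Longrightarrow> f \<in> funs X U \<Longrightarrow> g \<in> funs X U \<Longrightarrow> (\<lambda>p. f p * g p) \<in> funs X U"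
    and funs_inverse: "openin (zar X) U \<Longrightarrow> f \<in> funs X U \<Longrightarrow> (\<And>p. p \<in> U \<Longrightarrow> f p \<noteq> 0) \<Longrightarrow>
      (\<lambda>p. inverse (f p)) \<in> funs X U"
    and funs_restrict: "openin (zar X) U \<Longrightarrow> f \<in> funs X U \<Longrightarrow> openin (zar X) V \<Longrightarrow> V \<subseteq> U \<Longrightarrow> f \<in> funs X V"
    and funs_local: "openin (zar X) U \<Longrightarrow> (\<And>p. p \<in> U \<Longrightarrow> \<exists>V g. openin (zar X) V \<and> p \<in> V \<and> V \<subseteq> U \<and>
      g \<in> funs X V \<and> (\<forall>q\<in>V. f q = g q)) \<Longrightarrow> f \<in> funs X U"
    and openin_funs_nonzero: "openin (zar X) U \<Longrightarrow> f \<in> funs X U \<Longrightarrow> openin (zar X) {p \<in> U. f p \<noteq> 0}"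
begin

lemma funs_cong:
  assumes "openin (zar X) U" "f \<in> funs X U" "\<And>p. p \<in> U \<Longrightarrow> g p = f p"
  shows "g \<in> funs X U"
proof (rule funs_local[OF assms(1)])
  fix p assume "p \<in> U"
  then show "\<exists>V f. openin (zar X) V \<and> p \<in> V \<and> V \<subseteq> U \<and> f \<in> funs X V \<and> (\<forall>q\<in>V. g q = f q)"
    using assms by (intro exI[of _ U] exI[of _ f]) simp
qed

lemma funs_sum:
  assumes U: "openin (zar X) U" and "\<And>i. i \<in> I \<Longrightarrow> f i \<in> funs X U"
  shows "(\<lambda>p. \<Sum>i\<in>I. f i p) \<in> funs X U"
  using assms(2)
proof (induction I rule: infinite_finite_induct)
  case (insert i I)
  then show ?case using funs_add[OF U, of "f i" "\<lambda>p. \<Sum>i\<in>I. f i p"] by simp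
qed (simp_all add: funs_const[OF U])

lemma funs_prod:
  assumes U: "openin (zar X) U" and "\<And>i. i \<in> I \<Longrightarrow> f i \<in> funs X U"
  shows "(\<lambda>p. \<Prod>i\<in>I. f i p) \<in> funs X U"
  using assms(2)
proof (induction I rule: infinite_finite_induct)
  case (insert i I)
  then show ?case using funs_mult[OF U, of "f i" "\<lambda>p. \<Prod>i\<in>I. f i p"] by simp
qed (simp_all add: funs_const[OF U])

lemma funs_power:
  assumes U: "openin (zar X) U" and "f \<in> funs X U"
  shows "(\<lambda>p. f p ^ k) \<in> funs X U"
  using funs_prod[OF U, of "{..<k}" "\<lambda>_. f"] assms(2) by simp

lemma funs_powi:
  assumes U: "openin (zar X) U" and f: "f \<in> funs X U" "\<And>p. p \<in> U \<Longrightarrow> f p \<noteq> 0"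
  shows "(\<lambda>p. f p powi k) \<in> funs X U"
proof (cases "k \<ge> 0")
  case True
  then show ?thesis using funs_power[OF U f(1)] by (simp add: power_int_def)
next
  case False
  then show ?thesis using funs_power[OF U funs_inverse[OF U f], of "nat (- k)"] by (simp add: power_int_def)
qed

lemma funs_whom:
  assumes U: "openin (zar X) U" and "\<And>i. i \<in> {1..n} \<Longrightarrow> (\<lambda>p. \<Phi> p i) \<in> funs X U" and "whom n w d F"
  shows "(\<lambda>p. F (\<Phi> p)) \<in> funs X U"
proof -
  obtain M b where F: "F = (\<lambda>x. \<Sum>m\<in>M. b m * (\<Prod>i=1..n. x i ^ m i))"
    using assms(3) unfolding whom_def by (elim exE conjE) (rule that)
  show ?thesis unfolding F
    by (intro funs_sum[OF U] funs_mult[OF U] funs_prod[OF U] funs_const[OF U] funs_power[OF U] assms(2))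
qed

end


lemma quotient_on_inverse:
  assumes "quotient_on n w k V s" "\<And>x. x \<in> \<Union>V \<Longrightarrow> s x \<noteq> 0"
  shows "quotient_on n w (- k) V (\<lambda>x. inverse (s x))"
proof -
  obtain d e F G where FG: "whom n w d F" "whom n w e G" "int d - int e = k"
    "\<forall>x\<in>\<Union>V. G x \<noteq> 0 \<and> s x = F x / G x"
    using assms(1) by (rule quotient_onE)
  have "F x \<noteq> 0" if "x \<in> \<Union>V" for x using that FG(4) assms(2)[OF that] by auto
  then show ?thesis by (intro quotient_onI[OF FG(2,1)]) (use FG(3,4) in auto)
qed

lemma twist_inverse:
  assumes "s \<in> twist n w Z k U" "\<And>x. x \<in> \<Union>U \<Longrightarrow> s x \<noteq> 0"
  shows "(\<lambda>x. inverse (s x)) \<in> twist n w Z (- k) U"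
proof (rule twistI)
  show "inverse (s x) = 0" if "x \<notin> \<Union>U" for x using twist_outside[OF assms(1) that] by simp
  fix p assume "p \<in> U"
  with assms(1) obtain V where V: "openin (subzar n w Z) V" "p \<in> V" "V \<subseteq> U" "quotient_on n w k V s"
    by (rule twistE)
  have "quotient_on n w (- k) V (\<lambda>x. inverse (s x))"
    by (rule quotient_on_inverse[OF V(4)]) (use V(3) assms(2) in auto)
  then show "quotient_near n w Z (- k) U (\<lambda>x. inverse (s x)) p"
    using V by (intro exI[of _ V]) simp
qed

lemma openin_twist_nonzero:
  assumes "openin (subzar n w Z) U" "s \<in> twist n w Z k U"
  shows "openin (subzar n w Z) {p \<in> U. \<forall>x\<in>p. s x \<noteq> 0}"
proof (subst openin_subopen, intro ballI)
  fix p assume p: "p \<in> {p \<in> U. \<forall>x\<in>p. s x \<noteq> 0}"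
  then have "p \<in> U" by simp
  with assms(2) obtain V where V: "openin (subzar n w Z) V" "p \<in> V" "V \<subseteq> U" "quotient_on n w k V s"
    by (rule twistE)
  obtain d e F G where FG: "whom n w d F" "whom n w e G" "int d - int e = k"
    "\<forall>x\<in>\<Union>V. G x \<noteq> 0 \<and> s x = F x / G x"
    using V(4) by (rule quotient_onE)
  have "\<forall>x\<in>p. F x \<noteq> 0" using p FG(4) V(2) by auto
  then have "p \<in> V \<inter> nonvan n w F" using V(2) subzar_subset(1)[OF V(1)] by (auto simp: nonvan_def)
  moreover have "V \<inter> nonvan n w F \<subseteq> {p \<in> U. \<forall>x\<in>p. s x \<noteq> 0}"
    using FG(4) V(3) by (auto simp: nonvan_def)
  ultimately show "\<exists>T. openin (subzar n w Z) T \<and> p \<in> T \<and> T \<subseteq> {p \<in> U. \<forall>x\<in>p. s x \<noteq> 0}"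
    using openin_subzar_nonvan[OF V(1) FG(1)] by (intro exI[of _ "V \<inter> nonvan n w F"]) simp
qed

text \<open>Regular functions are functions of points, sections of \<open>\<O>(0)\<close> are functions on the cone.\<close>

definition on_cone :: "(nat \<Rightarrow> nat) \<Rightarrow> point set \<Rightarrow> (point \<Rightarrow> complex) \<Rightarrow> vec \<Rightarrow> complex" where
  "on_cone w U f = (\<lambda>x. if x \<in> \<Union>U then f (orbit w x) else 0)"

lemma on_cone_eq:
  assumes "U \<subseteq> wproj n w" "p \<in> U" "x \<in> p"
  shows "on_cone w U f x = f p"
  using assms wproj_point(1)[of p n w x] unfolding on_cone_def by auto

lemma zar_wproj_subvariety [simp]: "zar (wproj_subvariety n w Z) = subzar n w Z"
  unfolding wproj_subvariety_def by simp

lemma funs_wproj_subvariety: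
  assumes "U \<subseteq> wproj n w"
  shows "f \<in> funs (wproj_subvariety n w Z) U \<longleftrightarrow> on_cone w U f \<in> twist n w Z 0 U"
proof
  assume "f \<in> funs (wproj_subvariety n w Z) U"
  then obtain s where s: "s \<in> twist n w Z 0 U" "\<forall>p\<in>U. \<forall>x\<in>p. f p = s x"
    unfolding wproj_subvariety_def by auto
  have "on_cone w U f x = s x" for x
  proof (cases "x \<in> \<Union>U")
    case True
    then show ?thesis
      using s(2) cone_memD[OF assms True] orbit_self[of x w] unfolding on_cone_def by auto
  qed (use twist_outside[OF s(1)] in \<open>simp add: on_cone_def\<close>)
  then show "on_cone w U f \<in> twist n w Z 0 U" using s(1) by (metis ext)
next
  assume "on_cone w U f \<in> twist n w Z 0 U"
  then show "f \<in> funs (wproj_subvariety n w Z) U"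
    unfolding wproj_subvariety_def using on_cone_eq[OF assms] by (auto intro!: bexI[of _ "on_cone w U f"])
qed

lemma function_space_wproj_subvariety: "function_space (wproj_subvariety n w Z)"
  (is "function_space ?X")
proof
  fix U assume "openin (zar ?X) U"
  then have U: "openin (subzar n w Z) U" by simp
  note UZ = subzar_subset[OF U]
  note F = funs_wproj_subvariety[OF UZ(1)]
  show "(\<lambda>_. c) \<in> funs ?X U" for c
    using twist_quotient[OF U whom_const[of n w c] whom_const[of n w 1]]
    unfolding F on_cone_def by (simp cong: if_cong)
  {
    fix f assume "f \<in> funs ?X U"
    then have f: "on_cone w U f \<in> twist n w Z 0 U" unfolding F .
    have "on_cone w U (\<lambda>p. inverse (f p)) = (\<lambda>x. inverse (on_cone w U f x))"
      unfolding on_cone_def by auto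
    moreover have "(\<lambda>x. inverse (on_cone w U f x)) \<in> twist n w Z (- 0) U"
      if "\<And>p. p \<in> U \<Longrightarrow> f p \<noteq> 0"
      by (rule twist_inverse[OF f]) (use that on_cone_eq[OF UZ(1)] in auto)
    ultimately show "(\<lambda>p. inverse (f p)) \<in> funs ?X U"
      if "\<And>p. p \<in> U \<Longrightarrow> f p \<noteq> 0"
      unfolding F using that by simp
    have "{p \<in> U. \<forall>x\<in>p. on_cone w U f x \<noteq> 0} = {p \<in> U. f p \<noteq> 0}"
      using on_cone_eq[OF UZ(1)] wproj_nonempty UZ(1) by fastforce
    then show "openin (zar ?X) {p \<in> U. f p \<noteq> 0}"
      using openin_twist_nonzero[OF U f] by simp
    {
      fix g assume "g \<in> funs ?X U"
      then have g: "on_cone w U g \<in> twist n w Z 0 U" unfolding F .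
      have "on_cone w U (\<lambda>p. f p + g p) = (\<lambda>x. on_cone w U f x + on_cone w U g x)"
        unfolding on_cone_def by auto
      then show "(\<lambda>p. f p + g p) \<in> funs ?X U"
        unfolding F using twist_add[OF f g] by simp
      have "on_cone w U (\<lambda>p. f p * g p) = (\<lambda>x. on_cone w U f x * on_cone w U g x)"
        unfolding on_cone_def by auto
      then show "(\<lambda>p. f p * g p) \<in> funs ?X U"
        unfolding F using twist_mult[OF f g] by simp
    }
    show "f \<in> funs ?X V"
      if "openin (zar ?X) V" "V \<subseteq> U" for V
    proof -
      have V: "openin (subzar n w Z) V" using that(1) by simp
      have "on_cone w V f = (\<lambda>x. if x \<in> \<Union>V then on_cone w U f x else 0)"
        using that(2) unfolding on_cone_def by (intro ext) auto
      then show ?thesis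
        unfolding funs_wproj_subvariety[OF subzar_subset(1)[OF V]] using twist_restrict[OF f V that(2)] by simp
    qed
  }
  fix f assume loc: "\<And>p. p \<in> U \<Longrightarrow> \<exists>V g. openin (zar ?X) V \<and> p \<in> V \<and> V \<subseteq> U \<and>
      g \<in> funs ?X V \<and> (\<forall>q\<in>V. f q = g q)"
  show "f \<in> funs ?X U"
    unfolding F
  proof (rule twist_local)
    fix p assume "p \<in> U"
    from loc[OF this] obtain V g where V: "openin (zar ?X) V" "p \<in> V" "V \<subseteq> U"
      "g \<in> funs ?X V" "\<forall>q\<in>V. f q = g q"
      by (elim exE conjE) (rule that)
    have V': "V \<subseteq> wproj n w" using V(3) UZ(1) by auto
    have "\<forall>x\<in>\<Union>V. on_cone w U f x = on_cone w V g x"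
      using V(3,5) on_cone_eq[OF V'] on_cone_eq[OF UZ(1)] by auto
    then show "\<exists>V s'. p \<in> V \<and> V \<subseteq> U \<and> s' \<in> twist n w Z 0 V \<and> (\<forall>x\<in>\<Union>V. on_cone w U f x = s' x)"
      using V funs_wproj_subvariety[OF V'] by (intro exI[of _ V] exI[of _ "on_cone w V g"]) simp
  qed (simp add: on_cone_def)
qed


section \<open>Morphisms to subvarieties of weighted projective space\<close>

lemma morphism_open_subspaceI:
  assumes "openin (zar X) U" "openin (zar Y) V" "\<And>p. p \<in> U \<Longrightarrow> f p \<in> V"
    and "\<And>N. openin (zar Y) N \<Longrightarrow> N \<subseteq> V \<Longrightarrow> openin (zar X) {p \<in> U. f p \<in> N}"
    and "\<And>N h. openin (zar Y) N \<Longrightarrow> N \<subseteq> V \<Longrightarrow> h \<in> funs Y N \<Longrightarrow> h \<circ> f \<in> funs X {p \<in> U. f p \<in> N}"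
  shows "morphism (open_subspace X U) (open_subspace Y V) f"
proof -
  have top: "topspace (subtopology (zar X) U) = U" "topspace (subtopology (zar Y) V) = V"
    using openin_subset[OF assms(1)] openin_subset[OF assms(2)] by auto
  have op: "openin (subtopology (zar Y) V) N \<longleftrightarrow> openin (zar Y) N \<and> N \<subseteq> V" for N
    using openin_open_subtopology[OF assms(2)] by simp
  have op': "openin (subtopology (zar X) U) N \<longleftrightarrow> openin (zar X) N \<and> N \<subseteq> U" for N
    using openin_open_subtopology[OF assms(1)] by simp
  have cont: "continuous_map (subtopology (zar X) U) (subtopology (zar Y) V) f"
    unfolding continuous_map_def top op op' using assms(3,4) by auto
  show ?thesis
    unfolding morphism_def open_subspace_def using cont assms(5) by (simp add: top op del: topspace_subtopology)
qed

text \<open>A map \<open>p \<mapsto> [\<Phi> p]\<close> given by regular functions is a morphism: polynomials in the \<open>\<Phi>\<^sub>i\<close> are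
  regular, so are their quotients, and local sections of \<open>\<O>(k)\<close> are such quotients.\<close>

locale coordinate_map = function_space X for X :: "'a fspace" +
  fixes U :: "'a set" and \<Phi> :: "'a \<Rightarrow> vec" and n :: nat and w :: "nat \<Rightarrow> nat" and Z :: "point set"
  assumes open_U: "openin (zar X) U"
    and regular: "\<And>i. i \<in> {1..n} \<Longrightarrow> (\<lambda>p. \<Phi> p i) \<in> funs X U"
    and in_Z: "\<And>p. p \<in> U \<Longrightarrow> orbit w (\<Phi> p) \<in> Z"
    and Z_subset: "Z \<subseteq> wproj n w"
begin

lemma openin_preimage:
  assumes "openin (subzar n w Z) V"
  shows "openin (zar X) {p \<in> U. orbit w (\<Phi> p) \<in> V}"
proof (subst openin_subopen, intro ballI)
  fix p assume p: "p \<in> {p \<in> U. orbit w (\<Phi> p) \<in> V}"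
  obtain T where T: "openin (wproj_zariski n w) T" "V = T \<inter> Z"
    using assms unfolding openin_subtopology by auto
  have "orbit w (\<Phi> p) \<in> T" using p T(2) by simp
  with T(1) obtain d F where F: "whom n w d F" "orbit w (\<Phi> p) \<in> nonvan n w F" "nonvan n w F \<subseteq> T"
    by (rule wproj_zariski_basis)
  have *: "orbit w (\<Phi> q) \<in> nonvan n w F \<longleftrightarrow> F (\<Phi> q) \<noteq> 0" if "q \<in> U" for q
    using nonvan_iff[OF F(1) _ orbit_self] in_Z[OF that] Z_subset by auto
  have "{q \<in> U. F (\<Phi> q) \<noteq> 0} \<subseteq> {p \<in> U. orbit w (\<Phi> p) \<in> V}"
    using * F(3) T(2) in_Z by auto
  moreover have "p \<in> {q \<in> U. F (\<Phi> q) \<noteq> 0}" using p * F(2) by simp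
  moreover have "openin (zar X) {q \<in> U. F (\<Phi> q) \<noteq> 0}"
    by (rule openin_funs_nonzero[OF open_U funs_whom[OF open_U regular F(1)]])
  ultimately show "\<exists>T. openin (zar X) T \<and> p \<in> T \<and> T \<subseteq> {p \<in> U. orbit w (\<Phi> p) \<in> V}"
    by (intro exI[of _ "{q \<in> U. F (\<Phi> q) \<noteq> 0}"]) simp
qed

lemma funs_pullback_twist:
  assumes V: "openin (subzar n w Z) V" and s: "s \<in> twist n w Z k V"
  shows "(\<lambda>p. s (\<Phi> p)) \<in> funs X {p \<in> U. orbit w (\<Phi> p) \<in> V}"
proof (rule funs_local[OF openin_preimage[OF V]])
  fix p assume p: "p \<in> {p \<in> U. orbit w (\<Phi> p) \<in> V}"
  then have "orbit w (\<Phi> p) \<in> V" by simp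
  with s obtain V' where V': "openin (subzar n w Z) V'" "orbit w (\<Phi> p) \<in> V'" "V' \<subseteq> V" "quotient_on n w k V' s"
    by (rule twistE)
  obtain d e F G where FG: "whom n w d F" "whom n w e G" "int d - int e = k"
    "\<forall>x\<in>\<Union>V'. G x \<noteq> 0 \<and> s x = F x / G x"
    using V'(4) by (rule quotient_onE)
  define N where "N = {p \<in> U. orbit w (\<Phi> p) \<in> V'}"
  have N: "openin (zar X) N" "N \<subseteq> U"
    unfolding N_def using openin_preimage[OF V'(1)] by auto
  have *: "G (\<Phi> q) \<noteq> 0 \<and> s (\<Phi> q) = F (\<Phi> q) / G (\<Phi> q)" if "q \<in> N" for q
    using FG(4) that orbit_self[of "\<Phi> q" w] unfolding N_def by auto
  have reg: "(\<lambda>p. \<Phi> p i) \<in> funs X N" if "i \<in> {1..n}" for i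
    by (rule funs_restrict[OF open_U regular[OF that] N])
  have "(\<lambda>p. F (\<Phi> p) * inverse (G (\<Phi> p))) \<in> funs X N"
    by (intro funs_mult[OF N(1)] funs_inverse[OF N(1)] funs_whom[OF N(1) reg FG(1)]
      funs_whom[OF N(1) reg FG(2)]) (use * in auto)
  then show "\<exists>N g. openin (zar X) N \<and> p \<in> N \<and> N \<subseteq> {p \<in> U. orbit w (\<Phi> p) \<in> V} \<and>
      g \<in> funs X N \<and> (\<forall>q\<in>N. s (\<Phi> q) = g q)"
    using N(1) p V'(2,3) *
    by (intro exI[of _ N] exI[of _ "\<lambda>p. F (\<Phi> p) * inverse (G (\<Phi> p))"]) (auto simp: N_def divide_inverse)
qed

lemma funs_pullback:
  assumes V: "openin (subzar n w Z) V" and h: "h \<in> funs (wproj_subvariety n w Z) V"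
  shows "(\<lambda>p. h (orbit w (\<Phi> p))) \<in> funs X {p \<in> U. orbit w (\<Phi> p) \<in> V}"
proof (rule funs_cong[OF openin_preimage[OF V]])
  have "on_cone w V h \<in> twist n w Z 0 V"
    using h funs_wproj_subvariety[OF subzar_subset(1)[OF V]] by simp
  then show "(\<lambda>p. on_cone w V h (\<Phi> p)) \<in> funs X {p \<in> U. orbit w (\<Phi> p) \<in> V}"
    by (rule funs_pullback_twist[OF V])
  show "h (orbit w (\<Phi> p)) = on_cone w V h (\<Phi> p)" if "p \<in> {p \<in> U. orbit w (\<Phi> p) \<in> V}" for p
  proof -
    have "orbit w (\<Phi> p) \<in> V" using that by simp
    from on_cone_eq[OF subzar_subset(1)[OF V] this orbit_self] show ?thesis by simp
  qed
qed

lemma morphism_coordinate_map: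
  assumes V: "openin (subzar n w Z) V" and "\<And>p. p \<in> U \<Longrightarrow> orbit w (\<Phi> p) \<in> V"
  shows "morphism (open_subspace X U) (open_subspace (wproj_subvariety n w Z) V) (\<lambda>p. orbit w (\<Phi> p))"
proof (rule morphism_open_subspaceI[OF open_U])
  fix N h assume "openin (zar (wproj_subvariety n w Z)) N" "h \<in> funs (wproj_subvariety n w Z) N"
  then show "h \<circ> (\<lambda>p. orbit w (\<Phi> p)) \<in> funs X {p \<in> U. orbit w (\<Phi> p) \<in> N}"
    using funs_pullback[of N h] by (simp add: comp_def)
qed (use assms openin_preimage in auto)

end


section \<open>Coordinates on the torus of projective space\<close>

abbreviation std :: "nat \<Rightarrow> nat" where "std \<equiv> (\<lambda>_. 1)"

lemma zar_hyp [simp]: "zar (hyp n) = subzar n std (hyp_points n)"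
  unfolding hyp_def by simp

lemma function_space_hyp: "function_space (hyp n)"
  unfolding hyp_def by (rule function_space_wproj_subvariety)

lemma hyp_points_subset: "hyp_points n \<subseteq> wproj n std"
  unfolding hyp_points_def by auto

lemma topspace_hyp [simp]: "topspace (subzar n std (hyp_points n)) = hyp_points n"
  using hyp_points_subset by auto

text \<open>If \<open>F\<close> and \<open>G\<close> are forms of equal degree, then \<open>F / G\<close> does not depend on the representative
  and is a regular function where \<open>G \<noteq> 0\<close>.\<close>

definition ratio :: "(vec \<Rightarrow> complex) \<Rightarrow> (vec \<Rightarrow> complex) \<Rightarrow> point \<Rightarrow> complex" where
  "ratio F G p = (let x = SOME x. x \<in> p in F x / G x)"

lemma ratio_eq:
  assumes "whom n w d F" "whom n w d G" "p \<in> wproj n w" "x \<in> p"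
  shows "ratio F G p = F x / G x"
proof -
  define x' where "x' = (SOME x. x \<in> p)"
  have "x' \<in> p" unfolding x'_def by (rule someI[of "\<lambda>x. x \<in> p", OF assms(4)])
  then have "x' \<in> orbit w x" using wproj_point(1)[OF assms(3,4)] by simp
  then obtain c where "c \<noteq> 0" "x' = (\<lambda>i. c ^ w i * x i)" by (rule mem_orbitE)
  then show ?thesis
    unfolding ratio_def Let_def x'_def[symmetric] by (simp add: whom_scale[OF assms(1)] whom_scale[OF assms(2)])
qed

lemma funs_ratio:
  assumes "openin (subzar n w Z) U" "whom n w d F" "whom n w d G" "\<And>x. x \<in> \<Union>U \<Longrightarrow> G x \<noteq> 0"
  shows "ratio F G \<in> funs (wproj_subvariety n w Z) U"
proof -
  have "on_cone w U (ratio F G) = (\<lambda>x. if x \<in> \<Union>U then F x / G x else 0)"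
    unfolding on_cone_def
  proof (intro ext if_cong refl)
    fix x assume "x \<in> \<Union>U"
    then have "orbit w x \<in> wproj n w"
      using cone_memD[OF subzar_subset(1)[OF assms(1)]] subzar_subset(1)[OF assms(1)] by blast
    from ratio_eq[OF assms(2,3) this orbit_self] show "ratio F G (orbit w x) = F x / G x" .
  qed
  then show ?thesis
    unfolding funs_wproj_subvariety[OF subzar_subset(1)[OF assms(1)]]
    using twist_quotient[OF assms(1-4), of 0] by simp
qed

definition torus :: "nat \<Rightarrow> (nat \<Rightarrow> nat) \<Rightarrow> point set \<Rightarrow> point set" where
  "torus n w Z = {p \<in> Z. \<forall>x\<in>p. \<forall>i\<in>{1..n}. x i \<noteq> 0}"

lemma torus_iff:
  assumes "Z \<subseteq> wproj n w" "p \<in> Z" "x \<in> p"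
  shows "p \<in> torus n w Z \<longleftrightarrow> (\<forall>i\<in>{1..n}. x i \<noteq> 0)"
proof -
  have "\<forall>i\<in>{1..n}. x' i \<noteq> 0" if "x' \<in> p" "\<forall>i\<in>{1..n}. x i \<noteq> 0" for x'
  proof -
    have "x' \<in> orbit w x" using that(1) wproj_point(1)[of p n w x] assms by auto
    then obtain c where "c \<noteq> 0" "x' = (\<lambda>i. c ^ w i * x i)" by (rule mem_orbitE)
    then show ?thesis using that(2) by auto
  qed
  then show ?thesis using assms(2,3) unfolding torus_def by auto
qed

lemma openin_torus:
  assumes "Z \<subseteq> wproj n w"
  shows "openin (subzar n w Z) (torus n w Z)"
proof -
  have "torus n w Z = Z \<inter> topspace (subzar n w Z) \<inter> (\<Inter>i\<in>{1..n}. nonvan n w (\<lambda>x. x i) \<inter> wproj n w)"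
    using assms unfolding torus_def nonvan_def by auto
  also have "openin (subzar n w Z) \<dots>"
  proof (cases "n = 0")
    case True
    then have "wproj n w = {}" unfolding wproj_def vecs_def by auto
    then show ?thesis using assms by simp
  next
    case False
    have "openin (wproj_zariski n w) (\<Inter>i\<in>{1..n}. nonvan n w (\<lambda>x. x i) \<inter> wproj n w)"
      using False by (intro openin_Inter) (auto intro!: openin_Int openin_nonvan whom_coord 
          openin_topspace[of "wproj_zariski n w", simplified])
    then have "openin (subzar n w Z) (Z \<inter> (\<Inter>i\<in>{1..n}. nonvan n w (\<lambda>x. x i) \<inter> wproj n w))"
      by (rule openin_subtopology_Int2)
    moreover have "Z \<inter> topspace (subzar n w Z) = Z" using assms by auto
    ultimately show ?thesis by simp
  qed
  finally show ?thesis .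
qed

abbreviation hyp_torus :: "nat \<Rightarrow> point set" where
  "hyp_torus n \<equiv> torus n std (hyp_points n)"

lemma hyp_torus_subset: "hyp_torus n \<subseteq> wproj n std"
  unfolding torus_def hyp_points_def by auto

lemma openin_hyp_torus: "openin (subzar n std (hyp_points n)) (hyp_torus n)"
  by (rule openin_torus[OF hyp_points_subset])

lemma torus_cone_torus: "U \<subseteq> hyp_torus n \<Longrightarrow> torus_cone n U = \<Union>U"
  unfolding torus_cone_def torus_def by auto

lemma orbit_in_hyp_torus:
  assumes "n \<ge> 1" and y: "y \<in> vecs n" "\<forall>i\<in>{1..n}. y i \<noteq> 0" "(\<Sum>i=1..n. y i) = 0"
  shows "orbit std y \<in> hyp_torus n"
proof -
  have "orbit std y \<in> wproj n std" using orbit_in_wproj[OF y(1), of 1 std] y(2) assms(1) by simp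
  moreover have "(\<Sum>i=1..n. y' i) = 0" if "y' \<in> orbit std y" for y'
    using that y(3) by (auto elim!: mem_orbitE simp flip: sum_distrib_left)
  ultimately have "orbit std y \<in> hyp_points n" unfolding hyp_points_def by simp
  then show ?thesis using torus_iff[OF hyp_points_subset _ orbit_self] y(2) by blast
qed

text \<open>Every point of the torus has one representative with first coordinate \<open>1\<close>; its entries
  \<open>y\<^sub>i / y\<^sub>1\<close> are regular functions.\<close>

definition normal_rep :: "point \<Rightarrow> vec" where
  "normal_rep p = (\<lambda>i. ratio (\<lambda>y. y i) (\<lambda>y. y 1) p)"

lemma normal_rep_eq:
  assumes n: "n \<ge> 1" and "p \<in> hyp_torus n" "y \<in> p"
  shows "normal_rep p = (\<lambda>i. inverse (y 1) * y i)"
proof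
  fix i
  have p: "p \<in> wproj n std" using assms(2) hyp_torus_subset by auto
  show "normal_rep p i = inverse (y 1) * y i"
  proof (cases "i \<in> {1..n}")
    case True
    then show ?thesis
      using ratio_eq[OF whom_coord[of i n std] whom_coord[of 1 n std] p assms(3)] n
      unfolding normal_rep_def by (simp add: divide_inverse mult.commute)
  next
    case False
    have "y' i = 0" if "y' \<in> p" for y' using wproj_point(2)[OF p that] False unfolding vecs_def by auto
    from this[OF someI[of "\<lambda>x. x \<in> p", OF assms(3)]] this[OF assms(3)] show ?thesis
      unfolding normal_rep_def ratio_def Let_def by simp
  qed
qed

lemma normal_rep_mem:
  assumes "n \<ge> 1" "p \<in> hyp_torus n"
  shows "normal_rep p \<in> p" "normal_rep p 1 = 1" "orbit std (normal_rep p) = p"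
    "\<And>i. i \<in> {1..n} \<Longrightarrow> normal_rep p i \<noteq> 0"
proof -
  have p: "p \<in> wproj n std" using assms(2) hyp_torus_subset by auto
  obtain y where y: "y \<in> p" using wproj_nonempty[OF p] by auto
  have y0: "y i \<noteq> 0" if "i \<in> {1..n}" for i using assms(2) y that unfolding torus_def by auto
  have eq: "normal_rep p = (\<lambda>i. inverse (y 1) ^ std i * y i)" using normal_rep_eq[OF assms y] by simp
  have "orbit std (normal_rep p) = orbit std y"
    unfolding eq by (rule orbit_scale) (use y0[of 1] assms(1) in auto)
  then show o: "orbit std (normal_rep p) = p" using wproj_point(1)[OF p y] by simp
  show "normal_rep p \<in> p" using orbit_self[of "normal_rep p" std] o by simp
  show "normal_rep p 1 = 1" unfolding eq using y0[of 1] assms(1) by simp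
  show "normal_rep p i \<noteq> 0" if "i \<in> {1..n}" for i unfolding eq using y0[OF that] y0[of 1] assms(1) by simp
qed

lemma normal_rep_orbit:
  assumes "n \<ge> 1" "orbit std y \<in> hyp_torus n" "y 1 = 1"
  shows "normal_rep (orbit std y) = y"
  using normal_rep_eq[OF assms(1,2) orbit_self] assms(3) by simp

lemma funs_normal_rep:
  assumes "n \<ge> 1" "i \<in> {1..n}"
  shows "(\<lambda>p. normal_rep p i) \<in> funs (hyp n) (hyp_torus n)"
  unfolding normal_rep_def hyp_def
proof (rule funs_ratio[OF openin_hyp_torus])
  show "whom n std 1 (\<lambda>y. y i)" "whom n std 1 (\<lambda>y. y 1)"
    using whom_coord[OF assms(2), of std] whom_coord[of 1 n std] assms(1) by auto
  show "y 1 \<noteq> 0" if "y \<in> \<Union>(hyp_torus n)" for y using that assms(1) unfolding torus_def by auto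
qed


section \<open>The algebra of the cyclic cover\<close>

text \<open>The numerical condition says that \<open>\<O>(t)\<^sup>\<otimes>\<^sup>r\<close> and \<open>\<O>(\<Sum>\<^sub>j \<mu>\<^sub>j L\<^sub>j)\<close> have equal degrees, which makes the
  multiplication of the algebra well defined.\<close>

locale cyclic_cover =
  fixes n :: nat and a :: "nat \<Rightarrow> nat"
  assumes n_pos: "n \<ge> 1" and r_gt_1: "wstar n a > 1"
    and degree_tt: "tt n a * wstar n a = (\<Sum>j=1..n. mu n a j)"
begin

abbreviation r :: nat where "r \<equiv> wstar n a"
abbreviation \<mu> :: "nat \<Rightarrow> nat" where "\<mu> \<equiv> mu n a"
abbreviation t :: nat where "t \<equiv> tt n a"
abbreviation H :: "point set" where "H \<equiv> hyp_points n"
abbreviation Op :: "point set \<Rightarrow> bool" where "Op \<equiv> openin (subzar n std H)"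
abbreviation Alg :: "(point, cover_section) alg_sheaf" where "Alg \<equiv> cover_algebra n a"
abbreviation C :: "point set \<Rightarrow> cover_section set" where "C U \<equiv> carrier (sect Alg U)"

definition branch :: "vec \<Rightarrow> complex" where
  "branch y = (\<Prod>l=1..n. y l ^ \<mu> l)"

definition floor_exp :: "nat \<Rightarrow> nat \<Rightarrow> nat" where
  "floor_exp i j = \<mu> j * i div r"

abbreviation poles :: "nat \<Rightarrow> vec \<Rightarrow> complex" where
  "poles i y \<equiv> (\<Prod>j=1..n. y j ^ floor_exp i j)"

abbreviation deg :: "nat \<Rightarrow> int" where
  "deg i \<equiv> - int (t * i) + int (\<Sum>j=1..n. floor_exp i j)"

lemma Op_subset: "Op U \<Longrightarrow> U \<subseteq> H"
  using subzar_subset by simp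

lemma Op_cone: "Op U \<Longrightarrow> y \<in> \<Union>U \<Longrightarrow> orbit std y \<in> U"
  using cone_memD[OF subzar_subset(1)] by metis

lemma L_inv_iff:
  "s \<in> L_inv n a i U \<longleftrightarrow> (\<forall>y. y \<notin> torus_cone n U \<longrightarrow> s y = 0) \<and>
    (\<exists>g \<in> twist n std H (deg i) U.
      \<forall>y \<in> torus_cone n U. s y * poles i y = g y)"
proof -
  have "\<lfloor>of_nat (\<mu> j * i) / of_nat r :: real\<rfloor> = int (floor_exp i j)" for j
    unfolding floor_exp_def by (rule floor_divide_of_nat_eq)
  then show ?thesis unfolding L_inv_def twist_div_def by (simp only: mem_Collect_eq of_nat_sum power_int_of_nat)
qed

lemma L_invI:
  assumes "\<And>y. y \<notin> torus_cone n U \<Longrightarrow> s y = 0"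
    and "g \<in> twist n std H (deg i) U"
    and "\<And>y. y \<in> torus_cone n U \<Longrightarrow> s y * poles i y = g y"
  shows "s \<in> L_inv n a i U"
  unfolding L_inv_iff using assms by (intro conjI bexI[of _ g]) auto

lemma L_invE:
  assumes "s \<in> L_inv n a i U"
  obtains g where "\<forall>y. y \<notin> torus_cone n U \<longrightarrow> s y = 0"
    "g \<in> twist n std H (deg i) U"
    "\<forall>y\<in>torus_cone n U. s y * poles i y = g y"
  using assms unfolding L_inv_iff by (elim conjE bexE) (rule that)

lemma twist_monomial:
  assumes "Op U"
  shows "(\<lambda>y. if y \<in> \<Union>U then \<Prod>j=1..n. y j ^ k j else 0) \<in> twist n std H (int (\<Sum>j=1..n. k j)) U"
proof -
  have m: "whom n std (\<Sum>j=1..n. k j) (\<lambda>y. \<Prod>j=1..n. y j ^ k j)"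
    using whom_monomial[of n std k 1] by simp
  show ?thesis
    using twist_quotient[OF assms m whom_const[of n std 1], of "int (\<Sum>j=1..n. k j)"]
    by (simp cong: if_cong del: of_nat_sum)
qed

lemma L_inv_zero: "Op U \<Longrightarrow> (\<lambda>_. 0) \<in> L_inv n a i U"
  by (rule L_invI[of U _ "\<lambda>_. 0"]) (auto intro: twist_zero)

lemma L_inv_add:
  assumes "s \<in> L_inv n a i U" "s' \<in> L_inv n a i U"
  shows "(\<lambda>y. s y + s' y) \<in> L_inv n a i U"
proof -
  from assms(1) obtain g where g: "\<forall>y. y \<notin> torus_cone n U \<longrightarrow> s y = 0"
    "g \<in> twist n std H (deg i) U"
    "\<forall>y\<in>torus_cone n U. s y * poles i y = g y" by (rule L_invE) 
  from assms(2) obtain g' where g': "\<forall>y. y \<notin> torus_cone n U \<longrightarrow> s' y = 0"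
    "g' \<in> twist n std H (deg i) U"
    "\<forall>y\<in>torus_cone n U. s' y * poles i y = g' y" by (rule L_invE)
  show ?thesis
    by (rule L_invI[OF _ twist_add[OF g(2) g'(2)]]) (use g(1,3) g'(1,3) in \<open>simp_all add: distrib_right\<close>)
qed

lemma L_inv_sum:
  assumes "Op U" "\<And>x. x \<in> I \<Longrightarrow> f x \<in> L_inv n a i U"
  shows "(\<lambda>y. \<Sum>x\<in>I. f x y) \<in> L_inv n a i U"
  using assms(2)
proof (induction I rule: infinite_finite_induct)
  case (insert x I)
  then show ?case using L_inv_add[of "f x" i U "\<lambda>y. \<Sum>x\<in>I. f x y"] by simp
qed (simp_all add: L_inv_zero[OF assms(1)])

text \<open>Both rules of the multiplication at once, \<open>c = 0\<close> without wrap-around and \<open>c = 1\<close> with it.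
  The product has no more poles than allowed because
  \<open>\<lfloor>u\<rfloor> + \<lfloor>v\<rfloor> \<le> \<lfloor>u + v\<rfloor>\<close>, and the degrees agree because \<open>t r = \<Sum>\<^sub>l \<mu>\<^sub>l\<close>.\<close>

lemma L_inv_mult:
  assumes U: "Op U" and "s \<in> L_inv n a i U" "s' \<in> L_inv n a j U" and ij: "i + j = k + c * r"
  shows "(\<lambda>y. s y * s' y * branch y ^ c) \<in> L_inv n a k U"
proof -
  from assms(2) obtain g where g: "\<forall>y. y \<notin> torus_cone n U \<longrightarrow> s y = 0"
    "g \<in> twist n std H (deg i) U"
    "\<forall>y\<in>torus_cone n U. s y * poles i y = g y" by (rule L_invE) 
  from assms(3) obtain g' where g': "\<forall>y. y \<notin> torus_cone n U \<longrightarrow> s' y = 0"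
    "g' \<in> twist n std H (deg j) U"
    "\<forall>y\<in>torus_cone n U. s' y * poles j y = g' y" by (rule L_invE)
  define e where "e l = floor_exp k l + c * \<mu> l - (floor_exp i l + floor_exp j l)" for l
  have e: "floor_exp k l + c * \<mu> l = e l + floor_exp i l + floor_exp j l" for l
  proof -
    have "floor_exp i l + floor_exp j l \<le> (\<mu> l * i + \<mu> l * j) div r"
      unfolding floor_exp_def using r_gt_1 
      by (metis add_mult_distrib2 div_add1_eq le_add1)
    also have "\<mu> l * i + \<mu> l * j = \<mu> l * k + (c * \<mu> l) * r"
      using ij by (metis (no_types, lifting) add_mult_distrib2 mult.assoc mult.commute)
    also have "(\<mu> l * k + (c * \<mu> l) * r) div r = floor_exp k l + c * \<mu> l"
      unfolding floor_exp_def using r_gt_1 by simp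
    finally show ?thesis unfolding e_def by simp
  qed
  define m where "m = (\<lambda>y. if y \<in> \<Union>U then \<Prod>l=1..n. y l ^ e l else 0)"
  have m: "m \<in> twist n std H (int (\<Sum>l=1..n. e l)) U"
    unfolding m_def by (rule twist_monomial[OF U])
  have "(\<Sum>l=1..n. floor_exp k l + c * \<mu> l) = (\<Sum>l=1..n. e l + floor_exp i l + floor_exp j l)"
    using e by simp
  then have "(\<Sum>l=1..n. floor_exp k l) + c * (t * r) = (\<Sum>l=1..n. e l) + (\<Sum>l=1..n. floor_exp i l) + (\<Sum>l=1..n. floor_exp j l)"
    by (simp add: sum.distrib degree_tt flip: sum_distrib_left)
  then have "int ((\<Sum>l=1..n. floor_exp k l) + c * (t * r)) = int ((\<Sum>l=1..n. e l) + (\<Sum>l=1..n. floor_exp i l) + (\<Sum>l=1..n. floor_exp j l))"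
    by (rule arg_cong)
  moreover have "int (t * i) + int (t * j) = int (t * k) + int (c * (t * r))"
  proof -
    have "t * i + t * j = t * k + c * (t * r)" using ij by (metis add_mult_distrib2 mult.left_commute)
    then show ?thesis by (metis of_nat_add)
  qed
  ultimately have deg: "deg i + (deg j)
      + int (\<Sum>l=1..n. e l) = deg k"
    unfolding of_nat_add by linarith
  show ?thesis
  proof (rule L_invI[OF _ twist_mult[OF twist_mult[OF g(2) g'(2)] m, unfolded deg]])
    fix y
    show "s y * s' y * branch y ^ c = 0" if "y \<notin> torus_cone n U" using g(1)[rule_format, OF that] by simp
    assume y: "y \<in> torus_cone n U"
    have "branch y ^ c * poles k y = (\<Prod>l=1..n. y l ^ (floor_exp k l + c * \<mu> l))"
      unfolding branch_def prod_power_distrib by (simp add: power_add prod.distrib mult.commute flip: power_mult)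
    also have "\<dots> = poles i y * poles j y * (\<Prod>l=1..n. y l ^ e l)"
      unfolding e by (simp add: power_add prod.distrib mult_ac)
    also have "(\<Prod>l=1..n. y l ^ e l) = m y" unfolding m_def using y unfolding torus_cone_def by simp
    finally have "branch y ^ c * poles k y =
      poles i y * poles j y * m y" .
    then show "s y * s' y * branch y ^ c * poles k y = g y * g' y * m y"
      unfolding g(3)[rule_format, OF y, symmetric] g'(3)[rule_format, OF y, symmetric] by (simp add: mult_ac)
  qed
qed

lemma L_inv_restrict:
  assumes "s \<in> L_inv n a i U" "Op U" "Op V" "V \<subseteq> U"
  shows "(\<lambda>y. if y \<in> torus_cone n V then s y else 0) \<in> L_inv n a i V"
proof -
  from assms(1) obtain g where g: "\<forall>y. y \<notin> torus_cone n U \<longrightarrow> s y = 0"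
    "g \<in> twist n std H (deg i) U"
    "\<forall>y\<in>torus_cone n U. s y * poles i y = g y" by (rule L_invE)
  show ?thesis
  proof (rule L_invI[OF _ twist_restrict[OF g(2) assms(3,4)]])
    fix y assume y: "y \<in> torus_cone n V"
    then have "y \<in> \<Union>V" "y \<in> torus_cone n U" using assms(4) unfolding torus_cone_def by auto
    then show "(if y \<in> torus_cone n V then s y else 0) * poles i y = (if y \<in> \<Union>V then g y else 0)"
      using y g(3) by simp
  qed simp
qed

text \<open>On the torus the hyperplanes are invisible, so \<open>\<L>\<^sup>(\<^sup>i\<^sup>)\<^sup>-\<^sup>1\<close> is just \<open>\<O>(-ti)\<close> there.\<close>

lemma L_inv_torus:
  assumes U: "Op U" and sub: "U \<subseteq> hyp_torus n"
  shows "s \<in> L_inv n a i U \<longleftrightarrow> s \<in> twist n std H (- int (t * i)) U"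
proof
  note cone = torus_cone_torus[OF sub]
  define m where "m = (\<lambda>y. if y \<in> \<Union>U then \<Prod>l=1..n. y l ^ floor_exp i l else 0)"
  have m: "m \<in> twist n std H (int (\<Sum>l=1..n. floor_exp i l)) U"
    unfolding m_def by (rule twist_monomial[OF U])
  have m0: "m y \<noteq> 0" if "y \<in> \<Union>U" for y
    using that sub unfolding m_def torus_def by auto
  {
    assume s: "s \<in> twist n std H (- int (t * i)) U"
    show "s \<in> L_inv n a i U"
      by (rule L_invI[OF _ twist_mult[OF s m]])
        (simp_all add: cone m_def twist_outside[OF s])
  next
    assume "s \<in> L_inv n a i U"
    then obtain g where g: "\<forall>y. y \<notin> torus_cone n U \<longrightarrow> s y = 0"
      "g \<in> twist n std H (deg i) U"
      "\<forall>y\<in>torus_cone n U. s y * poles i y = g y" by (rule L_invE)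
    have "s y = g y * inverse (m y)" for y
    proof (cases "y \<in> \<Union>U")
      case True
      then have "s y * m y = g y" using g(3)[rule_format, of y] unfolding cone m_def by simp
      then show ?thesis using m0[OF True] by (simp add: field_simps)
    next
      case False
      then show ?thesis using g(1)[rule_format, of y] unfolding cone m_def by simp
    qed
    then have eq: "s = (\<lambda>y. g y * inverse (m y))" by (rule ext)
    show "s \<in> twist n std H (- int (t * i)) U"
      using twist_mult[OF g(2) twist_inverse[OF m m0]] unfolding eq by simp
  }
qed

lemma L_inv_scal:
  assumes U: "Op U" and f: "f \<in> funs (hyp n) U"
  shows "(\<lambda>y. if y \<in> torus_cone n U then f (orbit std y) else 0) \<in> L_inv n a 0 U"
proof -
  have "on_cone std U f \<in> twist n std H 0 U"
    using f funs_wproj_subvariety[OF subzar_subset(1)[OF U]] unfolding hyp_def by simp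
  then have "on_cone std U f \<in> twist n std H (deg 0) U"
    unfolding floor_exp_def by simp
  then show ?thesis
    by (rule L_invI[rotated]) (auto simp: floor_exp_def on_cone_def torus_cone_def)
qed

lemma carrier_iff:
  "s \<in> C U \<longleftrightarrow> (\<forall>i<r. s i \<in> L_inv n a i U) \<and> (\<forall>i\<ge>r. s i = (\<lambda>_. 0))"
  unfolding cover_algebra_def by simp

lemma sect_ops:
  "mult (sect Alg U) = cover_mult n a"
  "one (sect Alg U) = deg0_section (\<lambda>y. if y \<in> torus_cone n U then 1 else 0)"
  "zero (sect Alg U) = (\<lambda>_ _. 0)"
  "add (sect Alg U) = (\<lambda>s s' k y. s k y + s' k y)"
  "restr Alg V = (\<lambda>s k y. if y \<in> torus_cone n V then s k y else 0)"
  "scal Alg U = (\<lambda>f. deg0_section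
                (\<lambda>y. if y \<in> torus_cone n U then f (orbit std y) else 0))"
  unfolding cover_algebra_def by simp_all

lemma carrier_outside:
  assumes "s \<in> C U" "y \<notin> torus_cone n U"
  shows "s k y = 0"
proof (cases "k < r")
  case True
  then have "s k \<in> L_inv n a k U" using assms(1) unfolding carrier_iff by simp
  then show ?thesis using assms(2) unfolding L_inv_iff by simp
qed (use assms(1) in \<open>simp add: carrier_iff\<close>)

lemma zero_closed: "Op U \<Longrightarrow> (\<lambda>_ _. 0) \<in> C U"
  unfolding carrier_iff using L_inv_zero by simp

lemma add_closed: "s \<in> C U \<Longrightarrow> s' \<in> C U \<Longrightarrow> (\<lambda>k y. s k y + s' k y) \<in> C U"
  unfolding carrier_iff using L_inv_add by simp

lemma restr_closed: "s \<in> C U \<Longrightarrow> Op U \<Longrightarrow> Op V \<Longrightarrow> V \<subseteq> U \<Longrightarrow> restr Alg V s \<in> C V"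
proof -
  assume s: "s \<in> C U" and U: "Op U" "Op V" "V \<subseteq> U"
  have "(\<lambda>y. if y \<in> torus_cone n V then s i y else 0) \<in> L_inv n a i V" if "i < r" for i
    by (rule L_inv_restrict[OF _ U]) (use s that in \<open>simp add: carrier_iff\<close>)
  then show ?thesis using s unfolding carrier_iff sect_ops by auto
qed

lemma mult_closed:
  assumes U: "Op U" and s: "s \<in> C U" "s' \<in> C U"
  shows "cover_mult n a s s' \<in> C U"
  unfolding carrier_iff
proof (intro conjI allI impI)
  fix k assume k: "k < r"
  have "(\<lambda>y. if i + j = k then s i y * s' j y
        else if i + j = k + r then s i y * s' j y * (\<Prod>l=1..n. y l ^ \<mu> l) else 0) \<in> L_inv n a k U"
    if "i < r" "j < r" for i j
  proof -
    have ij: "s i \<in> L_inv n a i U" "s' j \<in> L_inv n a j U" using s that unfolding carrier_iff by auto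
    show ?thesis
      using L_inv_mult[OF U ij, of k 0] L_inv_mult[OF U ij, of k 1] L_inv_zero[OF U, of k]
      unfolding branch_def by (cases "i + j = k"; cases "i + j = k + r") simp_all
  qed
  then have "(\<lambda>y. \<Sum>i<r. \<Sum>j<r. if i + j = k then s i y * s' j y
        else if i + j = k + r then s i y * s' j y * (\<Prod>l=1..n. y l ^ \<mu> l) else 0) \<in> L_inv n a k U"
    by (intro L_inv_sum[OF U]) simp
  then show "cover_mult n a s s' k \<in> L_inv n a k U"
    using k unfolding cover_mult_def by simp
qed (simp add: cover_mult_def)

lemma scal_closed:
  assumes "Op U" "f \<in> funs (hyp n) U"
  shows "scal Alg U f \<in> C U"
  unfolding carrier_iff sect_ops deg0_section_def
proof (intro conjI allI impI)
  fix i
  show "(\<lambda>y. if i = 0 then if y \<in> torus_cone n U then f (orbit std y) else 0 else 0) \<in> L_inv n a i U"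
    using L_inv_scal[OF assms] L_inv_zero[OF assms(1), of i] by (cases "i = 0") simp_all
qed (use r_gt_1 in auto)

lemma one_closed:
  assumes "Op U"
  shows "one (sect Alg U) \<in> C U"
proof -
  interpret function_space "hyp n" by (rule function_space_hyp)
  have "(\<lambda>_. 1) \<in> funs (hyp n) U" using assms by (intro funs_const) simp
  from scal_closed[OF assms this] show ?thesis unfolding sect_ops by simp
qed

end


section \<open>Points of the cyclic cover\<close>

context cyclic_cover
begin

definition ev :: "vec \<Rightarrow> complex \<Rightarrow> cover_section \<Rightarrow> complex" where
  "ev y z s = (\<Sum>k<r. s k y * z ^ k)"

definition on_cover :: "vec \<Rightarrow> complex \<Rightarrow> bool" where
  "on_cover y z \<longleftrightarrow> y \<in> vecs n \<and> (\<forall>i\<in>{1..n}. y i \<noteq> 0) \<and> (\<Sum>i=1..n. y i) = 0 \<and> z ^ r = branch y"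

text \<open>The point of the cover over \<open>[y]\<close> at which \<open>z\<close> takes the given value: sections are evaluated
  there, and the value \<open>0\<close> outside the carriers is what \<open>stalk_hom\<close> prescribes.\<close>

definition cover_point :: "vec \<Rightarrow> complex \<Rightarrow> (point, cover_section) spec_point" where
  "cover_point y z = (orbit std y, \<lambda>U s. if Op U \<and> orbit std y \<in> U \<and> s \<in> C U then ev y z s else 0)"

abbreviation S :: "(point, cover_section) spec_point set" where
  "S \<equiv> spec_points (hyp n) Alg"

text \<open>The wrap-around of the multiplication is the rule \<open>z\<^sup>r = \<Prod>\<^sub>l y\<^sub>l\<^sup>\<mu>\<close>, so evaluation at a solution of
  this equation is multiplicative.\<close>

lemma ev_mult:
  assumes "z ^ r = branch y"
  shows "ev y z (cover_mult n a s s') = ev y z s * ev y z s'"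
proof -
  define T where "T i j k = (if i + j = k then s i y * s' j y
        else if i + j = k + r then s i y * s' j y * (\<Prod>l=1..n. y l ^ \<mu> l) else 0)" for i j k
  have T: "(\<Sum>k<r. T i j k * z ^ k) = (s i y * z ^ i) * (s' j y * z ^ j)" if "i < r" "j < r" for i j
  proof (cases "i + j < r")
    case True
    have "(\<Sum>k<r. T i j k * z ^ k) = (\<Sum>k<r. if k = i + j then s i y * s' j y * z ^ (i + j) else 0)"
      using True by (intro sum.cong) (auto simp: T_def)
    then show ?thesis using True by (simp add: sum.delta power_add mult_ac)
  next
    case False
    have "(\<Sum>k<r. T i j k * z ^ k) =
      (\<Sum>k<r. if k = i + j - r then s i y * s' j y * z ^ r * z ^ (i + j - r) else 0)"
      using False by (intro sum.cong) (auto simp: T_def assms branch_def)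
    also have "\<dots> = s i y * s' j y * z ^ (r + (i + j - r))"
      using that by (simp add: sum.delta power_add mult_ac)
    also have "r + (i + j - r) = i + j" using False by simp
    finally show ?thesis by (simp add: power_add mult_ac)
  qed
  have "ev y z (cover_mult n a s s') = (\<Sum>k<r. (\<Sum>i<r. \<Sum>j<r. T i j k) * z ^ k)"
    unfolding ev_def cover_mult_def T_def by (intro sum.cong) auto
  also have "\<dots> = (\<Sum>k<r. \<Sum>i<r. \<Sum>j<r. T i j k * z ^ k)" by (simp add: sum_distrib_right)
  also have "\<dots> = (\<Sum>i<r. \<Sum>k<r. \<Sum>j<r. T i j k * z ^ k)" by (rule sum.swap)
  also have "\<dots> = (\<Sum>i<r. \<Sum>j<r. \<Sum>k<r. T i j k * z ^ k)" by (intro sum.cong refl sum.swap)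
  also have "\<dots> = (\<Sum>i<r. \<Sum>j<r. (s i y * z ^ i) * (s' j y * z ^ j))" by (intro sum.cong refl T) auto
  also have "\<dots> = ev y z s * ev y z s'" unfolding ev_def by (simp add: sum_product)
  finally show ?thesis .
qed

lemma ev_deg0: "ev y z (deg0_section f) = f y"
proof -
  have "ev y z (deg0_section f) = (\<Sum>k<r. if k = 0 then f y else 0)"
    unfolding ev_def deg0_section_def by (intro sum.cong) auto
  then show ?thesis using r_gt_1 by simp
qed

lemma on_cover_torus: "on_cover y z \<Longrightarrow> orbit std y \<in> hyp_torus n"
  unfolding on_cover_def by (intro orbit_in_hyp_torus[OF n_pos]) auto

lemma on_cover_cone:
  assumes "on_cover y z" "orbit std y \<in> U"
  shows "y \<in> torus_cone n U"
  using assms orbit_self[of y std] unfolding on_cover_def torus_cone_def by auto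

lemma cover_point_in_S:
  assumes yz: "on_cover y z"
  shows "cover_point y z \<in> S"
proof -
  let ?\<phi> = "snd (cover_point y z)"
  have z: "z ^ r = branch y" using yz unfolding on_cover_def by simp
  have cp: "?\<phi> U s = (if Op U \<and> orbit std y \<in> U \<and> s \<in> C U then ev y z s else 0)" for U s
    unfolding cover_point_def by simp
  have "stalk_hom (hyp n) Alg (orbit std y) (?\<phi>)"
    unfolding stalk_hom_def zar_hyp
  proof (intro conjI allI impI ballI; (elim conjE)?)
    fix U s assume "\<not> (Op U \<and> orbit std y \<in> U \<and> s \<in> C U)"
    then show "?\<phi> U s = 0" unfolding cp by (rule if_not_P)
  next
    fix U assume U: "Op U" "orbit std y \<in> U"
    note cone = on_cover_cone[OF yz U(2)]
    have in_U: "?\<phi> U s = ev y z s" if "s \<in> C U" for s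
      unfolding cp using U that by simp
    show "?\<phi> U \<in> ring_hom (sect Alg U) complex_ring"
    proof (rule ring_hom_memI)
      fix s s' assume s: "s \<in> C U" "s' \<in> C U"
      show "?\<phi> U (s \<otimes>\<^bsub>sect Alg U\<^esub> s') =
        ?\<phi> U s \<otimes>\<^bsub>complex_ring\<^esub> ?\<phi> U s'"
        unfolding sect_ops in_U[OF s(1)] in_U[OF s(2)] in_U[OF mult_closed[OF U(1) s]] ev_mult[OF z]
        by (simp add: complex_ring_def)
      show "?\<phi> U (s \<oplus>\<^bsub>sect Alg U\<^esub> s') =
        ?\<phi> U s \<oplus>\<^bsub>complex_ring\<^esub> ?\<phi> U s'"
        unfolding sect_ops in_U[OF s(1)] in_U[OF s(2)] in_U[OF add_closed[OF s]]
        by (simp add: complex_ring_def ev_def distrib_right sum.distrib)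
    next
      show "?\<phi> U \<one>\<^bsub>sect Alg U\<^esub> = \<one>\<^bsub>complex_ring\<^esub>"
        unfolding in_U[OF one_closed[OF U(1)]] unfolding sect_ops ev_deg0
        using cone by (simp add: complex_ring_def)
    qed (simp add: complex_ring_def)
    fix f assume "f \<in> funs (hyp n) U"
    from in_U[OF scal_closed[OF U(1) this]]
    show "?\<phi> U (scal Alg U f) = f (orbit std y)"
      unfolding sect_ops ev_deg0 using cone by simp
  next
    fix U V s assume U: "Op U" "orbit std y \<in> U" and V: "Op V" "orbit std y \<in> V" "V \<subseteq> U"
      and s: "s \<in> C U"
    have "ev y z (restr Alg V s) = ev y z s"
      unfolding sect_ops ev_def using on_cover_cone[OF yz V(2)] by simp
    then show "?\<phi> V (restr Alg V s) = ?\<phi> U s"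
      unfolding cp using U V s restr_closed[OF s U(1) V(1,3)] by simp
  qed
  moreover have "orbit std y \<in> H" using on_cover_torus[OF yz] unfolding torus_def by simp
  ultimately show ?thesis unfolding spec_points_def zar_hyp topspace_hyp by (simp add: cover_point_def)
qed

lemma S_fst: "q \<in> S \<Longrightarrow> fst q \<in> H"
  unfolding spec_points_def by auto

lemma S_stalk_hom: "q \<in> S \<Longrightarrow> stalk_hom (hyp n) Alg (fst q) (snd q)"
  unfolding spec_points_def by auto

lemma S_outside:
  assumes "q \<in> S" "\<not> (Op U \<and> fst q \<in> U \<and> s \<in> C U)"
  shows "snd q U s = 0"
  using S_stalk_hom[OF assms(1)] assms(2) unfolding stalk_hom_def zar_hyp by blast

lemma S_hom: "q \<in> S \<Longrightarrow> Op U \<Longrightarrow> fst q \<in> U \<Longrightarrow> snd q U \<in> ring_hom (sect Alg U) complex_ring"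
  using S_stalk_hom unfolding stalk_hom_def zar_hyp by blast

lemma S_mult:
  assumes "q \<in> S" "Op U" "fst q \<in> U" "s \<in> C U" "s' \<in> C U"
  shows "snd q U (cover_mult n a s s') = snd q U s * snd q U s'"
  using ring_hom_mult[OF S_hom[OF assms(1-3)] assms(4,5)] unfolding sect_ops by (simp add: complex_ring_def)

lemma S_add:
  assumes "q \<in> S" "Op U" "fst q \<in> U" "s \<in> C U" "s' \<in> C U"
  shows "snd q U (\<lambda>k y. s k y + s' k y) = snd q U s + snd q U s'"
  using ring_hom_add[OF S_hom[OF assms(1-3)] assms(4,5)] unfolding sect_ops by (simp add: complex_ring_def)

lemma S_one:
  assumes "q \<in> S" "Op U" "fst q \<in> U"
  shows "snd q U (one (sect Alg U)) = 1"
  using ring_hom_one[OF S_hom[OF assms]] by (simp add: complex_ring_def)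

lemma S_zero:
  assumes "q \<in> S"
  shows "snd q U (\<lambda>_ _. 0) = 0"
proof (cases "Op U \<and> fst q \<in> U")
  case True
  then have "snd q U (\<lambda>_ _. 0) = snd q U (\<lambda>_ _. 0) + snd q U (\<lambda>_ _. 0)"
    using S_add[OF assms, of U "\<lambda>_ _. 0" "\<lambda>_ _. 0"] zero_closed[of U] by simp
  then show ?thesis by simp
qed (use S_outside[OF assms] in blast)

lemma S_scal:
  assumes "q \<in> S" "Op U" "fst q \<in> U" "f \<in> funs (hyp n) U"
  shows "snd q U (scal Alg U f) = f (fst q)"
  using S_stalk_hom[OF assms(1)] assms(2-4) unfolding stalk_hom_def zar_hyp by blast

lemma S_restr:
  assumes "q \<in> S" "Op U" "Op V" "fst q \<in> V" "V \<subseteq> U" "s \<in> C U"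
  shows "snd q V (restr Alg V s) = snd q U s"
  using S_stalk_hom[OF assms(1)] assms(2-6) unfolding stalk_hom_def zar_hyp by blast


subsection \<open>The topology and the regular functions\<close>

abbreviation Yz :: "(point, cover_section) spec_point topology" where
  "Yz \<equiv> spec_zariski (hyp n) Alg"

definition nonzero_at :: "point set \<Rightarrow> cover_section \<Rightarrow> (point, cover_section) spec_point set" where
  "nonzero_at U s = {q \<in> S. fst q \<in> U \<and> snd q U s \<noteq> 0}"

lemma Yz_eq: "Yz = topology_generated_by {nonzero_at U s | U s. Op U \<and> s \<in> C U}"
  unfolding spec_zariski_def nonzero_at_def zar_hyp ..

lemma openin_nonzero_at: "Op U \<Longrightarrow> s \<in> C U \<Longrightarrow> openin Yz (nonzero_at U s)"
  unfolding Yz_eq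
  by (rule topology_generated_by_Basis, rule CollectI, rule exI[of _ U], rule exI[of _ s]) simp

lemma nonzero_at_iff: "q \<in> nonzero_at U s \<longleftrightarrow> q \<in> S \<and> fst q \<in> U \<and> snd q U s \<noteq> 0"
  unfolding nonzero_at_def by simp

lemma Op_H: "Op H"
  using openin_topspace[of "subzar n std H"] unfolding topspace_hyp .

lemma topspace_Yz: "topspace Yz = S"
proof
  show "topspace Yz \<subseteq> S"
    unfolding Yz_eq topology_generated_by_topspace nonzero_at_def by auto
  note H = Op_H
  have "nonzero_at H (one (sect Alg H)) = S"
    by (rule Set.set_eqI) (simp add: nonzero_at_iff S_one[OF _ H] S_fst cong: conj_cong)
  then show "S \<subseteq> topspace Yz"
    using openin_subset[OF openin_nonzero_at[OF H one_closed[OF H]]] by simp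
qed

lemma Yz_basis:
  assumes "openin Yz N" "q \<in> N"
  obtains U s where "Op U" "s \<in> C U" "q \<in> nonzero_at U s" "nonzero_at U s \<subseteq> N"
proof -
  let ?B = "{nonzero_at U s | U s. Op U \<and> s \<in> C U}"
  have "\<exists>Q\<in>?B. q \<in> Q \<and> Q \<subseteq> N"
    using assms unfolding Yz_eq
  proof (rule generated_topology_basis)
    fix R Q q assume "R \<in> ?B" "Q \<in> ?B" and q: "q \<in> R \<inter> Q"
    then obtain U s V s' where R: "R = nonzero_at U s" and U: "Op U" "s \<in> C U"
      and Q: "Q = nonzero_at V s'" and V: "Op V" "s' \<in> C V" by blast
    define s1 where "s1 = restr Alg (U \<inter> V) s"
    define s2 where "s2 = restr Alg (U \<inter> V) s'"
    have UV: "Op (U \<inter> V)" using U(1) V(1) by (rule openin_Int)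
    have s12: "s1 \<in> C (U \<inter> V)" "s2 \<in> C (U \<inter> V)"
      unfolding s1_def s2_def by (auto intro!: restr_closed U V UV)
    have "snd q' (U \<inter> V) (cover_mult n a s1 s2) = snd q' U s * snd q' V s'"
      if "q' \<in> S" "fst q' \<in> U \<inter> V" for q'
      using S_mult[OF that(1) UV that(2) s12] S_restr[OF that(1) U(1) UV that(2) _ U(2)]
        S_restr[OF that(1) V(1) UV that(2) _ V(2)]
      unfolding s1_def s2_def by simp
    then have eq: "nonzero_at (U \<inter> V) (cover_mult n a s1 s2) = R \<inter> Q"
      unfolding R Q by (intro Set.set_eqI) (simp add: nonzero_at_iff cong: conj_cong, blast)
    have "R \<inter> Q \<in> ?B"
      unfolding eq[symmetric] using UV mult_closed[OF UV s12]
      by (intro CollectI exI[of _ "U \<inter> V"] exI[of _ "cover_mult n a s1 s2"] conjI refl)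
    then show "\<exists>P\<in>?B. q \<in> P \<and> P \<subseteq> R \<inter> Q" using q by blast
  qed
  then show thesis using that by blast
qed

definition fraction_on :: "(point, cover_section) spec_point set \<Rightarrow> ((point, cover_section) spec_point \<Rightarrow> complex) \<Rightarrow> bool" where
  "fraction_on N f \<longleftrightarrow> (\<exists>U s s'. Op U \<and> s \<in> C U \<and> s' \<in> C U \<and>
     (\<forall>q\<in>N. fst q \<in> U \<and> snd q U s' \<noteq> 0 \<and> f q = snd q U s / snd q U s'))"

lemma fraction_onI:
  assumes "Op U" "s \<in> C U" "s' \<in> C U"
    "\<And>q. q \<in> N \<Longrightarrow> fst q \<in> U \<and> snd q U s' \<noteq> 0 \<and> f q = snd q U s / snd q U s'"
  shows "fraction_on N f"
  unfolding fraction_on_def using assms by (intro exI[of _ U] exI[of _ s] exI[of _ s']) simp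

lemma fraction_onE:
  assumes "fraction_on N f"
  obtains U s s' where "Op U" "s \<in> C U" "s' \<in> C U"
    "\<forall>q\<in>N. fst q \<in> U \<and> snd q U s' \<noteq> 0 \<and> f q = snd q U s / snd q U s'"
  using assms unfolding fraction_on_def by (elim exE conjE) (rule that)

lemma fraction_on_cong:
  assumes "fraction_on N f" "M \<subseteq> N" "\<And>q. q \<in> M \<Longrightarrow> g q = f q"
  shows "fraction_on M g"
proof -
  obtain U s s' where *: "Op U" "s \<in> C U" "s' \<in> C U"
    "\<forall>q\<in>N. fst q \<in> U \<and> snd q U s' \<noteq> 0 \<and> f q = snd q U s / snd q U s'"
    using assms(1) by (rule fraction_onE)
  show ?thesis by (rule fraction_onI[OF *(1-3)]) (use *(4) assms(2,3) in auto)
qed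

text \<open>Two fractions get a common open set by restriction, which does not change the values.\<close>

lemma fraction_on_common:
  assumes "fraction_on N f" "fraction_on N g" "N \<subseteq> S"
  obtains U s s' u u' where "Op U" "s \<in> C U" "s' \<in> C U" "u \<in> C U" "u' \<in> C U"
    "\<forall>q\<in>N. fst q \<in> U \<and> snd q U s' \<noteq> 0 \<and> f q = snd q U s / snd q U s'"
    "\<forall>q\<in>N. snd q U u' \<noteq> 0 \<and> g q = snd q U u / snd q U u'"
proof -
  obtain U s s' where U: "Op U" "s \<in> C U" "s' \<in> C U"
    "\<forall>q\<in>N. fst q \<in> U \<and> snd q U s' \<noteq> 0 \<and> f q = snd q U s / snd q U s'"
    using assms(1) by (rule fraction_onE)
  obtain V u u' where V: "Op V" "u \<in> C V" "u' \<in> C V"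
    "\<forall>q\<in>N. fst q \<in> V \<and> snd q V u' \<noteq> 0 \<and> g q = snd q V u / snd q V u'"
    using assms(2) by (rule fraction_onE)
  have UV: "Op (U \<inter> V)" using U(1) V(1) by (rule openin_Int)
  have N: "q \<in> S" "fst q \<in> U \<inter> V" if "q \<in> N" for q using that U(4) V(4) assms(3) by auto
  note R = S_restr[OF N(1) U(1) UV N(2) Int_lower1] S_restr[OF N(1) V(1) UV N(2) Int_lower2]
  show thesis
    by (rule that[OF UV restr_closed[OF U(2,1) UV Int_lower1] restr_closed[OF U(3,1) UV Int_lower1]
        restr_closed[OF V(2,1) UV Int_lower2] restr_closed[OF V(3,1) UV Int_lower2]])
      (use U(4) V(4) in \<open>simp_all add: R(1)[OF _ _ U(2)] R(1)[OF _ _ U(3)] R(2)[OF _ _ V(2)] R(2)[OF _ _ V(3)]\<close>)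
qed

lemma fraction_on_add_mult:
  assumes "fraction_on N f" "fraction_on N g" "N \<subseteq> S"
  shows "fraction_on N (\<lambda>q. f q + g q)" "fraction_on N (\<lambda>q. f q * g q)"
proof -
  obtain U s s' u u' where U: "Op U" "s \<in> C U" "s' \<in> C U" "u \<in> C U" "u' \<in> C U"
    and f: "\<forall>q\<in>N. fst q \<in> U \<and> snd q U s' \<noteq> 0 \<and> f q = snd q U s / snd q U s'"
    and g: "\<forall>q\<in>N. snd q U u' \<noteq> 0 \<and> g q = snd q U u / snd q U u'"
    using assms by (rule fraction_on_common)
  have N: "q \<in> S" "fst q \<in> U" if "q \<in> N" for q using that f assms(3) by auto
  note M = S_mult[OF N(1) U(1) N(2)] and A = S_add[OF N(1) U(1) N(2)] and cl = mult_closed[OF U(1)]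
  show "fraction_on N (\<lambda>q. f q + g q)"
    by (rule fraction_onI[OF U(1) add_closed[OF cl[OF U(2,5)] cl[OF U(4,3)]] cl[OF U(3,5)]])
      (use f g in \<open>simp add: A[OF _ _ cl[OF U(2,5)] cl[OF U(4,3)]] M U add_frac_eq\<close>)
  show "fraction_on N (\<lambda>q. f q * g q)"
    by (rule fraction_onI[OF U(1) cl[OF U(2,4)] cl[OF U(3,5)]]) (use f g in \<open>simp add: M U\<close>)
qed

lemma zar_Y' [simp]: "zar (Y' n a) = Yz"
  unfolding Y'_def rel_spec_def by simp

abbreviation fraction_near where
  "fraction_near A f q \<equiv> \<exists>N. openin Yz N \<and> q \<in> N \<and> N \<subseteq> A \<and> fraction_on N f"

lemma funs_Y'_iff:
  "f \<in> funs (Y' n a) A \<longleftrightarrow> (\<forall>q\<in>A. \<exists>N. openin Yz N \<and> q \<in> N \<and> N \<subseteq> A \<and> fraction_on N f)"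
  unfolding Y'_def rel_spec_def fraction_on_def zar_hyp by auto

lemma funs_Y'E:
  assumes "f \<in> funs (Y' n a) A" "q \<in> A"
  obtains N where "openin Yz N" "q \<in> N" "N \<subseteq> A" "fraction_on N f"
  using assms unfolding funs_Y'_iff by auto

lemma function_space_Y': "function_space (Y' n a)"
proof
  fix A assume "openin (zar (Y' n a)) A"
  then have A: "openin Yz A" by simp
  then have AS: "A \<subseteq> S" using openin_subset topspace_Yz by metis
  {
    fix c
    interpret function_space "hyp n" by (rule function_space_hyp)
    note H = Op_H
    have c: "(\<lambda>_. c) \<in> funs (hyp n) H" using H by (intro funs_const) simp
    have "fraction_on A (\<lambda>_. c)"
      by (rule fraction_onI[OF H scal_closed[OF H c] one_closed[OF H]])
        (use S_scal[OF _ H S_fst c] S_one[OF _ H S_fst] S_fst AS in \<open>simp add: subset_iff del: split_paired_All\<close>)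
    then show "(\<lambda>_. c) \<in> funs (Y' n a) A" unfolding funs_Y'_iff using A by blast
  }
  {
    fix f assume f: "f \<in> funs (Y' n a) A"
    show "(\<lambda>q. inverse (f q)) \<in> funs (Y' n a) A" if nz: "\<And>q. q \<in> A \<Longrightarrow> f q \<noteq> 0"
      unfolding funs_Y'_iff
    proof
      fix q assume "q \<in> A"
      with f obtain N where N: "openin Yz N" "q \<in> N" "N \<subseteq> A" "fraction_on N f" by (rule funs_Y'E)
      obtain U s s' where *: "Op U" "s \<in> C U" "s' \<in> C U"
        "\<forall>q\<in>N. fst q \<in> U \<and> snd q U s' \<noteq> 0 \<and> f q = snd q U s / snd q U s'"
        using N(4) by (rule fraction_onE)
      have "fraction_on N (\<lambda>q. inverse (f q))"
        by (rule fraction_onI[OF *(1,3,2)]) (use *(4) N(3) nz in force)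
      then show "fraction_near A (\<lambda>q. inverse (f q)) q"
        using N by (intro exI[of _ N]) simp
    qed
    show "openin (zar (Y' n a)) {q \<in> A. f q \<noteq> 0}"
      unfolding zar_Y'
    proof (subst openin_subopen, intro ballI)
      fix q assume q: "q \<in> {q \<in> A. f q \<noteq> 0}"
      then have "q \<in> A" by simp
      with f obtain N where N: "openin Yz N" "q \<in> N" "N \<subseteq> A" "fraction_on N f" by (rule funs_Y'E)
      obtain U s s' where *: "Op U" "s \<in> C U" "s' \<in> C U"
        "\<forall>q\<in>N. fst q \<in> U \<and> snd q U s' \<noteq> 0 \<and> f q = snd q U s / snd q U s'"
        using N(4) by (rule fraction_onE)
      have "N \<inter> nonzero_at U s \<subseteq> {q \<in> A. f q \<noteq> 0}" "q \<in> N \<inter> nonzero_at U s"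
        using *(4) N(2,3) q AS unfolding nonzero_at_def by auto
      then show "\<exists>T. openin Yz T \<and> q \<in> T \<and> T \<subseteq> {q \<in> A. f q \<noteq> 0}"
        using openin_Int[OF N(1) openin_nonzero_at[OF *(1,2)]] by (intro exI[of _ "N \<inter> nonzero_at U s"]) simp
    qed
    fix g assume g: "g \<in> funs (Y' n a) A"
    have "\<exists>N. openin Yz N \<and> q \<in> N \<and> N \<subseteq> A \<and> fraction_on N (\<lambda>q. f q + g q) \<and> fraction_on N (\<lambda>q. f q * g q)"
      if "q \<in> A" for q
    proof -
      from f that obtain N where N: "openin Yz N" "q \<in> N" "N \<subseteq> A" "fraction_on N f" by (rule funs_Y'E)
      from g that obtain M where M: "openin Yz M" "q \<in> M" "M \<subseteq> A" "fraction_on M g" by (rule funs_Y'E)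
      have "fraction_on (N \<inter> M) f" "fraction_on (N \<inter> M) g"
        using fraction_on_cong[OF N(4)] fraction_on_cong[OF M(4)] by auto
      from fraction_on_add_mult[OF this] N M AS show ?thesis
        by (intro exI[of _ "N \<inter> M"]) auto
    qed
    then show "(\<lambda>q. f q + g q) \<in> funs (Y' n a) A" "(\<lambda>q. f q * g q) \<in> funs (Y' n a) A"
      unfolding funs_Y'_iff by meson+
  }
  show "f \<in> funs (Y' n a) V"
    if f: "f \<in> funs (Y' n a) A" and "openin (zar (Y' n a)) V" and VA: "V \<subseteq> A" for f V
    unfolding funs_Y'_iff
  proof
    fix q assume q: "q \<in> V"
    then have "q \<in> A" using VA by auto
    with f obtain N where N: "openin Yz N" "q \<in> N" "N \<subseteq> A" "fraction_on N f" by (rule funs_Y'E)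
    have "fraction_on (N \<inter> V) f" by (rule fraction_on_cong[OF N(4)]) auto
    then show "fraction_near V f q"
      using N(1,2) q that(2) by (intro exI[of _ "N \<inter> V"]) auto
  qed
  fix f assume loc: "\<And>p. p \<in> A \<Longrightarrow> \<exists>V g. openin (zar (Y' n a)) V \<and> p \<in> V \<and> V \<subseteq> A \<and>
      g \<in> funs (Y' n a) V \<and> (\<forall>q\<in>V. f q = g q)"
  show "f \<in> funs (Y' n a) A"
    unfolding funs_Y'_iff
  proof
    fix q assume "q \<in> A"
    from loc[OF this] obtain V g where V: "openin (zar (Y' n a)) V" "q \<in> V" "V \<subseteq> A"
      "g \<in> funs (Y' n a) V" "\<forall>q\<in>V. f q = g q"
      by (elim exE conjE) (rule that)
    from V(4,2) obtain N where N: "openin Yz N" "q \<in> N" "N \<subseteq> V" "fraction_on N g" by (rule funs_Y'E)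
    have "fraction_on N f" by (rule fraction_on_cong[OF N(4)]) (use V(5) N(3) in auto)
    then show "fraction_near A f q"
      using N V(3) by (intro exI[of _ N]) auto
  qed
qed

lemma funs_fst:
  assumes U: "Op U" and f: "f \<in> funs (hyp n) U"
  shows "(\<lambda>q. f (fst q)) \<in> funs (Y' n a) {q \<in> S. fst q \<in> U}" "openin Yz {q \<in> S. fst q \<in> U}"
proof -
  have "{q \<in> S. fst q \<in> U} = nonzero_at U (one (sect Alg U))"
    by (rule Set.set_eqI) (simp add: nonzero_at_iff S_one[OF _ U] cong: conj_cong)
  then show op: "openin Yz {q \<in> S. fst q \<in> U}" using openin_nonzero_at[OF U one_closed[OF U]] by simp
  have "fraction_on {q \<in> S. fst q \<in> U} (\<lambda>q. f (fst q))"
    by (rule fraction_onI[OF U scal_closed[OF U f] one_closed[OF U]])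
      (use S_scal[OF _ U _ f] S_one[OF _ U] in auto)
  then show "(\<lambda>q. f (fst q)) \<in> funs (Y' n a) {q \<in> S. fst q \<in> U}"
    unfolding funs_Y'_iff using op by blast
qed

end


subsection \<open>The cover over the torus\<close>

text \<open>Over the torus the algebra is generated by \<open>z\<close>, up to a twist by \<open>y\<^sub>1\<close>.  Hence a point of
  the cover there is a point of the torus together with a value of \<open>z\<close>.\<close>

context cyclic_cover
begin

definition single :: "nat \<Rightarrow> (vec \<Rightarrow> complex) \<Rightarrow> cover_section" where
  "single k f = (\<lambda>k' y. if k' = k then f y else 0)"

lemma deg0_section_single: "deg0_section f = single 0 f"
  unfolding deg0_section_def single_def ..

lemma single_closed:
  assumes "Op U" "k < r" "f \<in> L_inv n a k U"
  shows "single k f \<in> C U"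
  unfolding carrier_iff
proof (intro conjI allI impI)
  show "single k f i \<in> L_inv n a i U" for i
    using assms L_inv_zero[of U i] unfolding single_def by (cases "i = k") simp_all
qed (use assms(2) in \<open>auto simp: single_def\<close>)

lemma cover_mult_single:
  assumes "i < r" "j < r" "i + j = k + c * r" "k < r" "c \<le> 1"
  shows "cover_mult n a (single i f) (single j g) = single k (\<lambda>y. f y * g y * branch y ^ c)"
proof (intro ext)
  fix k' y
  define R where "R = (if i + j = k' then f y * g y else if i + j = k' + r then f y * g y * branch y else 0)"
  have "(\<Sum>i'<r. \<Sum>j'<r. if i' + j' = k' then single i f i' y * single j g j' y
        else if i' + j' = k' + r then single i f i' y * single j g j' y * branch y else 0) =
    (\<Sum>i'<r. \<Sum>j'<r. if i' = i \<and> j' = j then R else 0)"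
    by (intro sum.cong refl) (auto simp: single_def R_def)
  also have "\<dots> = (\<Sum>i'<r. if i' = i then \<Sum>j'<r. if j' = j then R else 0 else 0)"
    by (intro sum.cong refl) auto
  also have "\<dots> = R"
    using assms by (simp add: sum.delta)
  finally have "k' < r \<Longrightarrow> cover_mult n a (single i f) (single j g) k' y = R"
    unfolding cover_mult_def branch_def by simp
  moreover have "c = 0 \<or> c = 1" using assms(5) by auto
  ultimately show "cover_mult n a (single i f) (single j g) k' y = single k (\<lambda>y. f y * g y * branch y ^ c) k' y"
    using assms by (cases "k' < r") (auto simp: single_def cover_mult_def R_def)
qed

text \<open>The power \<open>y\<^sub>1\<^sup>-\<^sup>t\<^sup>k\<close> trivializes \<open>\<O>(-tk)\<close> on the torus.  So \<open>zeta U k\<close> below is \<open>(z / y\<^sub>1\<^sup>t)\<^sup>k\<close>,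
  and \<open>fiber_coord\<close> is the value of \<open>z\<close> at the representative with \<open>y\<^sub>1 = 1\<close>.\<close>

definition inv_power :: "point set \<Rightarrow> nat \<Rightarrow> vec \<Rightarrow> complex" where
  "inv_power U k y = (if y \<in> \<Union>U then 1 / y 1 ^ (t * k) else 0)"

lemma torus_nonzero:
  assumes "U \<subseteq> hyp_torus n" "y \<in> \<Union>U" "i \<in> {1..n}"
  shows "y i \<noteq> 0"
  using assms unfolding torus_def by auto

lemma whom_y1_power: "whom n std k (\<lambda>y. y 1 ^ k)"
  using whom_power[OF whom_coord[of 1 n std], of k] n_pos by simp

lemma inv_power_closed:
  assumes U: "Op U" "U \<subseteq> hyp_torus n"
  shows "inv_power U k \<in> L_inv n a k U"
  unfolding L_inv_torus[OF U] inv_power_def[abs_def]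
proof (rule twist_quotient[OF U(1) whom_const whom_y1_power])
  show "y 1 ^ (t * k) \<noteq> 0" if "y \<in> \<Union>U" for y using torus_nonzero[OF U(2) that, of 1] n_pos by simp
qed simp

definition zeta :: "point set \<Rightarrow> nat \<Rightarrow> cover_section" where
  "zeta U k = single k (inv_power U k)"

lemma zeta_closed: "Op U \<Longrightarrow> U \<subseteq> hyp_torus n \<Longrightarrow> k < r \<Longrightarrow> zeta U k \<in> C U"
  unfolding zeta_def by (intro single_closed inv_power_closed)

definition fiber_coord :: "(point, cover_section) spec_point \<Rightarrow> complex" where
  "fiber_coord q = snd q (hyp_torus n) (zeta (hyp_torus n) 1)"

lemma value_zeta:
  assumes q: "q \<in> S" "fst q \<in> U" and U: "Op U" "U \<subseteq> hyp_torus n" and "k < r"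
  shows "snd q U (zeta U k) = fiber_coord q ^ k"
  using \<open>k < r\<close>
proof (induction k)
  case 0
  have "zeta U 0 = one (sect Alg U)"
    unfolding zeta_def sect_ops deg0_section_single torus_cone_torus[OF U(2)] inv_power_def[abs_def]
    by (simp cong: if_cong)
  then show ?case using S_one[OF q(1) U(1) q(2)] by simp
next
  case (Suc k)
  have T: "Op (hyp_torus n)" by (rule openin_hyp_torus)
  have 1: "1 < r" by (rule r_gt_1)
  have "restr Alg U (zeta (hyp_torus n) 1) = zeta U 1"
    unfolding sect_ops zeta_def single_def inv_power_def torus_cone_torus[OF U(2)]
    using U(2) by (intro ext) auto
  then have z: "snd q U (zeta U 1) = fiber_coord q"
    using S_restr[OF q(1) T U(1) q(2) U(2) zeta_closed[OF T subset_refl 1]] unfolding fiber_coord_def by simp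
  have "cover_mult n a (zeta U k) (zeta U 1) = single (Suc k) (\<lambda>y. inv_power U k y * inv_power U 1 y * branch y ^ 0)"
    unfolding zeta_def using Suc.prems 1 by (intro cover_mult_single) auto
  also have "\<dots> = zeta U (Suc k)"
    unfolding zeta_def inv_power_def by (intro arg_cong[of _ _ "single (Suc k)"] ext) (simp add: power_add)
  finally show ?case
    using S_mult[OF q(1) U(1) q(2) zeta_closed[OF U, of k] zeta_closed[OF U 1]] Suc z by (simp add: mult.commute)
qed

lemma scal_torus:
  assumes "U \<subseteq> hyp_torus n"
  shows "scal Alg U f = single 0 (on_cone std U f)"
  unfolding sect_ops deg0_section_single torus_cone_torus[OF assms] on_cone_def ..

lemma fiber_coord_power:
  assumes q: "q \<in> S" "fst q \<in> hyp_torus n"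
  shows "fiber_coord q ^ r = branch (normal_rep (fst q))"
proof -
  let ?T = "hyp_torus n"
  have T: "Op ?T" by (rule openin_hyp_torus)
  define h where "h = ratio branch (\<lambda>y. y 1 ^ (t * r))"
  have wb: "whom n std (t * r) branch"
    using whom_monomial[of n std \<mu> 1] degree_tt unfolding branch_def[abs_def] by simp
  have nz: "y 1 ^ (t * r) \<noteq> 0" if "y \<in> \<Union>?T" for y using torus_nonzero[OF subset_refl that, of 1] n_pos by simp
  have h: "h \<in> funs (hyp n) ?T"
    unfolding h_def hyp_def by (rule funs_ratio[OF T wb whom_y1_power]) (rule nz)
  have r1: "r - 1 < r" "1 < r" using r_gt_1 by auto
  have "cover_mult n a (zeta ?T (r - 1)) (zeta ?T 1) =
      single 0 (\<lambda>y. inv_power ?T (r - 1) y * inv_power ?T 1 y * branch y ^ 1)"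
    unfolding zeta_def using r_gt_1 by (intro cover_mult_single) auto
  also have "\<dots> = scal Alg ?T h"
    unfolding scal_torus[OF subset_refl]
  proof (intro arg_cong[of _ _ "single 0"] ext)
    fix y
    show "inv_power ?T (r - 1) y * inv_power ?T 1 y * branch y ^ 1 = on_cone std ?T h y"
    proof (cases "y \<in> \<Union>?T")
      case True
      have "orbit std y \<in> wproj n std" using cone_memD[OF hyp_torus_subset True] hyp_torus_subset by blast
      then have "h (orbit std y) = branch y / y 1 ^ (t * r)"
        unfolding h_def by (rule ratio_eq[OF wb whom_y1_power _ orbit_self])
      moreover have "t * (r - 1) + t * 1 = t * r" using r_gt_1 by (simp add: algebra_simps)
      then have "y 1 ^ (t * (r - 1)) * y 1 ^ (t * 1) = y 1 ^ (t * r)" by (metis power_add)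
      moreover have "inv_power ?T (r - 1) y * inv_power ?T 1 y * branch y ^ 1 =
          branch y / (y 1 ^ (t * (r - 1)) * y 1 ^ (t * 1))"
        using True unfolding inv_power_def by simp
      ultimately show ?thesis using True unfolding on_cone_def by simp
    qed (simp add: inv_power_def on_cone_def)
  qed
  finally have "snd q ?T (zeta ?T (r - 1)) * snd q ?T (zeta ?T 1) = h (fst q)"
    using S_mult[OF q(1) T q(2) zeta_closed[OF T subset_refl r1(1)] zeta_closed[OF T subset_refl r1(2)]]
      S_scal[OF q(1) T q(2) h] by simp
  moreover have "h (fst q) = branch (normal_rep (fst q))"
    using ratio_eq[OF wb whom_y1_power _ normal_rep_mem(1)[OF n_pos q(2)]] q(2) hyp_torus_subset
      normal_rep_mem(2)[OF n_pos q(2)] unfolding h_def by auto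
  ultimately have "fiber_coord q ^ (r - 1) * fiber_coord q ^ 1 = branch (normal_rep (fst q))"
    using value_zeta[OF q T subset_refl r1(1)] value_zeta[OF q T subset_refl r1(2)] by simp
  moreover have "fiber_coord q ^ (r - 1) * fiber_coord q ^ 1 = fiber_coord q ^ r"
    unfolding power_add[symmetric] using r_gt_1 by simp
  ultimately show ?thesis by simp
qed

lemma normal_rep_on_cover:
  assumes "q \<in> S" "fst q \<in> hyp_torus n"
  shows "on_cover (normal_rep (fst q)) (fiber_coord q)"
proof -
  note N = normal_rep_mem[OF n_pos assms(2)]
  have "fst q \<in> wproj n std" "\<forall>y\<in>fst q. (\<Sum>i=1..n. y i) = 0"
    using assms(2) unfolding torus_def hyp_points_def by auto
  then show ?thesis
    unfolding on_cover_def using N fiber_coord_power[OF assms] wproj_point(2) by blast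
qed

lemma homogeneous_coefficient:
  assumes U: "Op U" "U \<subseteq> hyp_torus n" and s: "s \<in> L_inv n a k U"
  shows "(\<lambda>p. s (normal_rep p)) \<in> funs (hyp n) U"
    and "y \<in> \<Union>U \<Longrightarrow> s (normal_rep (orbit std y)) = s y * y 1 ^ (t * k)"
proof -
  have s': "s \<in> twist n std H (- int (t * k)) U" using s unfolding L_inv_torus[OF U] .
  show eq: "s (normal_rep (orbit std y)) = s y * y 1 ^ (t * k)" if y: "y \<in> \<Union>U" for y
  proof -
    have y1: "y 1 \<noteq> 0" using torus_nonzero[OF U(2) y, of 1] n_pos by simp
    have "orbit std y \<in> hyp_torus n" using Op_cone[OF U(1) y] U(2) by blast
    from normal_rep_eq[OF n_pos this orbit_self]
    have "s (normal_rep (orbit std y)) = s (\<lambda>i. inverse (y 1) ^ std i * y i)" by simp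
    also have "\<dots> = inverse (y 1) powi (- int (t * k)) * s y"
      using twist_homogeneous[OF s' subzar_subset(1)[OF U(1)] y, of "inverse (y 1)"] y1 by simp
    also have "inverse (y 1) powi (- int (t * k)) = y 1 ^ (t * k)"
      by (simp only: power_int_minus power_int_of_nat power_inverse inverse_inverse_eq)
    finally show ?thesis by (simp only: mult.commute)
  qed
  have "(\<lambda>y. if y \<in> \<Union>U then y 1 ^ (t * k) / 1 else 0) \<in> twist n std H (int (t * k)) U"
    by (rule twist_quotient[OF U(1) whom_y1_power whom_const]) auto
  from twist_mult[OF s' this]
  have "(\<lambda>y. s y * (if y \<in> \<Union>U then y 1 ^ (t * k) / 1 else 0)) \<in> twist n std H 0 U" by simp
  moreover have "on_cone std U (\<lambda>p. s (normal_rep p)) = (\<lambda>y. s y * (if y \<in> \<Union>U then y 1 ^ (t * k) / 1 else 0))"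
    unfolding on_cone_def using eq by (intro ext) simp
  ultimately show "(\<lambda>p. s (normal_rep p)) \<in> funs (hyp n) U"
    unfolding hyp_def funs_wproj_subvariety[OF subzar_subset(1)[OF U(1)]] by simp
qed

text \<open>A section \<open>\<Sum>\<^sub>k s\<^sub>k z\<^sup>k\<close> is the sum of the products of the regular functions \<open>s\<^sub>k y\<^sub>1\<^sup>t\<^sup>k\<close> with
  the sections \<open>zeta U k\<close>.  The homomorphism is evaluation on the former by definition and a power of
  \<open>fiber_coord\<close> on the latter.\<close>

lemma value_over_torus:
  assumes q: "q \<in> S" "fst q \<in> U" and U: "Op U" "U \<subseteq> hyp_torus n" and s: "s \<in> C U"
  shows "snd q U s = ev (normal_rep (fst q)) (fiber_coord q) s"
proof -
  have sk: "s k \<in> L_inv n a k U" if "k < r" for k using s that unfolding carrier_iff by simp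
  have s_high: "s k y = 0" if "\<not> k < r" for k y using s that unfolding carrier_iff by simp
  have "snd q U (\<lambda>k y. if k < m then s k y else 0) =
    (\<Sum>k<m. s k (normal_rep (fst q)) * fiber_coord q ^ k)" if "m \<le> r" for m
    using that
  proof (induction m)
    case 0
    show ?case using S_zero[OF q(1)] by simp
  next
    case (Suc m)
    then have m: "m < r" by simp
    define h where "h = (\<lambda>p. s m (normal_rep p))"
    note h = homogeneous_coefficient[OF U sk[OF m], folded h_def]
    have trunc: "(\<lambda>k y. if k < m then s k y else 0) \<in> C U"
      unfolding carrier_iff
    proof (intro conjI allI impI)
      show "(\<lambda>y. if k < m then s k y else 0) \<in> L_inv n a k U" if "k < r" for k
        using sk[OF that] L_inv_zero[OF U(1), of k] by (cases "k < m") simp_all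
      show "(\<lambda>y. if k < m then s k y else 0) = (\<lambda>_. 0)" if "k \<ge> r" for k
        using that m by auto
    qed
    have "cover_mult n a (scal Alg U h) (zeta U m) =
        single m (\<lambda>y. on_cone std U h y * inv_power U m y * branch y ^ 0)"
      unfolding scal_torus[OF U(2)] zeta_def using m r_gt_1 by (intro cover_mult_single) auto
    also have "\<dots> = single m (s m)"
    proof (intro arg_cong[of _ _ "single m"] ext)
      fix y
      show "on_cone std U h y * inv_power U m y * branch y ^ 0 = s m y"
      proof (cases "y \<in> \<Union>U")
        case True
        have "y 1 \<noteq> 0" using torus_nonzero[OF U(2) True, of 1] n_pos by simp
        then show ?thesis using h(2)[OF True] True unfolding on_cone_def inv_power_def h_def by simp
      next
        case False
        then show ?thesis
          using carrier_outside[OF s, of y m] unfolding torus_cone_torus[OF U(2)] inv_power_def by simp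
      qed
    qed
    finally have "snd q U (single m (s m)) = h (fst q) * fiber_coord q ^ m"
      using S_mult[OF q(1) U(1) q(2) scal_closed[OF U(1) h(1)] zeta_closed[OF U m]]
        S_scal[OF q(1) U(1) q(2) h(1)] value_zeta[OF q U m] by simp
    moreover have "snd q U (\<lambda>k y. (if k < m then s k y else 0) + single m (s m) k y) =
        snd q U (\<lambda>k y. if k < m then s k y else 0) + snd q U (single m (s m))"
      by (rule S_add[OF q(1) U(1) q(2) trunc single_closed[OF U(1) m sk[OF m]]])
    moreover have "(\<lambda>k y. (if k < m then s k y else 0) + single m (s m) k y) = (\<lambda>k y. if k < Suc m then s k y else 0)"
      unfolding single_def by (intro ext) auto
    ultimately show ?case using Suc by (simp add: h_def)
  qed
  from this[of r] have "snd q U (\<lambda>k y. if k < r then s k y else 0) = ev (normal_rep (fst q)) (fiber_coord q) s"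
    unfolding ev_def by simp
  moreover have "(\<lambda>k y. if k < r then s k y else 0) = s"
    using s_high by (intro ext) simp
  ultimately show ?thesis by simp
qed

text \<open>A point of the cover is determined by its values on small open sets, as these values are
  compatible with restriction to the torus.\<close>

lemma cover_point_fiber_coord:
  assumes q: "q \<in> S" "fst q \<in> hyp_torus n"
  shows "cover_point (normal_rep (fst q)) (fiber_coord q) = q"
proof -
  let ?T = "hyp_torus n"
  have T: "Op ?T" by (rule openin_hyp_torus)
  have orb: "orbit std (normal_rep (fst q)) = fst q" by (rule normal_rep_mem(3)[OF n_pos q(2)])
  have val: "(if Op U \<and> fst q \<in> U \<and> s \<in> C U then ev (normal_rep (fst q)) (fiber_coord q) s else 0) = snd q U s" for U s
  proof (cases "Op U \<and> fst q \<in> U \<and> s \<in> C U")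
    case True
    then have U: "Op U" "fst q \<in> U" "s \<in> C U" by auto
    have N: "Op (U \<inter> ?T)" "fst q \<in> U \<inter> ?T" "U \<inter> ?T \<subseteq> U" "U \<inter> ?T \<subseteq> ?T"
      using openin_Int[OF U(1) T] U(2) q(2) by auto
    let ?s = "restr Alg (U \<inter> ?T) s"
    have "snd q U s = snd q (U \<inter> ?T) ?s"
      using S_restr[OF q(1) U(1) N(1-3) U(3)] by simp
    also have "\<dots> = ev (normal_rep (fst q)) (fiber_coord q) ?s"
      by (rule value_over_torus[OF q(1) N(2,1,4) restr_closed[OF U(3,1) N(1,3)]])
    also have "\<dots> = ev (normal_rep (fst q)) (fiber_coord q) s"
    proof -
      have "normal_rep (fst q) \<in> torus_cone n (U \<inter> ?T)"
        using on_cover_cone[OF normal_rep_on_cover[OF q]] N(2) orb by simp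
      then show ?thesis unfolding sect_ops ev_def by simp
    qed
    finally show ?thesis using True by simp
  qed (use S_outside[OF q(1)] in auto)
  have "snd (cover_point (normal_rep (fst q)) (fiber_coord q)) = snd q"
    unfolding cover_point_def snd_conv orb by (intro ext val)
  moreover have "fst (cover_point (normal_rep (fst q)) (fiber_coord q)) = fst q"
    unfolding cover_point_def using orb by simp
  ultimately show ?thesis by (rule prod_eqI[rotated])
qed

definition cover_torus :: "(point, cover_section) spec_point set" where
  "cover_torus = {q \<in> S. fst q \<in> hyp_torus n}"

lemma openin_cover_torus: "openin Yz cover_torus"
proof -
  interpret function_space "hyp n" by (rule function_space_hyp)
  have "(\<lambda>_. 0) \<in> funs (hyp n) (hyp_torus n)" using openin_hyp_torus by (intro funs_const) simp
  from funs_fst(2)[OF openin_hyp_torus this] show ?thesis unfolding cover_torus_def .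
qed

lemma funs_fiber_coord: "fiber_coord \<in> funs (Y' n a) cover_torus"
proof -
  have T: "Op (hyp_torus n)" by (rule openin_hyp_torus)
  have "fraction_on cover_torus fiber_coord"
    by (rule fraction_onI[OF T zeta_closed[OF T subset_refl r_gt_1] one_closed[OF T]])
      (simp add: cover_torus_def fiber_coord_def S_one[OF _ T] del: One_nat_def)
  then show ?thesis unfolding funs_Y'_iff using openin_cover_torus by blast
qed

lemma cover_point_in_torus:
  assumes "on_cover y z"
  shows "cover_point y z \<in> cover_torus"
  unfolding cover_torus_def using cover_point_in_S[OF assms] on_cover_torus[OF assms]
  by (simp add: cover_point_def)

lemma fiber_coord_cover_point:
  assumes "on_cover y z" "y 1 = 1"
  shows "fiber_coord (cover_point y z) = z"
proof -
  have T: "Op (hyp_torus n)" by (rule openin_hyp_torus)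
  have y: "y \<in> \<Union>(hyp_torus n)" using on_cover_torus[OF assms(1)] orbit_self[of y std] by blast
  have "fiber_coord (cover_point y z) = ev y z (zeta (hyp_torus n) 1)"
    unfolding fiber_coord_def cover_point_def
    using T on_cover_torus[OF assms(1)] zeta_closed[OF T subset_refl r_gt_1] by simp
  also have "\<dots> = (\<Sum>k<r. if k = 1 then z else 0)"
    unfolding ev_def zeta_def single_def inv_power_def using y assms(2) by (intro sum.cong) auto
  finally show ?thesis using r_gt_1 by simp
qed

text \<open>A section that is nonzero at some point of the cover is nonzero as a function on the torus,
  say at \<open>y\<close>.  There it is a nonzero polynomial in \<open>z\<close> of degree less than \<open>r\<close>, which cannot vanish
  at all \<open>r\<close> solutions of \<open>z\<^sup>r = \<Prod>\<^sub>l y\<^sub>l\<^sup>\<mu>\<^sup>l\<close>.\<close>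

lemma dense_open_cover_torus: "dense_open (Y' n a) cover_torus"
  unfolding dense_open_def zar_Y'
proof
  show "Yz closure_of cover_torus = topspace Yz"
  proof (intro subset_antisym closure_of_subset_topspace subsetI)
    fix q assume q: "q \<in> topspace Yz"
    show "q \<in> Yz closure_of cover_torus"
      unfolding in_closure_of
    proof (intro conjI q allI impI; elim conjE)
      fix N assume "q \<in> N" "openin Yz N"
      from this(2,1) obtain U s where U: "Op U" "s \<in> C U" "q \<in> nonzero_at U s" "nonzero_at U s \<subseteq> N"
        by (rule Yz_basis)
      have "s \<noteq> (\<lambda>_ _. 0)"
        using U(3) S_zero[of q U] unfolding nonzero_at_def by auto
      then obtain k y where sky: "s k y \<noteq> 0" by (metis ext)
      have k: "k < r" using sky U(2) unfolding carrier_iff by (metis not_le)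
      have y: "y \<in> torus_cone n U" using sky carrier_outside[OF U(2)] by blast
      define P where "P = (\<Sum>k<r. monom (s k y) k)"
      have coeff: "coeff P i = (if i < r then s i y else 0)" for i
        unfolding P_def by (simp add: coeff_sum)
      have P0: "P \<noteq> 0" using coeff[of k] k sky by auto
      have "degree P < r"
      proof (rule degree_lessI)
        show "\<forall>i\<ge>r. coeff P i = 0" by (simp add: coeff)
      qed (use P0 in simp)
      have P_ev: "poly P z = ev y z s" for z
        unfolding P_def ev_def by (simp add: poly_sum poly_monom)
      have b0: "branch y \<noteq> 0" using y unfolding branch_def torus_cone_def by auto
      have "\<exists>z. z ^ r = branch y \<and> poly P z \<noteq> 0"
      proof (rule ccontr)
        assume "\<nexists>z. z ^ r = branch y \<and> poly P z \<noteq> 0"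
        then have "{z. z ^ r = branch y} \<subseteq> {z. poly P z = 0}" by auto
        then have "card {z. z ^ r = branch y} \<le> card {z. poly P z = 0}"
          by (rule card_mono[OF poly_roots_finite[OF P0]])
        also have "\<dots> \<le> degree P" by (rule card_poly_roots_bound[OF P0])
        finally show False
          using card_nth_roots[OF b0, of r] \<open>degree P < r\<close> r_gt_1 by simp
      qed
      then obtain z where z: "z ^ r = branch y" "poly P z \<noteq> 0" by auto
      have oy: "orbit std y \<in> U" using Op_cone[OF U(1)] y unfolding torus_cone_def by auto
      then have "y \<in> \<Union>H" "orbit std y \<in> H" using Op_subset[OF U(1)] orbit_self[of y std] by auto
      then have "(\<Sum>i=1..n. y i) = 0" "y \<in> vecs n"
        using wproj_point(2)[OF _ orbit_self[of y std]] orbit_self[of y std] unfolding hyp_points_def by auto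
      then have yz: "on_cover y z" using y z(1) unfolding on_cover_def torus_cone_def by simp
      have "cover_point y z \<in> nonzero_at U s"
        unfolding nonzero_at_iff using cover_point_in_S[OF yz] oy U(1,2) z(2) by (simp add: cover_point_def P_ev)
      then show "\<exists>q. q \<in> cover_torus \<and> q \<in> N"
        using cover_point_in_torus[OF yz] U(4) by blast
    qed
  qed
qed (rule openin_cover_torus)

end


section \<open>Morphisms to the cyclic cover\<close>

text \<open>The analogue of \<open>coordinate_map\<close> with the additional coordinate \<open>z\<close>.\<close>

locale cover_map = cyclic_cover n a + coordinate_map X U \<Phi> n "\<lambda>_. 1" "hyp_points n"
  for n :: nat and a :: "nat \<Rightarrow> nat" and X :: "'x fspace" and U :: "'x set" and \<Phi> :: "'x \<Rightarrow> vec" +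
  fixes z :: "'x \<Rightarrow> complex"
  assumes regular_z: "z \<in> funs X U"
    and point_on_cover: "\<And>p. p \<in> U \<Longrightarrow> on_cover (\<Phi> p) (z p)"
begin

abbreviation \<psi> :: "'x \<Rightarrow> (point, cover_section) spec_point" where
  "\<psi> p \<equiv> cover_point (\<Phi> p) (z p)"

text \<open>The sections are regular off the hyperplanes \<open>L\<^sub>j\<close>, which the image avoids: there \<open>s\<^sub>k\<close> is a
  section of \<open>\<O>\<close> divided by a product of coordinates.\<close>

lemma funs_ev:
  assumes V: "Op V" and s: "s \<in> C V"
  shows "(\<lambda>p. ev (\<Phi> p) (z p) s) \<in> funs X {p \<in> U. orbit std (\<Phi> p) \<in> V}"
proof -
  define N where "N = {p \<in> U. orbit std (\<Phi> p) \<in> V}"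
  have N: "openin (zar X) N" "N \<subseteq> U" unfolding N_def using openin_preimage[OF V] by auto
  have cone: "\<Phi> p \<in> torus_cone n V" if "p \<in> N" for p
    using on_cover_cone[OF point_on_cover] that unfolding N_def by simp
  have "(\<lambda>p. s k (\<Phi> p)) \<in> funs X N" if "k < r" for k
  proof -
    have "s k \<in> L_inv n a k V" using s that unfolding carrier_iff by simp
    then obtain g where g: "\<forall>y. y \<notin> torus_cone n V \<longrightarrow> s k y = 0"
      "g \<in> twist n std H (deg k) V"
      "\<forall>y\<in>torus_cone n V. s k y * poles k y = g y" by (rule L_invE)
    have nz: "poles k (\<Phi> p) \<noteq> 0" if "p \<in> N" for p
      using cone[OF that] unfolding torus_cone_def by simp
    have "(\<lambda>p. g (\<Phi> p) * inverse (poles k (\<Phi> p))) \<in> funs X N"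
    proof (intro funs_mult[OF N(1)] funs_inverse[OF N(1)] funs_prod[OF N(1)] funs_power[OF N(1)] nz)
      show "(\<lambda>p. g (\<Phi> p)) \<in> funs X N" unfolding N_def by (rule funs_pullback_twist[OF V g(2)])
      show "(\<lambda>p. \<Phi> p j) \<in> funs X N" if "j \<in> {1..n}" for j
        by (rule funs_restrict[OF open_U regular[OF that] N])
    qed
    then show ?thesis
    proof (rule funs_cong[OF N(1)])
      fix p assume p: "p \<in> N"
      have "s k (\<Phi> p) * poles k (\<Phi> p) = g (\<Phi> p)" using g(3) cone[OF p] by blast
      then show "s k (\<Phi> p) = g (\<Phi> p) * inverse (poles k (\<Phi> p))"
        using nz[OF p] by (simp add: field_simps)
    qed
  qed
  then show ?thesis
    unfolding ev_def N_def[symmetric]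
    by (intro funs_sum[OF N(1)] funs_mult[OF N(1)] funs_power[OF N(1)] funs_restrict[OF open_U regular_z N]) simp
qed

lemma cover_point_value:
  assumes "p \<in> U" "Op V" "orbit std (\<Phi> p) \<in> V" "s \<in> C V"
  shows "snd (\<psi> p) V s = ev (\<Phi> p) (z p) s"
  using assms unfolding cover_point_def by simp

lemma openin_cover_preimage:
  assumes N: "openin Yz N"
  shows "openin (zar X) {p \<in> U. \<psi> p \<in> N}"
proof (subst openin_subopen, intro ballI)
  fix p assume p: "p \<in> {p \<in> U. \<psi> p \<in> N}"
  then have "\<psi> p \<in> N" by simp
  with N obtain V s where V: "Op V" "s \<in> C V" "\<psi> p \<in> nonzero_at V s" "nonzero_at V s \<subseteq> N"
    by (rule Yz_basis)
  define M where "M = {p \<in> U. orbit std (\<Phi> p) \<in> V}"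
  have iff: "\<psi> p \<in> nonzero_at V s \<longleftrightarrow> p \<in> M \<and> ev (\<Phi> p) (z p) s \<noteq> 0" if "p \<in> U" for p
    using cover_point_in_S[OF point_on_cover[OF that]] that V(1,2)
    unfolding nonzero_at_iff M_def by (auto simp: cover_point_def)
  have "openin (zar X) {p \<in> M. ev (\<Phi> p) (z p) s \<noteq> 0}"
    unfolding M_def by (rule openin_funs_nonzero[OF openin_preimage[OF V(1)] funs_ev[OF V(1,2)]])
  moreover have "{p \<in> M. ev (\<Phi> p) (z p) s \<noteq> 0} \<subseteq> {p \<in> U. \<psi> p \<in> N}"
    using iff V(4) unfolding M_def by auto
  moreover have "p \<in> {p \<in> M. ev (\<Phi> p) (z p) s \<noteq> 0}" using iff V(3) p by simp
  ultimately show "\<exists>T. openin (zar X) T \<and> p \<in> T \<and> T \<subseteq> {p \<in> U. \<psi> p \<in> N}"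
    by (intro exI[of _ "{p \<in> M. ev (\<Phi> p) (z p) s \<noteq> 0}"]) simp
qed

lemma funs_cover_pullback:
  assumes N: "openin Yz N" and h: "h \<in> funs (Y' n a) N"
  shows "h \<circ> \<psi> \<in> funs X {p \<in> U. \<psi> p \<in> N}"
proof (rule funs_local[OF openin_cover_preimage[OF N]])
  fix p assume p: "p \<in> {p \<in> U. \<psi> p \<in> N}"
  then have "\<psi> p \<in> N" by simp
  with h obtain M where M: "openin Yz M" "\<psi> p \<in> M" "M \<subseteq> N" "fraction_on M h"
    by (rule funs_Y'E)
  obtain V s s' where V: "Op V" "s \<in> C V" "s' \<in> C V"
    "\<forall>q\<in>M. fst q \<in> V \<and> snd q V s' \<noteq> 0 \<and> h q = snd q V s / snd q V s'"
    using M(4) by (rule fraction_onE)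
  define A where "A = {p \<in> U. \<psi> p \<in> M}"
  have A: "openin (zar X) A" unfolding A_def by (rule openin_cover_preimage[OF M(1)])
  have AV: "A \<subseteq> {p \<in> U. orbit std (\<Phi> p) \<in> V}"
    using V(4) unfolding A_def by (auto simp: cover_point_def)
  have val: "ev (\<Phi> p) (z p) s' \<noteq> 0 \<and> h (\<psi> p) = ev (\<Phi> p) (z p) s * inverse (ev (\<Phi> p) (z p) s')"
    if "p \<in> A" for p
  proof -
    have "p \<in> U" "orbit std (\<Phi> p) \<in> V" "\<psi> p \<in> M" using that AV unfolding A_def by auto
    then show ?thesis
      using bspec[OF V(4), of "\<psi> p"] cover_point_value[OF _ V(1) _ V(2)] cover_point_value[OF _ V(1) _ V(3)]
      by (simp add: divide_inverse)
  qed
  note restr = funs_restrict[OF openin_preimage[OF V(1)] funs_ev[OF V(1)] A AV]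
  have "(\<lambda>p. ev (\<Phi> p) (z p) s * inverse (ev (\<Phi> p) (z p) s')) \<in> funs X A"
    by (intro funs_mult[OF A] funs_inverse[OF A] restr V(2,3)) (use val in auto)
  then show "\<exists>A g. openin (zar X) A \<and> p \<in> A \<and> A \<subseteq> {p \<in> U. \<psi> p \<in> N} \<and> g \<in> funs X A \<and>
      (\<forall>q\<in>A. (h \<circ> \<psi>) q = g q)"
    using A p M(2,3) val
    by (intro exI[of _ A] exI[of _ "\<lambda>p. ev (\<Phi> p) (z p) s * inverse (ev (\<Phi> p) (z p) s')"]) (auto simp: A_def)
qed

lemma morphism_cover_map:
  "morphism (open_subspace X U) (open_subspace (Y' n a) cover_torus) \<psi>"
  by (rule morphism_open_subspaceI[OF open_U])
    (use openin_cover_torus cover_point_in_torus[OF point_on_cover] openin_cover_preimage funs_cover_pullback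
      in simp_all)

end


section \<open>Cyclic indices\<close>

lemma cyc_in: "n \<ge> 1 \<Longrightarrow> cyc n i \<in> {1..n}"
  unfolding cyc_def by (simp add: Suc_leI)

lemma cyc_id: "i \<in> {1..n} \<Longrightarrow> cyc n i = i"
  unfolding cyc_def by auto

lemma cyc_cyc_add:
  assumes "i \<ge> 1"
  shows "cyc n (cyc n i + j) = cyc n (i + j)"
proof -
  have "i + j - 1 = (i - 1) + j" using assms by simp
  then show ?thesis unfolding cyc_def by (simp add: mod_simps)
qed

lemma cyc_add_n: "i \<ge> 1 \<Longrightarrow> cyc n (i + n * k) = cyc n i"
proof -
  assume "i \<ge> 1"
  then have "i + n * k - 1 = (i - 1) + n * k" by simp
  then show ?thesis unfolding cyc_def by simp
qed

lemma cyc_Suc_neq: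
  assumes "i \<ge> 1" "n \<ge> 2"
  shows "cyc n (i + 1) \<noteq> cyc n i"
proof -
  obtain m where "i = Suc m" using assms(1) by (cases i) auto
  then show ?thesis using assms(2) unfolding cyc_def by (simp add: mod_Suc)
qed

lemma cyc_succ_inj:
  assumes "i \<in> {1..n}" "j \<in> {1..n}" "cyc n (i + 1) = cyc n (j + 1)"
  shows "i = j"
proof -
  have "i mod n = j mod n" using assms(3) unfolding cyc_def by simp
  moreover have "k mod n = (if k = n then 0 else k)" if "k \<in> {1..n}" for k using that by auto
  ultimately show ?thesis using assms(1,2) by (auto split: if_splits)
qed

lemma cyc_last: "cyc n (n + 1) = 1"
  unfolding cyc_def by simp


section \<open>Density of the tori\<close>

definition line :: "nat \<Rightarrow> vec \<Rightarrow> vec \<Rightarrow> complex \<Rightarrow> vec" where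
  "line n x u \<epsilon> = (\<lambda>i. if i \<in> {1..n} then x i + \<epsilon> * (u i - x i) else 0)"

lemma line_0: "x \<in> vecs n \<Longrightarrow> line n x u 0 = x"
  unfolding line_def vecs_def by auto

lemma line_vecs: "line n x u \<epsilon> \<in> vecs n"
  unfolding line_def vecs_def by auto

lemma line_tendsto: "((\<lambda>\<epsilon>. line n x u \<epsilon> i) \<longlongrightarrow> line n x u 0 i) (at 0)"
  unfolding line_def by (cases "i \<in> {1..n}") (auto intro!: tendsto_eq_intros)

text \<open>Restricted to the line from \<open>x\<close> to \<open>u\<close> a form is a polynomial in one variable.  If it does not
  vanish at \<open>u\<close>, it has only finitely many zeros on the line.\<close>

lemma line_generic:
  assumes G: "whom n w d G" and u: "u \<in> vecs n" "G u \<noteq> 0"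
  shows "eventually (\<lambda>\<epsilon>. G (line n x u \<epsilon>) \<noteq> 0) (at 0)"
proof -
  obtain M b where M: "G = (\<lambda>x. \<Sum>m\<in>M. b m * (\<Prod>i=1..n. x i ^ m i))"
    using G unfolding whom_def by (elim exE conjE) (rule that)
  define p where "p = (\<Sum>m\<in>M. smult (b m) (\<Prod>i=1..n. [:x i, u i - x i:] ^ m i))"
  have p: "poly p \<epsilon> = G (line n x u \<epsilon>)" for \<epsilon>
    unfolding p_def M line_def by (simp add: poly_sum poly_prod)
  have "line n x u 1 = u" using u(1) unfolding line_def vecs_def by auto
  then have "poly p 1 \<noteq> 0" using p u(2) by simp
  then have "p \<noteq> 0" by auto
  then have "\<not> 0 islimpt {\<epsilon>. poly p \<epsilon> = 0}" by (intro islimpt_finite poly_roots_finite)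
  then show ?thesis unfolding islimpt_iff_eventually by (simp add: p)
qed

lemma whom_coords_prod: "\<exists>d. whom n w d (\<lambda>x. \<Prod>i=1..n. x i)"
  using whom_monomial[of n w "\<lambda>_. 1" 1] by auto

text \<open>Forms are continuous for the classical topology.  So a family of points of the torus with
  classical limit \<open>x\<close> meets every Zariski neighbourhood of \<open>[x]\<close>.\<close>

lemma dense_openI_torus:
  assumes Z: "Z \<subseteq> wproj n w"
    and perturb: "\<And>x. x \<in> vecs n \<Longrightarrow> orbit w x \<in> Z \<Longrightarrow>
      \<exists>X. (\<forall>i\<in>{1..n}. ((\<lambda>\<epsilon>. X \<epsilon> i) \<longlongrightarrow> x i) (at (0::complex))) \<and>
        eventually (\<lambda>\<epsilon>. orbit w (X \<epsilon>) \<in> torus n w Z) (at 0)"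
  shows "dense_open (wproj_subvariety n w Z) (torus n w Z)"
  unfolding dense_open_def zar_wproj_subvariety
proof
  show "openin (subzar n w Z) (torus n w Z)" by (rule openin_torus[OF Z])
  have top: "topspace (subzar n w Z) = Z" using Z by auto
  show "subzar n w Z closure_of torus n w Z = topspace (subzar n w Z)"
  proof (intro subset_antisym closure_of_subset_topspace subsetI)
    fix p assume p: "p \<in> topspace (subzar n w Z)"
    show "p \<in> subzar n w Z closure_of torus n w Z"
      unfolding in_closure_of
    proof (intro conjI p allI impI; elim conjE)
      fix N assume "p \<in> N" "openin (subzar n w Z) N"
      then obtain T where T: "openin (wproj_zariski n w) T" "p \<in> T" "N = T \<inter> Z"
        unfolding openin_subtopology by auto
      from T(1,2) obtain d F where F: "whom n w d F" "p \<in> nonvan n w F" "nonvan n w F \<subseteq> T"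
        by (rule wproj_zariski_basis)
      have pZ: "p \<in> Z" "p \<in> wproj n w" using p Z unfolding top by auto
      then obtain x where x: "x \<in> p" using wproj_nonempty by blast
      have ox: "p = orbit w x" "x \<in> vecs n" using wproj_point[OF pZ(2) x] by auto
      have "F x \<noteq> 0" using F(2) x unfolding nonvan_def by auto
      from perturb[OF ox(2)] pZ(1) ox(1)
      have "\<exists>X. (\<forall>i\<in>{1..n}. ((\<lambda>\<epsilon>. X \<epsilon> i) \<longlongrightarrow> x i) (at (0::complex))) \<and>
        eventually (\<lambda>\<epsilon>. orbit w (X \<epsilon>) \<in> torus n w Z) (at 0)" by simp
      then obtain X where X: "\<forall>i\<in>{1..n}. ((\<lambda>\<epsilon>. X \<epsilon> i) \<longlongrightarrow> x i) (at (0::complex))"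
        "eventually (\<lambda>\<epsilon>. orbit w (X \<epsilon>) \<in> torus n w Z) (at 0)" by (elim exE conjE) (rule that)
      have "((\<lambda>\<epsilon>. F (X \<epsilon>)) \<longlongrightarrow> F x) (at 0)"
        by (rule whom_tendsto[OF F(1)]) (use X(1) in blast)
      then have "eventually (\<lambda>\<epsilon>. F (X \<epsilon>) \<noteq> 0) (at 0)"
        using \<open>F x \<noteq> 0\<close> by (rule tendsto_imp_eventually_ne)
      with X(2) have "eventually (\<lambda>\<epsilon>. orbit w (X \<epsilon>) \<in> torus n w Z \<and> F (X \<epsilon>) \<noteq> 0) (at 0)"
        by (rule eventually_conj)
      from eventually_happens'[OF at_neq_bot this] obtain \<epsilon> where \<epsilon>: "orbit w (X \<epsilon>) \<in> torus n w Z" "F (X \<epsilon>) \<noteq> 0"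
        by (elim exE conjE) (rule that)
      then have "orbit w (X \<epsilon>) \<in> Z" unfolding torus_def by simp
      moreover from this have "orbit w (X \<epsilon>) \<in> nonvan n w F"
        using nonvan_iff[OF F(1) _ orbit_self] Z \<epsilon>(2) by blast
      ultimately show "\<exists>q. q \<in> torus n w Z \<and> q \<in> N"
        using \<epsilon>(1) F(3) T(3) by blast
    qed
  qed
qed

lemma dense_open_hyp_torus:
  assumes n: "n \<ge> 2"
  shows "dense_open (hyp n) (hyp_torus n)"
  unfolding hyp_def
proof (rule dense_openI_torus[OF hyp_points_subset])
  fix x assume x: "x \<in> vecs n" "orbit std x \<in> hyp_points n"
  have sx: "(\<Sum>i=1..n. x i) = 0" using x(2) orbit_self[of x std] unfolding hyp_points_def by auto
  define u :: vec where "u i = (if i \<in> {1..n} then if i = n then - of_nat (n - 1) else 1 else 0)" for i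
  have u: "u \<in> vecs n" unfolding u_def vecs_def by auto
  have "(\<Sum>i=1..n. u i) = (\<Sum>i\<in>{1..n}-{n}. u i) + u n" using n by (subst sum.remove[of _ n]) auto
  also have "(\<Sum>i\<in>{1..n}-{n}. u i) = (\<Sum>i\<in>{1..n}-{n}. 1)" by (intro sum.cong) (auto simp: u_def)
  finally have su: "(\<Sum>i=1..n. u i) = 0" using n by (simp add: u_def)
  have sl: "(\<Sum>i=1..n. line n x u \<epsilon> i) = 0" for \<epsilon>
  proof -
    have "(\<Sum>i=1..n. line n x u \<epsilon> i) = (\<Sum>i=1..n. x i) + \<epsilon> * ((\<Sum>i=1..n. u i) - (\<Sum>i=1..n. x i))"
      unfolding line_def by (simp add: sum.distrib flip: sum_subtractf sum_distrib_left)
    then show ?thesis using sx su by simp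
  qed
  have tor: "orbit std (line n x u \<epsilon>) \<in> hyp_torus n" if "(\<Prod>i=1..n. line n x u \<epsilon> i) \<noteq> 0" for \<epsilon>
    using that n sl[of \<epsilon>] by (intro orbit_in_hyp_torus line_vecs) auto
  obtain d where d: "whom n std d (\<lambda>x. \<Prod>i=1..n. x i)" using whom_coords_prod by blast
  have "(\<Prod>i=1..n. u i) \<noteq> 0" using n by (auto simp: u_def)
  from line_generic[OF d u this, of x]
  have "eventually (\<lambda>\<epsilon>. orbit std (line n x u \<epsilon>) \<in> hyp_torus n) (at 0)"
    by (rule eventually_mono) (rule tor)
  moreover have "\<forall>i\<in>{1..n}. ((\<lambda>\<epsilon>. line n x u \<epsilon> i) \<longlongrightarrow> x i) (at 0)"
    using line_tendsto[of n x u] line_0[OF x(1)] by simp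
  ultimately show "\<exists>X. (\<forall>i\<in>{1..n}. ((\<lambda>\<epsilon>. X \<epsilon> i) \<longlongrightarrow> x i) (at (0::complex))) \<and>
        eventually (\<lambda>\<epsilon>. orbit std (X \<epsilon>) \<in> hyp_torus n) (at 0)"
    by (intro exI[of _ "line n x u"] conjI)
qed

text \<open>A polynomial with a small value has a root nearby, since its value is the leading coefficient
  times the product of the distances to the roots.\<close>

lemma exists_close_root:
  fixes q :: "complex poly"
  assumes "degree q \<ge> 1"
  obtains z where "poly q z = 0" "norm (lead_coeff q) * norm (c - z) ^ degree q \<le> norm (poly q c)"
proof -
  obtain root where q: "smult (lead_coeff q) (\<Prod>i<degree q. [:-root i, 1:]) = q"
    by (rule complex_poly_decompose')
  have ev: "poly q x = lead_coeff q * (\<Prod>i<degree q. x - root i)" for x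
    by (subst q[symmetric]) (simp add: poly_prod)
  define D where "D = (\<lambda>i. norm (c - root i)) ` {..<degree q}"
  have D: "finite D" "D \<noteq> {}" unfolding D_def using assms by (auto simp: lessThan_empty_iff)
  obtain i where i: "i < degree q" "Min D = norm (c - root i)"
    using Min_in[OF D] unfolding D_def by auto
  have "norm (c - root i) ^ degree q = (\<Prod>j<degree q. norm (c - root i))" by simp
  also have "\<dots> \<le> (\<Prod>j<degree q. norm (c - root j))"
  proof (rule prod_mono)
    fix j assume "j \<in> {..<degree q}"
    then have "Min D \<le> norm (c - root j)" by (intro Min_le D) (simp add: D_def)
    then show "0 \<le> norm (c - root i) \<and> norm (c - root i) \<le> norm (c - root j)" using i(2) by simp
  qed
  finally have "norm (lead_coeff q) * norm (c - root i) ^ degree q \<le> norm (poly q c)"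
    unfolding ev norm_mult prod_norm by (simp add: mult_left_mono)
  moreover have "poly q (root i) = 0" unfolding ev using i(1) by auto
  ultimately show thesis using that by blast
qed

definition kollar_form :: "nat \<Rightarrow> (nat \<Rightarrow> nat) \<Rightarrow> vec \<Rightarrow> complex" where
  "kollar_form n a x = (\<Sum>i=1..n. x i ^ a i * x (cyc n (i + 1)))"

text \<open>The index \<open>k\<close> is such that \<open>x\<^sub>k\<close> can be solved for near the given point: as a polynomial in
  \<open>x\<^sub>k\<close> the equation has degree \<open>a\<^sub>k\<close> and leading coefficient \<open>x\<^sub>k\<^sub>+\<^sub>1\<close> if \<open>a\<^sub>k \<ge> 2\<close>, and
  \<open>x\<^sub>k\<^sub>+\<^sub>1 + x\<^sub>k\<^sub>-\<^sub>1\<^sup>a\<close> if \<open>a\<^sub>k = 1\<close>.  If there were no such index, \<open>x\<^sub>j\<^sub>+\<^sub>2 \<noteq> 0\<close> would give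
  \<open>a\<^sub>j\<^sub>+\<^sub>1 = 1\<close> and \<open>x\<^sub>j \<noteq> 0\<close>, and this would go around the cycle.  For odd \<open>n\<close> all \<open>x\<^sub>j\<close> are then
  nonzero, for even \<open>n\<close> the type is one of the excluded ones.\<close>

lemma solvable_index:
  fixes x :: vec
  assumes n: "n \<ge> 3" and a: "kollar_type n a" and nz: "i0 \<in> {1..n}" "x i0 \<noteq> 0"
  shows "(\<forall>i\<in>{1..n}. x i \<noteq> 0) \<or>
    (\<exists>j\<ge>1. x (cyc n (j + 2)) \<noteq> 0 \<and>
      (a (cyc n (j + 1)) \<noteq> 1 \<or> x (cyc n (j + 2)) + x (cyc n j) ^ a (cyc n j) \<noteq> 0))"
proof (rule disjCI)
  assume "\<not> (\<exists>j\<ge>1. x (cyc n (j + 2)) \<noteq> 0 \<and>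
      (a (cyc n (j + 1)) \<noteq> 1 \<or> x (cyc n (j + 2)) + x (cyc n j) ^ a (cyc n j) \<noteq> 0))"
  then have none: "a (cyc n (j + 1)) = 1" "x (cyc n (j + 2)) + x (cyc n j) ^ a (cyc n j) = 0"
    if "j \<ge> 1" "x (cyc n (j + 2)) \<noteq> 0" for j
    using that by blast+
  have n1: "n \<ge> 1" using n by simp
  have down: "x (cyc n j) \<noteq> 0" if "j \<ge> 1" "x (cyc n (j + 2)) \<noteq> 0" for j
  proof
    assume "x (cyc n j) = 0"
    moreover have "a (cyc n j) > 0" using a cyc_in[OF n1, of j] unfolding kollar_type_def by blast
    ultimately show False using none(2)[OF that] that(2) by (simp add: zero_power)
  qed
  have downs: "x (cyc n j) \<noteq> 0" if "j \<ge> 1" "x (cyc n (j + 2 * m)) \<noteq> 0" for j m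
    using that(2)
  proof (induction m)
    case (Suc m)
    then have "x (cyc n (j + 2 * m + 2)) \<noteq> 0" by simp
    from down[OF _ this] that(1) show ?case using Suc.IH by simp
  qed simp
  have up: "x (cyc n (j + 2)) \<noteq> 0" if "j \<ge> 1" "x (cyc n j) \<noteq> 0" for j
  proof (rule downs[of _ "n - 1"])
    have "j + 2 + 2 * (n - 1) = j + n * 2" using n by simp
    then have "cyc n (j + 2 + 2 * (n - 1)) = cyc n (j + n * 2)" by (rule arg_cong)
    then show "x (cyc n (j + 2 + 2 * (n - 1))) \<noteq> 0" using that cyc_add_n[of j n 2] by metis
  qed simp
  have i0: "i0 \<ge> 1" "x (cyc n i0) \<noteq> 0" using nz cyc_id[OF nz(1)] by auto
  have ups: "x (cyc n (i0 + 2 * m)) \<noteq> 0" for m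
  proof (induction m)
    case (Suc m)
    then show ?case using up[of "i0 + 2 * m"] i0(1) by simp
  qed (use i0 in simp)
  show "\<forall>i\<in>{1..n}. x i \<noteq> 0"
  proof (cases "even n")
    case True
    have one: "a (cyc n (i0 + 1 + 2 * k)) = 1" for k
      using none(1)[of "i0 + 2 * k"] ups[of "Suc k"] i0(1) by (simp add: algebra_simps)
    have "cyc n (i0 + 1) \<in> {1..n}" by (rule cyc_in[OF n1])
    then obtain k where "a (cyc n (cyc n (i0 + 1) + 2 * k)) \<noteq> 1"
      using a True unfolding kollar_type_def by blast
    then show ?thesis using one cyc_cyc_add[of "i0 + 1" n "2 * k"] by simp
  next
    case False
    show ?thesis
    proof
      fix i assume i: "i \<in> {1..n}"
      \<comment> \<open>One of \<open>i + n - i0\<close> and \<open>i + 2 n - i0\<close> is even, and \<open>i\<close> can be reached in steps of two.\<close>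
      define N where "N = (if even (i + n - i0) then n else 2 * n)"
      have "even (i + N - i0)" "i + N \<ge> i0"
        using False nz(1) i unfolding N_def by auto
      then obtain m where "i + N = i0 + 2 * m" by (metis evenE le_add_diff_inverse)
      moreover have "cyc n (i + N) = cyc n i"
        using cyc_add_n[of i n 1] cyc_add_n[of i n 2] i unfolding N_def by (auto simp: mult.commute)
      ultimately show "x i \<noteq> 0" using ups[of m] cyc_id[OF i] by simp
    qed
  qed
qed

definition kollar_points :: "nat \<Rightarrow> (nat \<Rightarrow> nat) \<Rightarrow> (nat \<Rightarrow> nat) \<Rightarrow> point set" where
  "kollar_points n a w = {p \<in> wproj n w. \<forall>x\<in>p. kollar_form n a x = 0}"

lemma kollar_points_subset: "kollar_points n a w \<subseteq> wproj n w"
  unfolding kollar_points_def by auto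

lemma whom_kollar_monomial:
  assumes "n \<ge> 1" "i \<in> {1..n}"
  shows "whom n w (a i * w i + w (cyc n (i + 1))) (\<lambda>x. x i ^ a i * x (cyc n (i + 1)))"
  using whom_mult[OF whom_power[OF whom_coord[OF assms(2)], of w "a i"] whom_coord[OF cyc_in[OF assms(1)], of w]]
  by (simp add: mult.commute)

lemma whom_kollar_form:
  assumes "n \<ge> 1" "\<And>i. i \<in> {1..n} \<Longrightarrow> a i * w i + w (cyc n (i + 1)) = D"
  shows "whom n w D (kollar_form n a)"
  unfolding kollar_form_def[abs_def]
  by (rule whom_sum) (use whom_kollar_monomial[OF assms(1), of _ w a] assms(2) in auto)

lemma orbit_in_kollar_points:
  assumes F: "whom n w D (kollar_form n a)"
    and x: "x \<in> vecs n" "i \<in> {1..n}" "x i \<noteq> 0" "kollar_form n a x = 0"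
  shows "orbit w x \<in> kollar_points n a w"
  unfolding kollar_points_def
  using orbit_in_wproj[OF x(1-3)] x(4) by (auto elim!: mem_orbitE simp: whom_scale[OF F])

text \<open>With \<open>k\<close> as in \<open>solvable_index\<close>, all coordinates other than \<open>x\<^sub>k\<close> are moved along a line towards
  \<open>1\<close>, and \<open>x\<^sub>k\<close> is recomputed as a root of the equation near its old value.  The root is
  nonzero as long as the terms without \<open>x\<^sub>k\<close> have a nonzero sum \<open>R\<close>, and this holds generically on the
  line because \<open>R = n - 2\<close> at the point \<open>(1, \<dots>, 1)\<close>.\<close>

lemma dense_open_kollar_torus:
  assumes n: "n \<ge> 3" and type: "kollar_type n a"
    and deg: "\<And>i. i \<in> {1..n} \<Longrightarrow> a i * w i + w (cyc n (i + 1)) = D"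
  shows "dense_open (wproj_subvariety n w (kollar_points n a w)) (torus n w (kollar_points n a w))"
proof (rule dense_openI_torus[OF kollar_points_subset])
  fix x assume x: "x \<in> vecs n" "orbit w x \<in> kollar_points n a w"
  have n1: "n \<ge> 1" "1 \<in> {1..n}" using n by auto
  have F: "whom n w D (kollar_form n a)" by (rule whom_kollar_form[OF n1(1)]) (rule deg)
  have Fx: "kollar_form n a x = 0" using x(2) orbit_self[of x w] unfolding kollar_points_def by auto
  have tor: "orbit w y \<in> torus n w (kollar_points n a w)"
    if "y \<in> vecs n" "\<forall>i\<in>{1..n}. y i \<noteq> 0" "kollar_form n a y = 0" for y
  proof -
    have "orbit w y \<in> kollar_points n a w"
      by (rule orbit_in_kollar_points[OF F that(1) n1(2) _ that(3)]) (use that(2) n1(2) in blast)+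
    then show ?thesis using torus_iff[OF kollar_points_subset _ orbit_self] that(2) by blast
  qed
  have "orbit w x \<in> wproj n w" using x(2) kollar_points_subset by blast
  then obtain i0 where i0: "i0 \<in> {1..n}" "x i0 \<noteq> 0" using wproj_point(3)[OF _ orbit_self] by blast
  consider "\<forall>i\<in>{1..n}. x i \<noteq> 0" | j where "j \<ge> 1" "x (cyc n (j + 2)) \<noteq> 0"
    "a (cyc n (j + 1)) \<noteq> 1 \<or> x (cyc n (j + 2)) + x (cyc n j) ^ a (cyc n j) \<noteq> 0"
    using solvable_index[where x = x, OF n type i0] by blast
  then show "\<exists>X. (\<forall>i\<in>{1..n}. ((\<lambda>\<epsilon>. X \<epsilon> i) \<longlongrightarrow> x i) (at (0::complex))) \<and>
        eventually (\<lambda>\<epsilon>. orbit w (X \<epsilon>) \<in> torus n w (kollar_points n a w)) (at 0)"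
  proof cases
    case 1
    then show ?thesis using tor[OF x(1) _ Fx] by (intro exI[of _ "\<lambda>_. x"]) simp
  next
    case (2 j)
    define k where "k = cyc n (j + 1)"
    define l where "l = cyc n (j + 2)"
    define p where "p = cyc n j"
    have klp: "k \<in> {1..n}" "l \<in> {1..n}" "p \<in> {1..n}"
      unfolding k_def l_def p_def using cyc_in[OF n1(1)] by auto
    have next_k: "cyc n (k + 1) = l" and next_p: "cyc n (p + 1) = k"
      unfolding k_def l_def p_def using cyc_cyc_add[of "j + 1" n 1] cyc_cyc_add[of j n 1] 2(1)
      by (simp_all add: numeral_2_eq_2)
    have neq: "k \<noteq> p" "l \<noteq> k"
      using cyc_Suc_neq[of j n] cyc_Suc_neq[of "j + 1" n] 2(1) n
      unfolding k_def l_def p_def by (simp_all add: numeral_2_eq_2)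
    have ak: "a k > 0" using type klp(1) unfolding kollar_type_def by blast
    define I where "I = {1..n} - {k, p}"
    define R where "R = (\<lambda>y :: vec. \<Sum>i\<in>I. y i ^ a i * y (cyc n (i + 1)))"
    have R: "whom n w D R"
      unfolding R_def
    proof (rule whom_sum)
      fix i assume "i \<in> I"
      then have "i \<in> {1..n}" unfolding I_def by simp
      with whom_kollar_monomial[OF n1(1) this, of w a] deg
      show "whom n w D (\<lambda>y. y i ^ a i * y (cyc n (i + 1)))" by simp
    qed
    have R_upd: "R (y(k := c)) = R y" for y c
      unfolding R_def
    proof (rule sum.cong[OF refl])
      fix i assume i: "i \<in> I"
      then have "cyc n (i + 1) \<noteq> k" using cyc_succ_inj[of i n p] next_p klp(3) unfolding I_def by auto
      then show "(y(k := c)) i ^ a i * (y(k := c)) (cyc n (i + 1)) = y i ^ a i * y (cyc n (i + 1))"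
        using i unfolding I_def by simp
    qed
    have split: "kollar_form n a y = y k ^ a k * y l + (y p ^ a p * y k + R y)" for y
    proof -
      have "kollar_form n a y = y k ^ a k * y l + (\<Sum>i\<in>{1..n}-{k}. y i ^ a i * y (cyc n (i + 1)))"
        unfolding kollar_form_def using klp(1) next_k by (subst sum.remove[of _ k]) auto
      also have "(\<Sum>i\<in>{1..n}-{k}. y i ^ a i * y (cyc n (i + 1))) = y p ^ a p * y k + (\<Sum>i\<in>{1..n}-{k}-{p}. y i ^ a i * y (cyc n (i + 1)))"
        using klp(3) neq(1) next_p by (subst sum.remove[of _ p]) auto
      also have "{1..n}-{k}-{p} = I" unfolding I_def by auto
      finally show ?thesis unfolding R_def .
    qed
    define u :: vec where "u = (\<lambda>i. if i \<in> {1..n} then 1 else 0)"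
    have u: "u \<in> vecs n" unfolding u_def vecs_def by auto
    have "R u = (\<Sum>i\<in>I. 1)"
      unfolding R_def u_def using cyc_in[OF n1(1)] by (intro sum.cong) (auto simp: I_def)
    also have "card I = n - 2" unfolding I_def using klp neq by simp
    then have "card I \<noteq> 0" using n by simp
    then have "(\<Sum>i\<in>I. 1) \<noteq> (0::complex)" by simp
    finally have Ru: "R u \<noteq> 0" .
    obtain d where d: "whom n w d (\<lambda>x. \<Prod>i=1..n. x i)" using whom_coords_prod by blast
    define G where "G = (\<lambda>y. R y * (\<Prod>i=1..n. y i))"
    have G: "whom n w (D + d) G" unfolding G_def by (rule whom_mult[OF R d])
    have Gu: "G u \<noteq> 0" unfolding G_def using Ru by (simp add: u_def)
    define y where "y = line n x u"
    have y_lim: "((\<lambda>\<epsilon>. y \<epsilon> i) \<longlongrightarrow> x i) (at 0)" for i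
      using line_tendsto[of n x u i] line_0[OF x(1), of u] unfolding y_def by simp
    \<comment> \<open>The leading coefficient of the equation as a polynomial in \<open>x\<^sub>k\<close>.\<close>
    define L where "L = (\<lambda>\<epsilon>. if a k = 1 then y \<epsilon> l + y \<epsilon> p ^ a p else y \<epsilon> l)"
    define L0 where "L0 = (if a k = 1 then x l + x p ^ a p else x l)"
    have L0: "L0 \<noteq> 0" using 2(2,3) unfolding L0_def k_def l_def p_def by simp
    have L_lim: "(L \<longlongrightarrow> L0) (at 0)"
      unfolding L_def L0_def by (auto intro!: tendsto_intros y_lim)
    have good: "eventually (\<lambda>\<epsilon>. G (y \<epsilon>) \<noteq> 0 \<and> L \<epsilon> \<noteq> 0) (at 0)"
      using line_generic[OF G u Gu, of x] tendsto_imp_eventually_ne[OF L_lim L0]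
      unfolding y_def by (rule eventually_conj)
    define Q where "Q = (\<lambda>\<epsilon>. monom (y \<epsilon> l) (a k) + (monom (y \<epsilon> p ^ a p) 1 + [:R (y \<epsilon>):]))"
    have Q: "poly (Q \<epsilon>) c = kollar_form n a ((y \<epsilon>)(k := c))" for \<epsilon> c
      unfolding split R_upd Q_def using neq by (simp add: poly_monom mult.commute)
    have coeff_ak: "coeff (Q \<epsilon>) (a k) = L \<epsilon>" for \<epsilon>
      unfolding Q_def L_def using ak by (cases "a k") (auto simp: coeff_pCons)
    have degQ: "degree (Q \<epsilon>) = a k" if "L \<epsilon> \<noteq> 0" for \<epsilon>
    proof (rule antisym)
      show "degree (Q \<epsilon>) \<le> a k"
        unfolding Q_def using ak
        by (intro degree_add_le order_trans[OF degree_monom_le]) auto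
      show "a k \<le> degree (Q \<epsilon>)" using that coeff_ak[of \<epsilon>] by (intro le_degree) simp
    qed
    have ex: "\<exists>z. poly (Q \<epsilon>) z = 0 \<and> norm (L \<epsilon>) * norm (x k - z) ^ a k \<le> norm (poly (Q \<epsilon>) (x k))"
      if "L \<epsilon> \<noteq> 0" for \<epsilon>
    proof -
      have "1 \<le> degree (Q \<epsilon>)" using ak degQ[OF that] by simp
      then obtain z where "poly (Q \<epsilon>) z = 0"
        "norm (lead_coeff (Q \<epsilon>)) * norm (x k - z) ^ degree (Q \<epsilon>) \<le> norm (poly (Q \<epsilon>) (x k))"
        by (rule exists_close_root)
      then show ?thesis using degQ[OF that] coeff_ak[of \<epsilon>] by (intro exI[of _ z]) simp
    qed
    define z where "z = (\<lambda>\<epsilon>. SOME z. poly (Q \<epsilon>) z = 0 \<and>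
      norm (L \<epsilon>) * norm (x k - z) ^ a k \<le> norm (poly (Q \<epsilon>) (x k)))"
    have z: "poly (Q \<epsilon>) (z \<epsilon>) = 0"
      "norm (L \<epsilon>) * norm (x k - z \<epsilon>) ^ a k \<le> norm (poly (Q \<epsilon>) (x k))" if "L \<epsilon> \<noteq> 0" for \<epsilon>
      using someI_ex[OF ex[OF that]] unfolding z_def by simp_all
    define X where "X = (\<lambda>\<epsilon>. (y \<epsilon>)(k := z \<epsilon>))"
    have "eventually (\<lambda>\<epsilon>. orbit w (X \<epsilon>) \<in> torus n w (kollar_points n a w)) (at 0)"
      using good
    proof (rule eventually_mono)
      fix \<epsilon> assume *: "G (y \<epsilon>) \<noteq> 0 \<and> L \<epsilon> \<noteq> 0"
      have RX: "R (X \<epsilon>) \<noteq> 0" using * unfolding X_def R_upd G_def by simp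
      have FX: "kollar_form n a (X \<epsilon>) = 0" using z(1) * unfolding Q X_def by simp
      \<comment> \<open>The new coordinate is nonzero because the equation has constant term \<open>R \<noteq> 0\<close> in it.\<close>
      have "X \<epsilon> k \<noteq> 0"
        using FX RX ak unfolding split by (auto simp: zero_power)
      moreover have "\<forall>i\<in>{1..n}. y \<epsilon> i \<noteq> 0" using * unfolding G_def by simp
      ultimately have "\<forall>i\<in>{1..n}. X \<epsilon> i \<noteq> 0" unfolding X_def by auto
      moreover have "X \<epsilon> \<in> vecs n" using line_vecs[of n x u \<epsilon>] klp(1) unfolding X_def y_def vecs_def by auto
      ultimately show "orbit w (X \<epsilon>) \<in> torus n w (kollar_points n a w)" using tor FX by blast
    qed
    moreover have "((\<lambda>\<epsilon>. X \<epsilon> i) \<longlongrightarrow> x i) (at 0)" if "i \<in> {1..n}" for i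
    proof (cases "i = k")
      case False
      then show ?thesis using y_lim[of i] unfolding X_def by simp
    next
      case True
      have "((\<lambda>\<epsilon>. kollar_form n a ((y \<epsilon>)(k := x k))) \<longlongrightarrow> kollar_form n a x) (at 0)"
      proof (rule whom_tendsto[OF F])
        show "((\<lambda>\<epsilon>. ((y \<epsilon>)(k := x k)) i) \<longlongrightarrow> x i) (at 0)" for i
          using y_lim[of i] by (cases "i = k") simp_all
      qed
      then have "((\<lambda>\<epsilon>. norm (poly (Q \<epsilon>) (x k)) / norm (L \<epsilon>)) \<longlongrightarrow> norm (kollar_form n a x) / norm L0) (at 0)"
        unfolding Q using L_lim L0 by (intro tendsto_divide tendsto_norm) auto
      then have "((\<lambda>\<epsilon>. root (a k) (norm (poly (Q \<epsilon>) (x k)) / norm (L \<epsilon>))) \<longlongrightarrow> 0) (at 0)"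
        using tendsto_real_root[of _ _ _ "a k"] Fx by fastforce
      moreover have "eventually (\<lambda>\<epsilon>. norm (z \<epsilon> - x k) \<le> root (a k) (norm (poly (Q \<epsilon>) (x k)) / norm (L \<epsilon>))) (at 0)"
        using good
      proof (rule eventually_mono)
        fix \<epsilon> assume *: "G (y \<epsilon>) \<noteq> 0 \<and> L \<epsilon> \<noteq> 0"
        then have "norm (x k - z \<epsilon>) ^ a k \<le> norm (poly (Q \<epsilon>) (x k)) / norm (L \<epsilon>)"
          using z(2)[of \<epsilon>] by (simp add: field_simps)
        then have "root (a k) (norm (x k - z \<epsilon>) ^ a k) \<le> root (a k) (norm (poly (Q \<epsilon>) (x k)) / norm (L \<epsilon>))"
          using ak by simp
        then show "norm (z \<epsilon> - x k) \<le> root (a k) (norm (poly (Q \<epsilon>) (x k)) / norm (L \<epsilon>))"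
          using ak by (simp add: real_root_power_cancel norm_minus_commute)
      qed
      ultimately have "((\<lambda>\<epsilon>. z \<epsilon> - x k) \<longlongrightarrow> 0) (at 0)"
        by (rule Lim_null_comparison[rotated])
      then have "(z \<longlongrightarrow> x k) (at 0)" by (simp add: LIM_zero_iff)
      then show ?thesis using True unfolding X_def by simp
    qed
    ultimately show ?thesis by (intro exI[of _ X] conjI ballI)
  qed
qed


section \<open>The weights\<close>

lemma prod_cyc:
  fixes n :: nat and a :: "nat \<Rightarrow> nat"
  shows "(\<Prod>l=i+1..i+n. int (a (cyc n l))) = (\<Prod>l=1..n. int (a l))"
proof (induction i)
  case 0
  show ?case by (intro prod.cong) (auto simp: cyc_id)
next
  case (Suc i)
  have "cyc n (i + 1 + n * 1) = cyc n (i + 1)" by (rule cyc_add_n) simp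
  then have "(\<Prod>l=Suc i+1..Suc i+n. int (a (cyc n l))) = (\<Prod>l=i+1..i+n. int (a (cyc n l)))"
    by (cases "n = 0") (simp_all add: prod.atLeast_Suc_atMost[of "Suc i" "i + n"] mult.commute)
  then show ?case using Suc by simp
qed

lemma W_shift: "i \<ge> 1 \<Longrightarrow> W n a (i + n) = W n a i"
proof -
  assume i: "i \<ge> 1"
  have "(\<Prod>l=i+n+j..i+n+n-1. int (a (cyc n l))) = (\<Prod>l=i+j..i+n-1. int (a (cyc n l)))" for j
  proof -
    have "(\<Prod>l=i+j+n..i+n-1+n. int (a (cyc n l))) = (\<Prod>l=i+j..i+n-1. int (a (cyc n (l + n))))"
      by (rule prod.shift_bounds_cl_nat_ivl)
    also have "\<dots> = (\<Prod>l=i+j..i+n-1. int (a (cyc n l)))"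
      using i cyc_add_n[of _ n 1] by (intro prod.cong) auto
    finally show ?thesis using i by (simp add: algebra_simps)
  qed
  then show ?thesis unfolding W_def by simp
qed

text \<open>The sums telescope, because \<open>a\<^sub>i W\<^sub>i\<close> and \<open>W\<^sub>i\<^sub>+\<^sub>1\<close> consist of the same products with opposite signs.\<close>

lemma W_recurrence:
  assumes n: "n \<ge> 1" and i: "i \<in> {1..n}"
  shows "int (a i) * W n a i + W n a (cyc n (i + 1)) = (\<Prod>l=1..n. int (a l)) - (-1) ^ n"
proof -
  define S where "S j = (\<Prod>l=i+j..i+n. int (a (cyc n l)))" for j
  have cyc_next: "W n a (cyc n (i + 1)) = W n a (i + 1)"
    using i W_shift[of 1 n a] cyc_id[of "i + 1" n] cyc_last[of n] by (cases "i = n") (auto simp: add.commute)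
  have ai: "a i = a (cyc n (i + n))" using cyc_add_n[of i n 1] cyc_id[OF i] i by simp
  have "int (a i) * (\<Prod>l=i+j..i+n-1. int (a (cyc n l))) = S j" if "j \<in> {1..n}" for j
  proof -
    have "{i+j..i+n} = insert (i+n) {i+j..i+n-1}" "i + n \<notin> {i+j..i+n-1}" using that n by auto
    then show ?thesis unfolding S_def ai by simp
  qed
  then have "int (a i) * W n a i = (\<Sum>j=1..n. (-1) ^ (j - 1) * S j)"
    unfolding W_def sum_distrib_left by (intro sum.cong) (auto simp: mult.left_commute)
  moreover have "W n a (i + 1) = (\<Sum>j=1..n. (-1) ^ (j - 1) * S (j + 1))"
    unfolding W_def S_def by (simp add: algebra_simps)
  ultimately have "int (a i) * W n a i + W n a (i + 1) = (\<Sum>j=1..n. (-1) ^ (j - 1) * (S j + S (j + 1)))"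
    by (simp add: sum.distrib distrib_left)
  also have "\<dots> = S 1 - (-1) ^ n * S (n + 1)"
  proof -
    have "(\<Sum>j=1..m. (-1) ^ (j - 1) * (S j + S (j + 1))) = S 1 - (-1) ^ m * S (m + 1)" for m
      by (induction m) (simp_all add: algebra_simps)
    then show ?thesis .
  qed
  also have "S 1 = (\<Prod>l=1..n. int (a l))" unfolding S_def by (rule prod_cyc)
  also have "S (n + 1) = 1" unfolding S_def by simp
  finally show ?thesis using cyc_next by simp
qed

text \<open>Every tail of the alternating sum lies between \<open>0\<close> and its first term.  If the whole sum is \<open>0\<close>,
  then every second factor is \<open>1\<close>; this is the case that the definition of a type excludes.\<close>

lemma W_pos:
  assumes n: "n \<ge> 3" and type: "kollar_type n a" and i: "i \<in> {1..n}"
  shows "W n a i > 0"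
proof -
  define b where "b l = int (a (cyc n l))" for l
  define T where "T j = (\<Prod>l=i+j..i+n-1. b l)" for j
  define E where "E k = (\<Sum>j=k..n. (-1) ^ (j - k) * T j)" for k
  have b: "b l \<ge> 1" for l
    using type cyc_in[of n l] n unfolding kollar_type_def b_def by (auto simp: Suc_le_eq)
  have T_pos: "T j \<ge> 1" for j
    unfolding T_def using b by (intro prod_ge_1) auto
  have T_rec: "T k = b (i + k) * T (k + 1)" if "k < n" for k
    unfolding T_def using that by (subst prod.atLeast_Suc_atMost) auto
  have E_n: "E n = 1" unfolding E_def T_def using n by simp
  have E_rec: "E k = T k - E (k + 1)" if "k < n" for k
  proof -
    have "(\<Sum>j=k+1..n. (-1) ^ (j - k) * T j) = (\<Sum>j=k+1..n. - ((-1) ^ (j - (k + 1)) * T j))"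
    proof (intro sum.cong refl)
      fix j assume "j \<in> {k+1..n}"
      then have "j - k = Suc (j - (k + 1))" by auto
      then show "(-1) ^ (j - k) * T j = - ((-1) ^ (j - (k + 1)) * T j)" by simp
    qed
    then show ?thesis unfolding E_def using that by (subst sum.atLeast_Suc_atMost) (auto simp: sum_negf)
  qed
  have E_bound: "0 \<le> E k \<and> E k \<le> T k" if "k \<le> n" for k
    using that
  proof (induction rule: inc_induct)
    case base
    show ?case using E_n T_pos[of n] by simp
  next
    case (step k)
    have "T (k + 1) \<le> T k"
      unfolding T_rec[OF \<open>k < n\<close>] using b[of "i + k"] T_pos[of "k + 1"] by (simp add: mult_le_cancel_right1)
    then show ?case using step E_rec[OF \<open>k < n\<close>] by auto
  qed
  have WE: "W n a i = E 1" unfolding W_def E_def T_def b_def by simp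
  have "E 1 \<noteq> 0"
  proof
    assume E1: "E 1 = 0"
    have step: "k < n \<and> b (i + k) = 1 \<and> (k + 2 \<le> n \<longrightarrow> E (k + 2) = 0)" if "k \<le> n" "E k = 0" for k
    proof -
      have k: "k < n" using that E_n by (cases "k = n") auto
      have "b (i + k) * T (k + 1) \<le> T (k + 1)"
        using E_rec[OF k] that(2) E_bound[of "k + 1"] k T_rec[OF k] by simp
      then have "b (i + k) \<le> 1" using T_pos[of "k + 1"] by (simp add: mult_le_cancel_right1)
      then have bk: "b (i + k) = 1" using b[of "i + k"] by simp
      moreover have "E (k + 2) = 0" if "k + 2 \<le> n"
        using E_rec[OF k] E_rec[of "k + 1"] that \<open>E k = 0\<close> T_rec[OF k] bk by simp
      ultimately show ?thesis using k by blast
    qed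
    have zero: "E (1 + 2 * m) = 0" if "1 + 2 * m \<le> n" for m
      using that
    proof (induction m)
      case (Suc m)
      then show ?case using step[of "1 + 2 * m"] by simp
    qed (use E1 in simp)
    show False
    proof (cases "even n")
      case True
      have "b (i + 1 + 2 * k) = 1" if "k < n div 2" for k
      proof -
        have "1 + 2 * k \<le> n" using that True by auto
        then show ?thesis using step[OF _ zero] by simp
      qed
      moreover have "cyc n (i + 1) \<in> {1..n}" using cyc_in n by simp
      then obtain k where "k < n div 2" "a (cyc n (cyc n (i + 1) + 2 * k)) \<noteq> 1"
        using type True unfolding kollar_type_def by blast
      moreover have "cyc n (cyc n (i + 1) + 2 * k) = cyc n (i + 1 + 2 * k)"
        by (rule cyc_cyc_add) simp
      ultimately show False unfolding b_def by simp
    next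
      case False
      then obtain m where "n = 1 + 2 * m" by (metis oddE add.commute)
      then show False using zero[of m] E_n by simp
    qed
  qed
  then show ?thesis using WE E_bound[of 1] n by simp
qed

locale kollar =
  fixes n :: nat and a :: "nat \<Rightarrow> nat"
  assumes n3: "n \<ge> 3" and type: "kollar_type n a"
begin

abbreviation w :: "nat \<Rightarrow> nat" where "w \<equiv> weight n a"
abbreviation ws :: nat where "ws \<equiv> wstar n a"

definition D :: nat where "D = a 1 * w 1 + w (cyc n 2)"

text \<open>The exponents with \<open>\<Prod>\<^sub>i y\<^sub>i\<^sup>\<nu> = x\<^sub>1\<^sup>r\<^sup>D\<close>, of which the \<open>\<mu>\<^sub>i\<close> are the residues.  The value at \<open>i = 0\<close>
  closes the recurrence below.\<close>

definition \<nu> :: "nat \<Rightarrow> int" where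
  "\<nu> i = (-1) ^ (i + 1) * (\<Prod>l=i+1..n. int (a l))"

lemma n_ge_1: "n \<ge> 1" "1 \<in> {1..n}"
  using n3 by auto

lemma int_r: "int ws = Gcd (W n a ` {1..n})" and r_pos: "ws > 0"
proof -
  have "W n a 1 \<in> W n a ` {1..n}" "W n a 1 > 0" using n_ge_1 W_pos[OF n3 type] by auto
  then have "Gcd (W n a ` {1..n}) \<noteq> 0" by (metis Gcd_0_iff less_irrefl singletonD subsetD)
  then have "Gcd (W n a ` {1..n}) > 0" using Gcd_int_greater_eq_0 by (metis less_le)
  then show "int ws = Gcd (W n a ` {1..n})" "ws > 0" unfolding wstar_def by auto
qed

lemma W_eq:
  assumes "i \<in> {1..n}"
  shows "W n a i = int ws * int (w i)"
proof -
  have "int ws dvd W n a i" unfolding int_r using assms by (intro Gcd_dvd) simp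
  then have "W n a i div int ws * int ws = W n a i" by (rule dvd_div_mult_self)
  moreover have "W n a i div int ws \<ge> 0" using W_pos[OF n3 type assms] r_pos by (simp add: pos_imp_zdiv_nonneg_iff)
  ultimately show ?thesis unfolding weight_def by (simp add: mult.commute)
qed

lemma degree_D_int:
  assumes "i \<in> {1..n}"
  shows "int ws * int (a i * w i + w (cyc n (i + 1))) = (\<Prod>l=1..n. int (a l)) - (-1) ^ n"
  using W_recurrence[OF n_ge_1(1) assms, of a] W_eq[OF assms] W_eq[OF cyc_in[OF n_ge_1(1), of "i + 1"]]
  by (simp add: algebra_simps)

lemma degree_D:
  assumes "i \<in> {1..n}"
  shows "a i * w i + w (cyc n (i + 1)) = D"
proof -
  have "int ws * int (a i * w i + w (cyc n (i + 1))) = int ws * int D"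
    using degree_D_int[OF assms] degree_D_int[OF n_ge_1(2)] unfolding D_def by (simp add: numeral_2_eq_2)
  then have "int (a i * w i + w (cyc n (i + 1))) = int D" using r_pos by (simp only: mult_cancel_left) simp
  then show ?thesis by (simp only: of_nat_eq_iff)
qed

text \<open>A common divisor of \<open>w\<^sub>1\<close> and \<open>D\<close> divides all \<open>w\<^sub>i\<close>, because \<open>w\<^sub>i\<^sub>+\<^sub>1 = D - a\<^sub>i w\<^sub>i\<close>.\<close>

lemma coprime_w1_D: "gcd (w 1) D = 1"
proof -
  define g where "g = gcd (w 1) D"
  have "g dvd w (Suc i)" if "Suc i \<le> n" for i
    using that
  proof (induction i)
    case 0
    then show ?case unfolding g_def by simp
  next
    case (Suc i)
    have i: "Suc i \<in> {1..n}" "cyc n (Suc i + 1) = Suc (Suc i)" using Suc.prems cyc_id[of "Suc (Suc i)" n] by auto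
    have "g dvd a (Suc i) * w (Suc i) + w (Suc (Suc i))"
      using degree_D[OF i(1)] unfolding i(2) g_def by simp
    moreover have "g dvd a (Suc i) * w (Suc i)" using Suc by simp
    ultimately show ?case by (simp only: dvd_add_right_iff)
  qed
  then have g: "g dvd w i" if "i \<in> {1..n}" for i using that by (cases i) auto
  have "int (ws * g) dvd int ws"
    unfolding int_r
  proof (rule Gcd_greatest)
    fix v assume "v \<in> W n a ` {1..n}"
    then obtain i where i: "i \<in> {1..n}" "v = W n a i" by auto
    have "int (ws * g) dvd int (ws * w i)" using g[OF i(1)] by (intro of_nat_dvd_iff[THEN iffD2] mult_dvd_mono) auto
    then show "int (ws * g) dvd v" unfolding i(2) W_eq[OF i(1)] by simp
  qed
  then have "ws * g dvd ws * 1" by simp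
  then show ?thesis using r_pos unfolding g_def by (simp only: nat_mult_dvd_cancel1 nat_dvd_1_iff_1)
qed

lemma bezout: "\<exists>u v. u * int (w 1) + v * int D = 1"
  using bezout_int[of "int (w 1)" "int D"] coprime_w1_D by (metis gcd_int_int_eq of_nat_1)

lemma nu_rec:
  assumes "i \<in> {1..n}"
  shows "int (a i) * \<nu> i = - \<nu> (i - 1)"
proof -
  have "(\<Prod>l=i..n. int (a l)) = int (a i) * (\<Prod>l=i+1..n. int (a l))"
    using assms by (subst prod.atLeast_Suc_atMost) auto
  then show ?thesis using assms unfolding \<nu>_def by (cases i) auto
qed

lemma nu_n: "\<nu> n = 1 \<or> \<nu> n = - 1"
  unfolding \<nu>_def by (cases "even n") auto

lemma nu_D: "\<nu> n - \<nu> 0 = int ws * int D"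
  using degree_D_int[OF n_ge_1(2)] unfolding degree_D[OF n_ge_1(2)] \<nu>_def by simp

text \<open>The terms of \<open>W\<^sub>1\<close> are the \<open>\<nu>\<^sub>i\<close>.\<close>

lemma nu_sum: "(\<Sum>i=1..n. \<nu> i) = int ws * int (w 1)"
proof -
  have "W n a 1 = (\<Sum>i=1..n. \<nu> i)"
    unfolding W_def
  proof (intro sum.cong refl)
    fix j assume j: "j \<in> {1..n}"
    have "(\<Prod>l=1+j..1+n-1. int (a (cyc n l))) = (\<Prod>l=j+1..n. int (a l))"
      by (intro prod.cong) (auto simp: cyc_id)
    moreover have "(-1::int) ^ (j - 1) = (-1) ^ (j + 1)" using j by (cases j) auto
    ultimately show "(-1) ^ (j - 1) * (\<Prod>l=1+j..1+n-1. int (a (cyc n l))) = \<nu> j"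
      unfolding \<nu>_def by simp
  qed
  then show ?thesis using W_eq[OF n_ge_1(2)] by simp
qed

lemma nu_mu: "\<nu> i = int ws * (\<nu> i div int ws) + int (mu n a i)"
proof -
  have "int (mu n a i) = \<nu> i mod int ws" unfolding mu_def \<nu>_def using r_pos by simp
  then show ?thesis by simp
qed

lemma tt_eq: "tt n a * ws = (\<Sum>i=1..n. mu n a i)"
proof -
  have "int (\<Sum>i=1..n. mu n a i) = (\<Sum>i=1..n. \<nu> i - int ws * (\<nu> i div int ws))"
  proof -
    have "int (mu n a i) = \<nu> i - int ws * (\<nu> i div int ws)" for i using nu_mu[of i] by linarith
    then show ?thesis by (simp only: of_nat_sum)
  qed
  also have "\<dots> = int ws * (int (w 1) - (\<Sum>i=1..n. \<nu> i div int ws))"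
    using nu_sum by (simp add: sum_subtractf sum_distrib_left right_diff_distrib)
  finally have "int ws dvd int (\<Sum>i=1..n. mu n a i)" by (rule dvdI)
  then have "ws dvd (\<Sum>i=1..n. mu n a i)" by (simp only: of_nat_dvd_iff)
  then show ?thesis unfolding tt_def by (rule dvd_div_mult_self)
qed

end


section \<open>Inverting the monomial map\<close>

context kollar
begin

definition summand :: "nat \<Rightarrow> vec \<Rightarrow> complex" where
  "summand i x = x i ^ a i * x (cyc n (i + 1))"

text \<open>The recurrence \<open>a\<^sub>i \<nu>\<^sub>i = - \<nu>\<^sub>i\<^sub>-\<^sub>1\<close> makes the product telescope.\<close>

lemma telescope:
  fixes X :: "nat \<Rightarrow> complex"
  assumes "m \<le> n" "\<And>i. i \<in> {1..m + 1} \<Longrightarrow> X i \<noteq> 0"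
  shows "(\<Prod>i=1..m. (X i ^ a i * X (i + 1)) powi \<nu> i) = X (m + 1) powi \<nu> m / X 1 powi \<nu> 0"
  using assms
proof (induction m)
  case (Suc m)
  have nz: "X (m + 1) \<noteq> 0" using Suc.prems(2)[of "m + 1"] by simp
  have "(X (m + 1) ^ a (m + 1)) powi \<nu> (m + 1) = X (m + 1) powi (int (a (m + 1)) * \<nu> (m + 1))"
    by (simp add: power_int_mult)
  also have "\<dots> = inverse (X (m + 1) powi \<nu> m)"
    using nu_rec[of "m + 1"] Suc.prems(1) by (simp add: power_int_minus)
  finally have "(X (m + 1) ^ a (m + 1) * X (m + 2)) powi \<nu> (m + 1) =
      X (m + 2) powi \<nu> (m + 1) / X (m + 1) powi \<nu> m"
    by (simp add: power_int_mult_distrib divide_inverse mult.commute)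
  moreover have "(\<Prod>i=1..m. (X i ^ a i * X (i + 1)) powi \<nu> i) = X (m + 1) powi \<nu> m / X 1 powi \<nu> 0"
    using Suc by simp
  ultimately show ?case using nz by simp
qed simp

lemma prod_summand_powi_nu:
  assumes "\<forall>i\<in>{1..n}. x i \<noteq> 0"
  shows "(\<Prod>i=1..n. summand i x powi \<nu> i) = (x 1 ^ D) ^ ws"
proof -
  define X where "X = (\<lambda>i. x (cyc n i))"
  have X: "X i \<noteq> 0" for i unfolding X_def using assms cyc_in[OF n_ge_1(1)] by blast
  have "X 1 = x 1" "X (n + 1) = x 1" unfolding X_def using cyc_id[OF n_ge_1(2)] cyc_last[of n] by simp_all
  moreover have "(\<Prod>i=1..n. summand i x powi \<nu> i) = (\<Prod>i=1..n. (X i ^ a i * X (i + 1)) powi \<nu> i)"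
    by (intro prod.cong refl) (simp add: summand_def X_def cyc_id)
  moreover have "(\<Prod>i=1..n. (X i ^ a i * X (i + 1)) powi \<nu> i) = X (n + 1) powi \<nu> n / X 1 powi \<nu> 0"
    by (rule telescope) (use X in auto)
  moreover have "x 1 powi \<nu> n / x 1 powi \<nu> 0 = x 1 powi (int (ws * D))"
    using bspec[OF assms n_ge_1(2)] nu_D by (simp flip: power_int_diff)
  ultimately show ?thesis by (simp only: power_int_of_nat power_mult mult.commute[of ws])
qed

text \<open>Some coefficients \<open>(u, v)\<close> of \<open>u w\<^sub>1 + v D = 1\<close>.\<close>

definition bez :: "int \<times> int" where
  "bez = (SOME (u, v). u * int (w 1) + v * int D = 1)"

abbreviation "bw \<equiv> fst bez"
abbreviation "bD \<equiv> snd bez"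

lemma bez: "bw * int (w 1) + bD * int D = 1"
proof -
  have "\<exists>p. case p of (u, v) \<Rightarrow> u * int (w 1) + v * int D = 1" using bezout by auto
  from someI_ex[OF this] show ?thesis unfolding bez_def by (simp add: case_prod_unfold)
qed

text \<open>Given the ratios \<open>Y\<^sub>i = y\<^sub>i / y\<^sub>1\<close> of the monomials and \<open>V = x\<^sub>1\<^sup>D / y\<^sub>1\<^sup>w\<close>, where \<open>w = w\<^sub>1\<close>,
  this is the representative \<open>x\<close> of the orbit for which \<open>x\<^sub>1\<^sup>u y\<^sub>1\<^sup>v = 1\<close>, where \<open>u w\<^sub>1 + v D = 1\<close>.  It has
  \<open>x\<^sub>1 = V\<^sup>v\<close> and \<open>y\<^sub>1 = V\<^sup>-\<^sup>u\<close>, and the other entries follow from \<open>x\<^sub>i\<^sub>+\<^sub>1 = y\<^sub>i / x\<^sub>i\<^sup>a\<close>.\<close>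

fun solve :: "vec \<Rightarrow> complex \<Rightarrow> nat \<Rightarrow> complex" where
  "solve Y V 0 = V powi bD"
| "solve Y V (Suc i) = V powi (- bw) * Y (Suc i) / solve Y V i ^ a (Suc i)"

definition solution :: "vec \<Rightarrow> complex \<Rightarrow> vec" where
  "solution Y V = (\<lambda>i. if i \<in> {1..n} then solve Y V (i - 1) else 0)"

text \<open>The conditions on \<open>(Y, V)\<close> satisfied by the images of the points of the hypersurface: \<open>Y\<close> is the
  representative with \<open>y\<^sub>1 = 1\<close> of a point of the torus in the hyperplane, and \<open>V\<close> has the \<open>r\<close>-th power that
  the telescoping product requires.\<close>

definition model :: "vec \<Rightarrow> complex \<Rightarrow> bool" where
  "model Y V \<longleftrightarrow> Y \<in> vecs n \<and> (\<forall>i\<in>{1..n}. Y i \<noteq> 0) \<and> (\<Sum>i=1..n. Y i) = 0 \<and> Y 1 = 1 \<and>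
     V ^ ws = (\<Prod>i=1..n. Y i powi \<nu> i)"

lemma model_V:
  assumes "model Y V"
  shows "V \<noteq> 0"
proof -
  have "(\<Prod>i=1..n. Y i powi \<nu> i) \<noteq> 0" using assms unfolding model_def by auto
  moreover have "V ^ ws = (\<Prod>i=1..n. Y i powi \<nu> i)" using assms unfolding model_def by blast
  ultimately show ?thesis using r_pos by (auto simp: zero_power)
qed

lemma solve_nonzero:
  assumes "model Y V" "i \<le> n"
  shows "solve Y V i \<noteq> 0"
  using assms(2)
proof (induction i)
  case 0
  then show ?case using model_V[OF assms(1)] by simp
next
  case (Suc i)
  then have "Y (Suc i) \<noteq> 0" using assms(1) unfolding model_def by simp
  then show ?case using Suc model_V[OF assms(1)] by simp
qed

text \<open>The equation \<open>x\<^sub>n\<^sup>a x\<^sub>1 = y\<^sub>n\<close> is the only one that is not built into the recursion.  It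
  follows from \<open>V\<^sup>r = \<Prod>\<^sub>i Y\<^sub>i\<^sup>\<nu>\<close>, where \<open>r = w\<^sup>*\<close>, and the telescoping product, as the last exponent is \<open>\<nu>\<^sub>n = \<plusminus>1\<close>.\<close>

lemma solve_closes:
  assumes m: "model Y V"
  shows "solve Y V n = solve Y V 0"
proof -
  define X where "X i = solve Y V (i - 1)" for i
  define lam where "lam = V powi (- bw)"
  have V: "V \<noteq> 0" by (rule model_V[OF m])
  have X: "X i \<noteq> 0" if "i \<in> {1..n + 1}" for i
    unfolding X_def using that by (intro solve_nonzero[OF m]) auto
  have step: "X i ^ a i * X (i + 1) = lam * Y i" if "i \<in> {1..n}" for i
  proof -
    have "X (i + 1) = lam * Y i / X i ^ a i" using that unfolding X_def lam_def by (cases i) auto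
    then show ?thesis using X[of i] that by simp
  qed
  have "X (n + 1) powi \<nu> n / X 1 powi \<nu> 0 = (\<Prod>i=1..n. (X i ^ a i * X (i + 1)) powi \<nu> i)"
    using telescope[of n X] X by simp
  also have "\<dots> = (\<Prod>i=1..n. lam powi \<nu> i) * (\<Prod>i=1..n. Y i powi \<nu> i)"
    unfolding prod.distrib[symmetric] by (intro prod.cong refl) (simp only: step power_int_mult_distrib)
  also have "(\<Prod>i=1..n. lam powi \<nu> i) = lam powi (int ws * int (w 1))"
  proof -
    have "lam \<noteq> 0" unfolding lam_def using V by simp
    then have "(\<Prod>i\<in>I. lam powi \<nu> i) = lam powi (\<Sum>i\<in>I. \<nu> i)" for I
      by (induction I rule: infinite_finite_induct) (simp_all add: power_int_add)
    from this[of "{1..n}"] show ?thesis unfolding nu_sum .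
  qed
  also have "(\<Prod>i=1..n. Y i powi \<nu> i) = V powi int ws" using m unfolding model_def by simp
  also have "lam powi (int ws * int (w 1)) * V powi int ws = V powi (- bw * (int ws * int (w 1)) + int ws)"
    unfolding lam_def power_int_mult[symmetric] by (rule power_int_add[symmetric]) (use V in simp)
  also have "- bw * (int ws * int (w 1)) + int ws = bD * (int ws * int D)"
  proof -
    have "int ws = int ws * (bw * int (w 1) + bD * int D)" by (simp only: bez mult_1_right)
    then show ?thesis by (simp add: algebra_simps)
  qed
  also have "V powi (bD * (int ws * int D)) = X 1 powi (int ws * int D)"
    unfolding X_def power_int_mult by simp
  also have "\<dots> = X 1 powi \<nu> n / X 1 powi \<nu> 0"
    using X[of 1] by (simp flip: nu_D add: power_int_diff)
  finally have "X (n + 1) powi \<nu> n = X 1 powi \<nu> n" using X[of 1] by simp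
  then have "X (n + 1) = X 1"
    using nu_n X[of 1] X[of "n + 1"] by (auto simp: power_int_minus)
  then show ?thesis unfolding X_def by simp
qed

lemma solution_nonzero:
  assumes "model Y V" "i \<in> {1..n}"
  shows "solution Y V i \<noteq> 0"
proof -
  have "i - 1 \<le> n" using assms(2) by auto
  then show ?thesis using solve_nonzero[OF assms(1)] assms(2) unfolding solution_def by simp
qed

lemma solution_vecs: "solution Y V \<in> vecs n"
  unfolding solution_def vecs_def by auto

lemma summand_solution:
  assumes m: "model Y V" and i: "i \<in> {1..n}"
  shows "summand i (solution Y V) = V powi (- bw) * Y i"
proof -
  have "solution Y V (cyc n (i + 1)) = solve Y V i"
    using i cyc_id[of "i + 1" n] cyc_last[of n] solve_closes[OF m] n_ge_1
    by (cases "i = n") (auto simp: solution_def)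
  moreover have "solution Y V i = solve Y V (i - 1)" using i unfolding solution_def by simp
  moreover have "solve Y V (i - 1) \<noteq> 0" using i by (intro solve_nonzero[OF m]) auto
  ultimately show ?thesis using i unfolding summand_def by (cases i) auto
qed

lemma kollar_form_summand: "kollar_form n a x = (\<Sum>i=1..n. summand i x)"
  unfolding kollar_form_def summand_def ..

abbreviation Z :: "point set" where "Z \<equiv> kollar_points n a w"

lemma whom_summand:
  assumes "i \<in> {1..n}"
  shows "whom n w D (summand i)"
  using whom_kollar_monomial[OF n_ge_1(1) assms, of w a] degree_D[OF assms]
  unfolding summand_def[abs_def] by simp

lemma whom_form: "whom n w D (kollar_form n a)"
  by (rule whom_kollar_form[OF n_ge_1(1)]) (rule degree_D)

lemma solution_in_torus:
  assumes m: "model Y V"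
  shows "orbit w (solution Y V) \<in> torus n w Z"
proof -
  have "kollar_form n a (solution Y V) = (\<Sum>i=1..n. V powi (- bw) * Y i)"
    unfolding kollar_form_summand by (intro sum.cong refl summand_solution[OF m])
  also have "\<dots> = 0" using m unfolding model_def by (simp flip: sum_distrib_left)
  finally have "orbit w (solution Y V) \<in> Z"
    by (rule orbit_in_kollar_points[OF whom_form solution_vecs n_ge_1(2) solution_nonzero[OF m n_ge_1(2)]])
  then show ?thesis
    using torus_iff[OF kollar_points_subset _ orbit_self] solution_nonzero[OF m] by blast
qed

lemma summand_nonzero:
  assumes "\<forall>i\<in>{1..n}. x i \<noteq> 0" "i \<in> {1..n}"
  shows "summand i x \<noteq> 0"
  unfolding summand_def using assms cyc_in[OF n_ge_1(1)] by simp

definition Yx :: "point \<Rightarrow> vec" where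
  "Yx p = (\<lambda>i. if i \<in> {1..n} then ratio (summand i) (summand 1) p else 0)"

definition Vx :: "point \<Rightarrow> complex" where
  "Vx = ratio (\<lambda>x. x 1 ^ D) (\<lambda>x. summand 1 x ^ w 1)"

lemma torus_point:
  assumes "p \<in> torus n w Z"
  obtains x where "x \<in> p" "p = orbit w x" "p \<in> wproj n w" "x \<in> vecs n"
    "\<forall>i\<in>{1..n}. x i \<noteq> 0" "kollar_form n a x = 0"
proof -
  have p: "p \<in> wproj n w" "p \<in> Z" using assms kollar_points_subset unfolding torus_def by auto
  obtain x where x: "x \<in> p" using wproj_nonempty[OF p(1)] by auto
  show thesis
    by (rule that[OF x wproj_point(1)[OF p(1) x] p(1) wproj_point(2)[OF p(1) x]])
      (use assms x p(2) in \<open>auto simp: torus_def kollar_points_def\<close>)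
qed

lemma whom_x1_D: "whom n w (D * w 1) (\<lambda>x. x 1 ^ D)"
  using whom_power[OF whom_coord[OF n_ge_1(2)], of w D] by (simp add: mult.commute)

lemma whom_summand1_w1: "whom n w (D * w 1) (\<lambda>x. summand 1 x ^ w 1)"
  by (rule whom_power[OF whom_summand[OF n_ge_1(2)]])

lemma Yx_eq:
  assumes "p \<in> wproj n w" "x \<in> p" "i \<in> {1..n}"
  shows "Yx p i = summand i x / summand 1 x"
  using ratio_eq[OF whom_summand[OF assms(3)] whom_summand[OF n_ge_1(2)] assms(1,2)] assms(3) unfolding Yx_def by simp

lemma Vx_eq:
  assumes "p \<in> wproj n w" "x \<in> p"
  shows "Vx p = x 1 ^ D / summand 1 x ^ w 1"
  unfolding Vx_def by (rule ratio_eq[OF whom_x1_D whom_summand1_w1 assms])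

lemma model_of_point:
  assumes p: "p \<in> torus n w Z"
  shows "model (Yx p) (Vx p)"
proof -
  obtain x where x: "x \<in> p" "p = orbit w x" "p \<in> wproj n w" "x \<in> vecs n"
    "\<forall>i\<in>{1..n}. x i \<noteq> 0" "kollar_form n a x = 0" using p by (rule torus_point)
  note Y = Yx_eq[OF x(3,1)] and V = Vx_eq[OF x(3,1)] and nz = summand_nonzero[OF x(5)]
  have nz1: "summand 1 x \<noteq> 0" by (rule nz[OF n_ge_1(2)])
  have "Yx p \<in> vecs n" unfolding Yx_def vecs_def by auto
  moreover have "\<forall>i\<in>{1..n}. Yx p i \<noteq> 0" using Y nz nz1 by simp
  moreover have "(\<Sum>i=1..n. Yx p i) = 0"
  proof -
    have "(\<Sum>i=1..n. Yx p i) = (\<Sum>i=1..n. summand i x) / summand 1 x" using Y by (simp add: sum_divide_distrib)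
    then show ?thesis using x(6) unfolding kollar_form_summand by simp
  qed
  moreover have "Yx p 1 = 1" using Y[OF n_ge_1(2)] nz1 by simp
  moreover have "Vx p ^ ws = (\<Prod>i=1..n. Yx p i powi \<nu> i)"
  proof -
    have "(\<Prod>i=1..n. Yx p i powi \<nu> i) = (\<Prod>i=1..n. summand i x powi \<nu> i / summand 1 x powi \<nu> i)"
      using Y by (intro prod.cong refl) (simp add: power_int_divide_distrib)
    also have "\<dots> = (x 1 ^ D) ^ ws / (\<Prod>i=1..n. summand 1 x powi \<nu> i)"
      by (simp only: prod_dividef prod_summand_powi_nu[OF x(5)])
    also have "(\<Prod>i=1..n. summand 1 x powi \<nu> i) = summand 1 x powi (int ws * int (w 1))"
    proof -
      have "(\<Prod>i\<in>I. summand 1 x powi \<nu> i) = summand 1 x powi (\<Sum>i\<in>I. \<nu> i)" for I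
        using nz1 by (induction I rule: infinite_finite_induct) (simp_all add: power_int_add)
      from this[of "{1..n}"] show ?thesis unfolding nu_sum .
    qed
    also have "summand 1 x powi (int ws * int (w 1)) = (summand 1 x ^ w 1) ^ ws"
      by (simp add: mult.commute[of ws] power_mult flip: of_nat_mult)
    finally show ?thesis unfolding V by (simp add: power_divide)
  qed
  ultimately show ?thesis unfolding model_def by blast
qed

lemma point_of_solution:
  assumes m: "model Y V"
  shows "Yx (orbit w (solution Y V)) = Y" "Vx (orbit w (solution Y V)) = V"
proof -
  let ?p = "orbit w (solution Y V)"
  have p: "?p \<in> wproj n w" using solution_in_torus[OF m] kollar_points_subset unfolding torus_def by auto
  have V: "V \<noteq> 0" by (rule model_V[OF m])
  have Y1: "Y 1 = 1" using m unfolding model_def by simp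
  show "Yx ?p = Y"
  proof
    fix i
    show "Yx ?p i = Y i"
    proof (cases "i \<in> {1..n}")
      case True
      then show ?thesis
        using Yx_eq[OF p orbit_self True] summand_solution[OF m True] summand_solution[OF m n_ge_1(2)] V Y1 by simp
    next
      case False
      then show ?thesis using m unfolding Yx_def model_def vecs_def by auto
    qed
  qed
  have "solution Y V 1 = V powi bD" using n_ge_1 unfolding solution_def by simp
  then have "Vx ?p = (V powi bD) ^ D / (V powi (- bw)) ^ w 1"
    using Vx_eq[OF p orbit_self] summand_solution[OF m n_ge_1(2)] Y1 by simp
  also have "\<dots> = V powi (bD * int D) / V powi (- bw * int (w 1))"
    by (simp only: power_int_mult power_int_of_nat)
  also have "\<dots> = V powi (bD * int D - (- bw * int (w 1)))"
    by (rule power_int_diff[symmetric]) (use V in simp)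
  also have "bD * int D - (- bw * int (w 1)) = 1" using bez by simp
  finally show "Vx ?p = V" by simp
qed

text \<open>The two vectors differ by the scalar \<open>c = 1 / (x\<^sub>1\<^sup>u y\<^sub>1\<^sup>v)\<close>, which normalizes the monomial of
  degree \<open>1\<close>.\<close>

lemma solution_of_point:
  assumes p: "p \<in> torus n w Z"
  shows "orbit w (solution (Yx p) (Vx p)) = p"
proof -
  obtain x where x: "x \<in> p" "p = orbit w x" "p \<in> wproj n w" "x \<in> vecs n"
    "\<forall>i\<in>{1..n}. x i \<noteq> 0" "kollar_form n a x = 0" using p by (rule torus_point)
  note Y = Yx_eq[OF x(3,1)] and V = Vx_eq[OF x(3,1)] and nz = summand_nonzero[OF x(5)]
  define y1 where "y1 = summand 1 x"
  have nz1: "y1 \<noteq> 0" "x 1 \<noteq> 0" unfolding y1_def using nz[OF n_ge_1(2)] x(5)[rule_format, OF n_ge_1(2)] by auto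
  define c where "c = inverse (x 1 powi bw * y1 powi bD)"
  have c: "c \<noteq> 0" unfolding c_def using nz1 by simp
  have V_powi: "Vx p powi e = x 1 powi (int D * e) * y1 powi (- (int (w 1) * e))" for e
    unfolding V y1_def[symmetric] power_int_divide_distrib
    by (simp add: power_int_mult power_int_minus divide_inverse)
  have c_powi: "c powi e = x 1 powi (- (bw * e)) * y1 powi (- (bD * e))" for e
    unfolding c_def
    by (simp add: power_int_mult power_int_minus power_int_inverse power_int_mult_distrib)
  have lam: "Vx p powi (- bw) / y1 = c ^ D"
  proof -
    have e: "- (int (w 1) * - bw) - 1 = - (bD * int D)" using bez by (simp add: algebra_simps)
    have "Vx p powi (- bw) / y1 = x 1 powi (int D * - bw) * (y1 powi (- (int (w 1) * - bw)) / y1 powi 1)"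
      unfolding V_powi by simp
    also have "y1 powi (- (int (w 1) * - bw)) / y1 powi 1 = y1 powi (- (bD * int D))"
      unfolding e[symmetric] by (rule power_int_diff[symmetric]) (use nz1 in simp)
    also have "x 1 powi (int D * - bw) * y1 powi (- (bD * int D)) = c powi int D"
      unfolding c_powi by (simp add: mult.commute)
    finally show ?thesis by simp
  qed
  have first: "Vx p powi bD = c ^ w 1 * x 1"
  proof -
    have e: "int D * bD = - (bw * int (w 1)) + 1" using bez by (simp add: algebra_simps)
    have "Vx p powi bD = x 1 powi (- (bw * int (w 1)) + 1) * y1 powi (- (int (w 1) * bD))"
      unfolding V_powi e ..
    also have "x 1 powi (- (bw * int (w 1)) + 1) = x 1 powi (- (bw * int (w 1))) * x 1"
      using power_int_add[of "x 1" "- (bw * int (w 1))" 1] nz1 by simp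
    also have "x 1 powi (- (bw * int (w 1))) * x 1 * y1 powi (- (int (w 1) * bD)) = c powi int (w 1) * x 1"
      unfolding c_powi by (simp add: mult_ac)
    finally show ?thesis by simp
  qed
  have sol: "solve (Yx p) (Vx p) i = c ^ w (i + 1) * x (i + 1)" if "i < n" for i
    using that
  proof (induction i)
    case 0
    then show ?case using first by simp
  next
    case (Suc i)
    define j where "j = Suc i"
    have j: "j \<in> {1..n}" "cyc n (j + 1) = j + 1" using Suc.prems cyc_id[of "j + 1" n] unfolding j_def by auto
    have IH: "solve (Yx p) (Vx p) i = c ^ w j * x j" using Suc unfolding j_def by simp
    have "solve (Yx p) (Vx p) j = (Vx p powi (- bw) / y1) * summand j x / (c ^ w j * x j) ^ a j"
      unfolding j_def solve.simps using IH Y[OF j(1)] unfolding j_def y1_def by simp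
    also have "\<dots> = c ^ D / c ^ (w j * a j) * x (j + 1)"
      unfolding lam summand_def j(2) using x(5)[rule_format, OF j(1)] by (simp add: power_mult_distrib power_mult)
    also have "D = w j * a j + w (j + 1)" using degree_D[OF j(1)] j(2) by (simp add: mult.commute)
    also have "c ^ (w j * a j + w (j + 1)) / c ^ (w j * a j) = c ^ w (j + 1)"
      using c by (simp add: power_add)
    finally show ?case unfolding j_def .
  qed
  have "solution (Yx p) (Vx p) = (\<lambda>i. c ^ w i * x i)"
  proof
    fix i
    show "solution (Yx p) (Vx p) i = c ^ w i * x i"
      using sol[of "i - 1"] x(4) unfolding solution_def vecs_def by auto
  qed
  then show ?thesis using orbit_scale[OF c, of w x] x(2) by simp
qed


section \<open>The birational maps\<close>

abbreviation X :: "point fspace" where "X \<equiv> wproj_subvariety n w Z"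

lemma kollar_hypersurface_eq: "kollar_hypersurface n a = X"
  unfolding kollar_hypersurface_def kollar_points_def kollar_form_def ..

lemma funs_Yx: "(\<lambda>p. Yx p i) \<in> funs X (torus n w Z)"
  and funs_Vx: "Vx \<in> funs X (torus n w Z)"
proof -
  interpret function_space X by (rule function_space_wproj_subvariety)
  have T: "openin (subzar n w Z) (torus n w Z)" by (rule openin_torus[OF kollar_points_subset])
  have nz: "summand 1 x \<noteq> 0" if "x \<in> \<Union>(torus n w Z)" for x
    using summand_nonzero[OF _ n_ge_1(2), of x] that unfolding torus_def by auto
  show "(\<lambda>p. Yx p i) \<in> funs X (torus n w Z)"
  proof (cases "i \<in> {1..n}")
    case True
    have "ratio (summand i) (summand 1) \<in> funs X (torus n w Z)"
      by (rule funs_ratio[OF T whom_summand[OF True] whom_summand[OF n_ge_1(2)]]) (rule nz)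
    then show ?thesis using True unfolding Yx_def by simp
  next
    case False
    have "(\<lambda>p. Yx p i) = (\<lambda>_. 0)" using False unfolding Yx_def by auto
    then show ?thesis using T by (simp add: funs_const)
  qed
  show "Vx \<in> funs X (torus n w Z)"
    unfolding Vx_def by (rule funs_ratio[OF T whom_x1_D whom_summand1_w1]) (use nz in simp)
qed

lemma (in function_space) funs_solution:
  assumes "kollar n a" and U: "openin (zar X) U" and Y: "\<And>i. i \<in> {1..n} \<Longrightarrow> (\<lambda>p. Y p i) \<in> funs X U" and V: "V \<in> funs X U"
    and m: "\<And>p. p \<in> U \<Longrightarrow> kollar.model n a (Y p) (V p)" and i: "i \<in> {1..n}"
  shows "(\<lambda>p. kollar.solution n a (Y p) (V p) i) \<in> funs X U"
proof -
  interpret kollar n a by (rule assms(1))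
  have V0: "V p \<noteq> 0" if "p \<in> U" for p using model_V[OF m[OF that]] .
  have "(\<lambda>p. solve (Y p) (V p) i) \<in> funs X U" if "i < n" for i
    using that
  proof (induction i)
    case 0
    show ?case using funs_powi[OF U V V0] by simp
  next
    case (Suc i)
    have "(\<lambda>p. V p powi (- bw) * Y p (Suc i) * inverse (solve (Y p) (V p) i ^ a (Suc i))) \<in> funs X U"
    proof (intro funs_mult[OF U] funs_inverse[OF U] funs_power[OF U] funs_powi[OF U V V0] Y)
      show "(\<lambda>p. solve (Y p) (V p) i) \<in> funs X U" using Suc by simp
      show "solve (Y p) (V p) i ^ a (Suc i) \<noteq> 0" if "p \<in> U" for p
        using solve_nonzero[OF m[OF that], of i] Suc.prems by simp
    qed (use Suc.prems in auto)
    then show ?case by (simp add: divide_inverse)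
  qed
  moreover have "i - 1 < n" using i by auto
  ultimately have "(\<lambda>p. solve (Y p) (V p) (i - 1)) \<in> funs X U" by blast
  then show ?thesis using i unfolding solution_def by simp
qed

lemma dense_kollar_torus: "dense_open X (torus n w Z)"
  by (rule dense_open_kollar_torus[OF n3 type]) (rule degree_D)

text \<open>For \<open>w\<^sup>* = 1\<close> the condition on \<open>V\<close> says that it is a monomial in the \<open>Y\<^sub>i\<close>.\<close>

lemma birational_hyp:
  assumes ws_eq: "ws = 1"
  shows "birational (kollar_hypersurface n a) (hyp n)"
proof -
  let ?T = "torus n w Z"
  define V where "V p = (\<Prod>i=1..n. normal_rep p i powi \<nu> i)" for p
  define f where "f p = orbit std (Yx p)" for p
  define g where "g q = orbit w (solution (normal_rep q) (V q))" for q
  have T: "openin (subzar n w Z) ?T" by (rule openin_torus[OF kollar_points_subset])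
  have HT: "openin (subzar n std (hyp_points n)) (hyp_torus n)" by (rule openin_hyp_torus)
  have f_torus: "f p \<in> hyp_torus n" if "p \<in> ?T" for p
    using model_of_point[OF that] unfolding f_def model_def by (intro orbit_in_hyp_torus[OF n_ge_1(1)]) auto
  have model: "model (normal_rep q) (V q)" if "q \<in> hyp_torus n" for q
  proof -
    note N = normal_rep_mem[OF n_ge_1(1) that]
    have "q \<in> wproj n std" "\<forall>y\<in>q. (\<Sum>i=1..n. y i) = 0"
      using that unfolding torus_def hyp_points_def by auto
    then show ?thesis unfolding model_def V_def ws_eq using N wproj_point(2) by auto
  qed
  interpret XX: function_space X by (rule function_space_wproj_subvariety)
  interpret H: function_space "hyp n" by (rule function_space_hyp)
  have "openin (zar (hyp n)) (hyp_torus n)" using HT by simp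
  note HT' = this
  have normal0: "normal_rep q i \<noteq> 0" if "q \<in> hyp_torus n" "i \<in> {1..n}" for q i
    by (rule normal_rep_mem(4)[OF n_ge_1(1) that])
  note fn = funs_normal_rep[OF n_ge_1(1)]
  have V: "V \<in> funs (hyp n) (hyp_torus n)"
    unfolding V_def[abs_def] by (intro H.funs_prod[OF HT'] H.funs_powi[OF HT'] fn normal0)
  interpret F: coordinate_map X ?T Yx n std "hyp_points n"
  proof
    show "orbit std (Yx p) \<in> hyp_points n" if "p \<in> ?T" for p
      using f_torus[OF that] unfolding f_def torus_def by simp
  qed (use T hyp_points_subset funs_Yx in simp_all)
  interpret G: coordinate_map "hyp n" "hyp_torus n" "\<lambda>q. solution (normal_rep q) (V q)" n w Z
  proof
    show "(\<lambda>q. solution (normal_rep q) (V q) i) \<in> funs (hyp n) (hyp_torus n)" if "i \<in> {1..n}" for i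
      by (rule H.funs_solution[OF kollar_axioms HT' fn V model that])
    show "orbit w (solution (normal_rep q) (V q)) \<in> Z" if "q \<in> hyp_torus n" for q
      using solution_in_torus[OF model[OF that]] unfolding torus_def by simp
  qed (use HT kollar_points_subset in simp_all)
  have "birational_map X (hyp n) ?T f"
    unfolding birational_map_def
  proof (intro conjI exI[of _ "hyp_torus n"] exI[of _ g] ballI)
    show "dense_open X ?T" by (rule dense_kollar_torus)
    show "dense_open (hyp n) (hyp_torus n)" using n3 by (intro dense_open_hyp_torus) simp
    show "morphism (open_subspace X ?T) (open_subspace (hyp n) (hyp_torus n)) f"
      using F.morphism_coordinate_map[OF HT] f_torus unfolding f_def hyp_def by simp
    show "morphism (open_subspace (hyp n) (hyp_torus n)) (open_subspace X ?T) g"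
      using G.morphism_coordinate_map[OF T] solution_in_torus[OF model] unfolding g_def by simp
  next
    fix p assume p: "p \<in> ?T"
    note m = model_of_point[OF p]
    have "normal_rep (f p) = Yx p"
      using normal_rep_orbit[OF n_ge_1(1), of "Yx p"] f_torus[OF p] m unfolding f_def model_def by simp
    moreover from this have "V (f p) = Vx p" using m unfolding V_def model_def ws_eq by simp
    ultimately show "g (f p) = p" using solution_of_point[OF p] unfolding g_def by simp
  next
    fix q assume q: "q \<in> hyp_torus n"
    show "f (g q) = q"
      using point_of_solution[OF model[OF q]] normal_rep_mem(3)[OF n_ge_1(1) q] unfolding f_def g_def by simp
  qed
  then show ?thesis unfolding birational_def kollar_hypersurface_eq by blast
qed

text \<open>The substitution \<open>V = z \<Prod>\<^sub>i Y\<^sub>i\<^sup>k\<close> with \<open>\<nu>\<^sub>i = k\<^sub>i w\<^sup>* + \<mu>\<^sub>i\<close> turns the condition on \<open>V\<close> into the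
  equation of the cover.\<close>

lemma birational_cover:
  assumes ws_eq: "ws > 1"
  shows "birational (kollar_hypersurface n a) (Y' n a)"
proof -
  interpret cyclic_cover n a
    by unfold_locales (use n_ge_1 ws_eq tt_eq in auto)
  let ?T = "torus n w Z"
  define k where "k i = \<nu> i div int (wstar n a)" for i
  define M where "M Y = (\<Prod>i=1..n. Y i powi k i)" for Y :: vec
  have nu_k: "\<nu> i = k i * int (wstar n a) + int (mu n a i)" for i
    using nu_mu[of i] unfolding k_def by (simp add: mult.commute)
  have M_power: "(\<Prod>i=1..n. Y i powi \<nu> i) = M Y ^ wstar n a * branch Y" if "\<forall>i\<in>{1..n}. Y i \<noteq> 0" for Y
    unfolding M_def branch_def prod_power_distrib prod.distrib[symmetric]
    using that by (intro prod.cong refl) (simp add: nu_k power_int_add power_int_mult)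
  have M0: "M Y \<noteq> 0" if "\<forall>i\<in>{1..n}. Y i \<noteq> 0" for Y
    unfolding M_def using that by simp
  have cover_iff: "on_cover Y (V / M Y) \<longleftrightarrow> model Y V" if "Y 1 = 1" for Y V
  proof (cases "\<forall>i\<in>{1..n}. Y i \<noteq> 0")
    case True
    have "(V / M Y) ^ wstar n a = branch Y \<longleftrightarrow> V ^ wstar n a = M Y ^ wstar n a * branch Y"
      using M0[OF True] by (simp add: power_divide divide_eq_eq mult.commute)
    then show ?thesis unfolding on_cover_def model_def using True that M_power[OF True] by simp
  qed (auto simp: on_cover_def model_def)
  define Zx where "Zx p = Vx p / M (Yx p)" for p
  define V where "V q = fiber_coord q * M (normal_rep (fst q))" for q :: "(point, cover_section) spec_point"
  define f where "f p = cover_point (Yx p) (Zx p)" for p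
  define g where "g q = orbit w (solution (normal_rep (fst q)) (V q))" for q :: "(point, cover_section) spec_point"
  have T: "openin (subzar n w Z) ?T" by (rule openin_torus[OF kollar_points_subset])
  have Yx0: "\<forall>i\<in>{1..n}. Yx p i \<noteq> 0" and Yx1: "Yx p 1 = 1" if "p \<in> ?T" for p
    using model_of_point[OF that] unfolding model_def by auto
  have on_cover_f: "on_cover (Yx p) (Zx p)" if "p \<in> ?T" for p
    unfolding Zx_def using cover_iff[of "Yx p" "Vx p"] Yx1[OF that] model_of_point[OF that] by simp
  have norm: "\<forall>i\<in>{1..n}. normal_rep (fst q) i \<noteq> 0" "normal_rep (fst q) 1 = 1" "q \<in> S" "fst q \<in> hyp_torus n"
    if "q \<in> cover_torus" for q
    using that normal_rep_mem[OF n_ge_1(1), of "fst q"] unfolding cover_torus_def by auto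
  have V_div: "V q / M (normal_rep (fst q)) = fiber_coord q" if "q \<in> cover_torus" for q
    unfolding V_def using M0[OF norm(1)[OF that]] by simp
  have model: "model (normal_rep (fst q)) (V q)" if "q \<in> cover_torus" for q
    using cover_iff[of "normal_rep (fst q)" "V q"] norm(2)[OF that] V_div[OF that] normal_rep_on_cover[OF norm(3,4)[OF that]] by simp
  interpret XX: function_space X by (rule function_space_wproj_subvariety)
  interpret YY: function_space "Y' n a" by (rule function_space_Y')
  have T': "openin (zar X) ?T" using T by simp
  have CT: "openin (zar (Y' n a)) cover_torus" using openin_cover_torus by simp
  have fn: "(\<lambda>q. normal_rep (fst q) i) \<in> funs (Y' n a) cover_torus" if "i \<in> {1..n}" for i
    using funs_fst(1)[OF openin_hyp_torus funs_normal_rep[OF n_ge_1(1) that]] unfolding cover_torus_def .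
  have V: "V \<in> funs (Y' n a) cover_torus"
    unfolding V_def[abs_def] M_def
    by (intro YY.funs_mult[OF CT] funs_fiber_coord YY.funs_prod[OF CT] YY.funs_powi[OF CT] fn) (use norm(1) in auto)
  have "(\<lambda>p. Vx p * inverse (M (Yx p))) \<in> funs X ?T"
    using M0[OF Yx0] unfolding M_def
    by (intro XX.funs_mult[OF T'] XX.funs_inverse[OF T'] XX.funs_prod[OF T'] XX.funs_powi[OF T'] funs_Yx funs_Vx) (use Yx0 in auto)
  then have Zx: "Zx \<in> funs X ?T" unfolding Zx_def[abs_def] divide_inverse .
  interpret F: cover_map n a X ?T Yx Zx
  proof
    show "orbit std (Yx p) \<in> hyp_points n" if "p \<in> ?T" for p
      using on_cover_torus[OF on_cover_f[OF that]] unfolding torus_def by simp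
  qed (use T hyp_points_subset funs_Yx Zx on_cover_f in simp_all)
  interpret G: coordinate_map "Y' n a" cover_torus "\<lambda>q. solution (normal_rep (fst q)) (V q)" n w Z
  proof
    show "(\<lambda>q. solution (normal_rep (fst q)) (V q) i) \<in> funs (Y' n a) cover_torus" if "i \<in> {1..n}" for i
      by (rule YY.funs_solution[OF kollar_axioms CT fn V model that])
    show "orbit w (solution (normal_rep (fst q)) (V q)) \<in> Z" if "q \<in> cover_torus" for q
      using solution_in_torus[OF model[OF that]] unfolding torus_def by simp
  qed (use CT kollar_points_subset in simp_all)
  have "birational_map X (Y' n a) ?T f"
    unfolding birational_map_def
  proof (intro conjI exI[of _ cover_torus] exI[of _ g] ballI)
    show "dense_open X ?T" by (rule dense_kollar_torus)
    show "dense_open (Y' n a) cover_torus" by (rule dense_open_cover_torus)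
    show "morphism (open_subspace X ?T) (open_subspace (Y' n a) cover_torus) f"
      using F.morphism_cover_map unfolding f_def .
    show "morphism (open_subspace (Y' n a) cover_torus) (open_subspace X ?T) g"
      using G.morphism_coordinate_map[OF T] solution_in_torus[OF model] unfolding g_def by simp
  next
    fix p assume p: "p \<in> ?T"
    have "fst (f p) = orbit std (Yx p)" unfolding f_def cover_point_def by simp
    then have "normal_rep (fst (f p)) = Yx p"
      using normal_rep_orbit[OF n_ge_1(1) on_cover_torus[OF on_cover_f[OF p]] Yx1[OF p]] by simp
    moreover from this have "V (f p) = Vx p"
      using fiber_coord_cover_point[OF on_cover_f[OF p] Yx1[OF p]] M0[OF Yx0[OF p]]
      unfolding V_def by (simp add: f_def Zx_def)
    ultimately show "g (f p) = p" using solution_of_point[OF p] unfolding g_def by simp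
  next
    fix q assume q: "q \<in> cover_torus"
    have "Yx (g q) = normal_rep (fst q)" "Zx (g q) = fiber_coord q"
      using point_of_solution[OF model[OF q]] V_div[OF q] unfolding g_def Zx_def by simp_all
    then show "f (g q) = q" using cover_point_fiber_coord[OF norm(3,4)[OF q]] unfolding f_def by simp
  qed
  then show ?thesis unfolding birational_def kollar_hypersurface_eq by blast
qed

end

theorem corollary2p4:
  fixes n :: nat and a :: "nat \<Rightarrow> nat"
  assumes "n \<ge> 3" and "kollar_type n a"
  shows "(wstar n a > 1 \<longrightarrow> birational (kollar_hypersurface n a) (Y' n a)) \<and>
         (wstar n a = 1 \<longrightarrow> birational (kollar_hypersurface n a) (hyp n))"
proof -
  interpret kollar n a by unfold_locales (rule assms)+
  show ?thesis using birational_cover birational_hyp by blast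
qed

end
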